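(* Let $R$ be a commutative ring, let $$0 \longrightarrow J \longrightarrow A \longrightarrow A' \longrightarrow 0$$ be a singular extension of $R$-algebras, and let $T$ be an $R$-algebra. Then the connecting homomorphism $$\partial\colon \operatorname{Tor}_*^R(T, A') \longrightarrow \operatorname{Tor}_{*-1}^R(T, J)$$ is a derivation with respect to the natural biaction of $\operatorname{Tor}_*^R(T, A')$ on $\operatorname{Tor}_*^R(T,J)$. That is, for all $\alpha\in \operatorname{Tor}_p^R(T,A')$ and $\beta\in\operatorname{Tor}_q^R(T,A')$, $$\partial(\alpha\cdot\beta) = \partial(\alpha)\cdot\beta + (-1)^p\,\alpha\cdot\partial(\beta).$$
   Context: Rings are commutative with unit. The $R$-algebras $A$ and $A'$ are associative and unital; $T$ is a commutative unital $R$-algebra. Unlabelled $\otimes$ means $\otimes_R$. A singular extension of $R$-algebras is a short exact sequence of $R$-modules $0\to J\to A\xrightarrow{p} A'\to 0$ in which $p$ is a surjection of $R$-algebras with kernel $J$, and the multiplication of $A$ restricted to $J$ is trivial ($J\cdot J=0$). Equivalently, the $A$-bimodule structure of $J$ comes from an $A'$-bimodule structure. $\operatorname{Tor}_*^R(T,-)$ is computed as the homology of $T\otimes Q_*$, where $Q_*$ is a projective resolution of the second argument. The connecting homomorphism is the usual one: choose projective resolutions $P_*\to J$, $Q_*\to A$, $Q'_*\to A'$ fitting into a short exact sequence of complexes $0\to P_*\to Q_*\to Q'_*\to 0$ over the extension; represent a class by a cycle in $T\otimes Q'_*$, lift it to $T\otimes Q_*$, apply the differential and lift the result to $T\otimes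 P_*$. $\operatorname{Tor}_*^R(T,A')$ is a graded $T$-algebra under the product $$\operatorname{Tor}_*^R(T,A')\otimes_T\operatorname{Tor}_*^R(T,A')\to\operatorname{Tor}_*^R(T,A'\otimes A')\to\operatorname{Tor}_*^R(T,A'),$$ where the first map is the Künneth map and the second is induced by multiplication. The biaction of $\operatorname{Tor}_*^R(T,A')$ on $\operatorname{Tor}_*^R(T,J)$ is given by $$\operatorname{Tor}_*^R(T, A') \otimes_T \operatorname{Tor}_*^R(T, J) \to \operatorname{Tor}_*^R(T, A'\otimes J) \to \operatorname{Tor}_*^R(T, J),$$ $$\operatorname{Tor}_*^R(T, J) \otimes_T \operatorname{Tor}_*^R(T, A') \to \operatorname{Tor}_*^R(T, J\otimes A') \to \operatorname{Tor}_*^R(T, J),$$ where the first maps are Künneth maps and the second maps are induced by the left and right actions of $A'$ on $J$. Explicitly, if $X,Y,Z$ are $R$-modules with projective resolutions $Q^X_*,Q^Y_*,Q^Z_*$, a pairing $X\otimes Y\to Z$ is lifted to a chain map $\mu\colon Q^X_*\otimes Q^Y_*\to Q^Z_*$, where the tensor product complex has differential $d(x\otimes y)=d(x)\otimes y+(-1)^{|x|}x\otimes d(y)$. The induced pairing on Tor is represented by $(t\otimes x)\cdot(t'\otimes y)=tt'\otimes\mu(x\otimes y)$. *)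

theory Defs
  imports "HOL-Algebra.Module" "HOL-Algebra.RingHom"
begin

text \<open>
  Modules over a commutative ring are records of type \<^typ>\<open>('r, 'm) module\<close>. Such a record also has the
  fields \<^const>\<open>mult\<close> and \<^const>\<open>one\<close>, which the locale \<^locale>\<open>module\<close> does not constrain;
  they are left undefined in the constructions of modules below.
\<close>

section \<open>Linear maps, algebras and singular extensions\<close>

definition mod_hom ::
  "('r, 'x) ring_scheme \<Rightarrow> ('r, 'm) module \<Rightarrow> ('r, 'n) module \<Rightarrow> ('m \<Rightarrow> 'n) set" where
  "mod_hom R M N = {f \<in> carrier M \<rightarrow> carrier N.
     (\<forall>x\<in>carrier M. \<forall>y\<in>carrier M. f (x \<oplus>\<^bsub>M\<^esub> y) = f x \<oplus>\<^bsub>N\<^esub> f y) \<and>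
     (\<forall>r\<in>carrier R. \<forall>x\<in>carrier M. f (r \<odot>\<^bsub>M\<^esub> x) = r \<odot>\<^bsub>N\<^esub> f x)}"

text \<open>The library locale \<^locale>\<open>algebra\<close> is about commutative algebras; this is the associative
  unital version.\<close>

locale assoc_algebra = module R A + ring A for R (structure) and A (structure) +
  assumes smult_mult_left:
      "\<lbrakk>r \<in> carrier R; x \<in> carrier A; y \<in> carrier A\<rbrakk> \<Longrightarrow>
       (r \<odot>\<^bsub>A\<^esub> x) \<otimes>\<^bsub>A\<^esub> y = r \<odot>\<^bsub>A\<^esub> (x \<otimes>\<^bsub>A\<^esub> y)"
    and smult_mult_right:
      "\<lbrakk>r \<in> carrier R; x \<in> carrier A; y \<in> carrier A\<rbrakk> \<Longrightarrow>
       x \<otimes>\<^bsub>A\<^esub> (r \<odot>\<^bsub>A\<^esub> y) = r \<odot>\<^bsub>A\<^esub> (x \<otimes>\<^bsub>A\<^esub> y)"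

definition singular_extension ::
  "('r, 'x) ring_scheme \<Rightarrow> ('r, 'j) module \<Rightarrow> ('r, 'a) module \<Rightarrow> ('r, 'b) module \<Rightarrow>
   ('j \<Rightarrow> 'a) \<Rightarrow> ('a \<Rightarrow> 'b) \<Rightarrow> bool" where
  "singular_extension R J A A' i p \<longleftrightarrow>
     module R J \<and> assoc_algebra R A \<and> assoc_algebra R A' \<and>
     i \<in> mod_hom R J A \<and> p \<in> mod_hom R A A' \<and> p \<in> ring_hom A A' \<and>
     inj_on i (carrier J) \<and> p ` carrier A = carrier A' \<and> i ` carrier J = a_kernel A A' p \<and>
     (\<forall>x\<in>carrier J. \<forall>y\<in>carrier J. i x \<otimes>\<^bsub>A\<^esub> i y = \<zero>\<^bsub>A\<^esub>)"

text \<open>The \<open>A'\<close>-bimodule structure of \<open>J\<close>: lift \<open>a'\<close> to \<open>A\<close> and multiply in \<open>A\<close>. The result does not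
  depend on the lift because the extension is singular.\<close>

definition left_act ::
  "('r, 'j) module \<Rightarrow> ('r, 'a) module \<Rightarrow> ('j \<Rightarrow> 'a) \<Rightarrow> ('a \<Rightarrow> 'b) \<Rightarrow> 'b \<Rightarrow> 'j \<Rightarrow> 'j" where
  "left_act J A i p a' x =
     (THE y. y \<in> carrier J \<and> (\<exists>a\<in>carrier A. p a = a' \<and> i y = a \<otimes>\<^bsub>A\<^esub> i x))"

definition right_act ::
  "('r, 'j) module \<Rightarrow> ('r, 'a) module \<Rightarrow> ('j \<Rightarrow> 'a) \<Rightarrow> ('a \<Rightarrow> 'b) \<Rightarrow> 'j \<Rightarrow> 'b \<Rightarrow> 'j" where
  "right_act J A i p x a' =
     (THE y. y \<in> carrier J \<and> (\<exists>a\<in>carrier A. p a = a' \<and> i y = i x \<otimes>\<^bsub>A\<^esub> a))"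


section \<open>Free and projective modules, quotients, direct sums\<close>

definition free_module :: "('r, 'x) ring_scheme \<Rightarrow> 's set \<Rightarrow> ('r, 's \<Rightarrow> 'r) module" where
  "free_module R S =
    \<lparr>carrier = {f. (\<forall>s. f s \<in> carrier R) \<and> finite {s. f s \<noteq> \<zero>\<^bsub>R\<^esub>} \<and> (\<forall>s. s \<notin> S \<longrightarrow> f s = \<zero>\<^bsub>R\<^esub>)},
     mult = undefined, one = undefined,
     zero = (\<lambda>_. \<zero>\<^bsub>R\<^esub>), add = (\<lambda>f g s. f s \<oplus>\<^bsub>R\<^esub> g s), smult = (\<lambda>r f s. r \<otimes>\<^bsub>R\<^esub> f s)\<rparr>"

definition free_basis :: "('r, 'x) ring_scheme \<Rightarrow> 's \<Rightarrow> 's \<Rightarrow> 'r" where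
  "free_basis R s = (\<lambda>t. if t = s then \<one>\<^bsub>R\<^esub> else \<zero>\<^bsub>R\<^esub>)"

definition free_lift ::
  "('r, 'x) ring_scheme \<Rightarrow> ('r, 'm) module \<Rightarrow> ('s \<Rightarrow> 'm) \<Rightarrow> ('s \<Rightarrow> 'r) \<Rightarrow> 'm" where
  "free_lift R M b f = (\<Oplus>\<^bsub>M\<^esub>s\<in>{s. f s \<noteq> \<zero>\<^bsub>R\<^esub>}. f s \<odot>\<^bsub>M\<^esub> b s)"

text \<open>Projective means direct summand of a free module. It is no restriction to take the basis
  of the free module inside the type of \<open>M\<close>: if \<open>M\<close> is a retract of some free module, the
  canonical map onto \<open>M\<close> from the free module on the set \<open>carrier M\<close> splits.\<close>

definition projective_module :: "('r, 'x) ring_scheme \<Rightarrow> ('r, 'm) module \<Rightarrow> bool" where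
  "projective_module R M \<longleftrightarrow> module R M \<and>
     (\<exists>(S :: 'm set) s r. s \<in> mod_hom R M (free_module R S) \<and> r \<in> mod_hom R (free_module R S) M \<and>
        (\<forall>x\<in>carrier M. r (s x) = x))"

definition submodule_span ::
  "('r, 'x) ring_scheme \<Rightarrow> ('r, 'm) module \<Rightarrow> 'm set \<Rightarrow> 'm set" where
  "submodule_span R M X = \<Inter>{N. submodule N R M \<and> X \<subseteq> N}"

definition quot_module :: "('r, 'm) module \<Rightarrow> 'm set \<Rightarrow> ('r, 'm set) module" where
  "quot_module M N =
    \<lparr>carrier = a_rcosets\<^bsub>M\<^esub> N, mult = undefined, one = undefined,
     zero = N, add = set_add M, smult = (\<lambda>r X. \<Union>x\<in>X. N +>\<^bsub>M\<^esub> (r \<odot>\<^bsub>M\<^esub> x))\<rparr>"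

definition direct_sum :: "('i \<Rightarrow> ('r, 'm) module) \<Rightarrow> ('r, 'i \<Rightarrow> 'm) module" where
  "direct_sum M =
    \<lparr>carrier = {w. (\<forall>i. w i \<in> carrier (M i)) \<and> finite {i. w i \<noteq> \<zero>\<^bsub>M i\<^esub>}},
     mult = undefined, one = undefined,
     zero = (\<lambda>i. \<zero>\<^bsub>M i\<^esub>), add = (\<lambda>v w i. v i \<oplus>\<^bsub>M i\<^esub> w i), smult = (\<lambda>r w i. r \<odot>\<^bsub>M i\<^esub> w i)\<rparr>"

definition direct_sum_in :: "('i \<Rightarrow> ('r, 'm) module) \<Rightarrow> 'i \<Rightarrow> 'm \<Rightarrow> 'i \<Rightarrow> 'm" where
  "direct_sum_in M i x = (\<lambda>j. if j = i then x else \<zero>\<^bsub>M j\<^esub>)"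

text \<open>Multiplication by \<open>(-1)\<^sup>p\<close> in the module \<open>M\<close>.\<close>

definition sign_act :: "('r, 'm) module \<Rightarrow> int \<Rightarrow> 'm \<Rightarrow> 'm" where
  "sign_act M p x = (if even p then x else \<ominus>\<^bsub>M\<^esub> x)"


section \<open>Tensor products\<close>

type_synonym ('r, 'm, 'n) tensor = "('m \<times> 'n \<Rightarrow> 'r) set"

definition tensor_free ::
  "('r, 'x) ring_scheme \<Rightarrow> ('r, 'm) module \<Rightarrow> ('r, 'n) module \<Rightarrow> ('r, 'm \<times> 'n \<Rightarrow> 'r) module" where
  "tensor_free R M N = free_module R (carrier M \<times> carrier N)"

definition tensor_rels ::
  "('r, 'x) ring_scheme \<Rightarrow> ('r, 'm) module \<Rightarrow> ('r, 'n) module \<Rightarrow> ('m \<times> 'n \<Rightarrow> 'r) set" where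
  "tensor_rels R M N =
    (let F = tensor_free R M N; e = (\<lambda>x y. free_basis R (x, y)) in
     submodule_span R F
       ({e (x \<oplus>\<^bsub>M\<^esub> x') y \<ominus>\<^bsub>F\<^esub> (e x y \<oplus>\<^bsub>F\<^esub> e x' y) | x x' y.
           x \<in> carrier M \<and> x' \<in> carrier M \<and> y \<in> carrier N} \<union>
        {e x (y \<oplus>\<^bsub>N\<^esub> y') \<ominus>\<^bsub>F\<^esub> (e x y \<oplus>\<^bsub>F\<^esub> e x y') | x y y'.
           x \<in> carrier M \<and> y \<in> carrier N \<and> y' \<in> carrier N} \<union>
        {e (r \<odot>\<^bsub>M\<^esub> x) y \<ominus>\<^bsub>F\<^esub> r \<odot>\<^bsub>F\<^esub> e x y | r x y.
           r \<in> carrier R \<and> x \<in> carrier M \<and> y \<in> carrier N} \<union>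
        {e x (r \<odot>\<^bsub>N\<^esub> y) \<ominus>\<^bsub>F\<^esub> r \<odot>\<^bsub>F\<^esub> e x y | r x y.
           r \<in> carrier R \<and> x \<in> carrier M \<and> y \<in> carrier N}))"

definition tensor ::
  "('r, 'x) ring_scheme \<Rightarrow> ('r, 'm) module \<Rightarrow> ('r, 'n) module \<Rightarrow> ('r, ('r, 'm, 'n) tensor) module" where
  "tensor R M N = quot_module (tensor_free R M N) (tensor_rels R M N)"

definition pure_tensor ::
  "('r, 'x) ring_scheme \<Rightarrow> ('r, 'm) module \<Rightarrow> ('r, 'n) module \<Rightarrow> 'm \<Rightarrow> 'n \<Rightarrow> ('r, 'm, 'n) tensor" where
  "pure_tensor R M N x y = tensor_rels R M N +>\<^bsub>tensor_free R M N\<^esub> free_basis R (x, y)"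

text \<open>The linear map into \<open>L\<close> induced by a bilinear map \<open>b\<close>, i.e.\ \<open>x \<otimes> y \<mapsto> b x y\<close>.\<close>

definition tensor_lift ::
  "('r, 'x) ring_scheme \<Rightarrow> ('r, 'l) module \<Rightarrow> ('m \<Rightarrow> 'n \<Rightarrow> 'l) \<Rightarrow> ('r, 'm, 'n) tensor \<Rightarrow> 'l" where
  "tensor_lift R L b U = the_elem (free_lift R L (case_prod b) ` U)"

text \<open>The map \<open>f \<otimes> g\<close> with values in the tensor product of \<open>M'\<close> and \<open>N'\<close>.\<close>

definition tensor_map ::
  "('r, 'x) ring_scheme \<Rightarrow> ('r, 'm') module \<Rightarrow> ('r, 'n') module \<Rightarrow> ('m \<Rightarrow> 'm') \<Rightarrow> ('n \<Rightarrow> 'n') \<Rightarrow>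
   ('r, 'm, 'n) tensor \<Rightarrow> ('r, 'm', 'n') tensor" where
  "tensor_map R M' N' f g = tensor_lift R (tensor R M' N') (\<lambda>x y. pure_tensor R M' N' (f x) (g y))"


section \<open>Chain complexes and projective resolutions\<close>

record ('r, 'm) chain_complex =
  cmod :: "int \<Rightarrow> ('r, 'm) module"
  cdiff :: "int \<Rightarrow> 'm \<Rightarrow> 'm"

definition is_complex :: "('r, 'x) ring_scheme \<Rightarrow> ('r, 'm, 'z) chain_complex_scheme \<Rightarrow> bool" where
  "is_complex R C \<longleftrightarrow> (\<forall>n. module R (cmod C n) \<and>
     cdiff C n \<in> mod_hom R (cmod C n) (cmod C (n - 1)) \<and>
     (\<forall>x\<in>carrier (cmod C n). cdiff C (n - 1) (cdiff C n x) = \<zero>\<^bsub>cmod C (n - 2)\<^esub>))"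

definition chain_map ::
  "('r, 'x) ring_scheme \<Rightarrow> ('r, 'm, 'z) chain_complex_scheme \<Rightarrow> ('r, 'n, 'w) chain_complex_scheme \<Rightarrow>
   (int \<Rightarrow> 'm \<Rightarrow> 'n) \<Rightarrow> bool" where
  "chain_map R C D f \<longleftrightarrow> (\<forall>n. f n \<in> mod_hom R (cmod C n) (cmod D n) \<and>
     (\<forall>x\<in>carrier (cmod C n). f (n - 1) (cdiff C n x) = cdiff D n (f n x)))"

definition cycles :: "('r, 'm, 'z) chain_complex_scheme \<Rightarrow> int \<Rightarrow> 'm set" where
  "cycles C n = {x \<in> carrier (cmod C n). cdiff C n x = \<zero>\<^bsub>cmod C (n - 1)\<^esub>}"

definition boundaries :: "('r, 'm, 'z) chain_complex_scheme \<Rightarrow> int \<Rightarrow> 'm set" where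
  "boundaries C n = cdiff C (n + 1) ` carrier (cmod C (n + 1))"

definition homology :: "('r, 'm, 'z) chain_complex_scheme \<Rightarrow> int \<Rightarrow> ('r, 'm set) module" where
  "homology C n = quot_module (cmod C n\<lparr>carrier := cycles C n\<rparr>) (boundaries C n)"

definition homology_class :: "('r, 'm, 'z) chain_complex_scheme \<Rightarrow> int \<Rightarrow> 'm \<Rightarrow> 'm set" where
  "homology_class C n x = boundaries C n +>\<^bsub>cmod C n\<^esub> x"

record ('r, 'm, 'a) resolution = "('r, 'm) chain_complex" +
  aug :: "'m \<Rightarrow> 'a"

definition projective_resolution ::
  "('r, 'x) ring_scheme \<Rightarrow> ('r, 'a) module \<Rightarrow> ('r, 'm, 'a) resolution \<Rightarrow> bool" where
  "projective_resolution R M Q \<longleftrightarrow>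
     module R M \<and> is_complex R Q \<and> (\<forall>n. projective_module R (cmod Q n)) \<and>
     (\<forall>n<0. carrier (cmod Q n) = {\<zero>\<^bsub>cmod Q n\<^esub>}) \<and>
     (\<forall>n>0. cycles Q n = boundaries Q n) \<and>
     aug Q \<in> mod_hom R (cmod Q 0) M \<and> aug Q ` carrier (cmod Q 0) = carrier M \<and>
     a_kernel (cmod Q 0) M (aug Q) = boundaries Q 0"

definition short_exact_complexes ::
  "('r, 'x) ring_scheme \<Rightarrow> ('r, 'l, 'u) chain_complex_scheme \<Rightarrow> ('r, 'm, 'v) chain_complex_scheme \<Rightarrow>
   ('r, 'n, 'w) chain_complex_scheme \<Rightarrow> (int \<Rightarrow> 'l \<Rightarrow> 'm) \<Rightarrow> (int \<Rightarrow> 'm \<Rightarrow> 'n) \<Rightarrow> bool" where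
  "short_exact_complexes R P Q Q' f g \<longleftrightarrow> chain_map R P Q f \<and> chain_map R Q Q' g \<and>
     (\<forall>n. inj_on (f n) (carrier (cmod P n)) \<and>
       f n ` carrier (cmod P n) = a_kernel (cmod Q n) (cmod Q' n) (g n) \<and>
       g n ` carrier (cmod Q n) = carrier (cmod Q' n))"

text \<open>The tensor product complex: in degree \<open>n\<close> the direct sum over all \<open>p\<close> of \<open>X\<^sub>p \<otimes> Y\<^bsub>n-p\<^esub>\<close>,
  with \<open>d (x \<otimes> y) = d x \<otimes> y + (-1)\<^sup>p x \<otimes> d y\<close> for \<open>x\<close> of degree \<open>p\<close>. The component \<open>p\<close> of \<open>d w\<close>
  receives contributions from the components \<open>p + 1\<close> and \<open>p\<close> of \<open>w\<close>.\<close>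

definition tensor_complex ::
  "('r, 'x) ring_scheme \<Rightarrow> ('r, 'm, 'u) chain_complex_scheme \<Rightarrow> ('r, 'n, 'v) chain_complex_scheme \<Rightarrow>
   ('r, int \<Rightarrow> ('r, 'm, 'n) tensor) chain_complex" where
  "tensor_complex R X Y =
    \<lparr>cmod = (\<lambda>n. direct_sum (\<lambda>p. tensor R (cmod X p) (cmod Y (n - p)))),
     cdiff = (\<lambda>n w p.
       tensor_map R (cmod X p) (cmod Y (n - 1 - p)) (cdiff X (p + 1)) id (w (p + 1))
       \<oplus>\<^bsub>tensor R (cmod X p) (cmod Y (n - 1 - p))\<^esub>
       sign_act (tensor R (cmod X p) (cmod Y (n - 1 - p))) p
         (tensor_map R (cmod X p) (cmod Y (n - 1 - p)) id (cdiff Y (n - p)) (w p)))\<rparr>"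


section \<open>Tor, its pairings and the connecting homomorphism\<close>

definition base_change ::
  "('r, 'x) ring_scheme \<Rightarrow> ('r, 't) module \<Rightarrow> ('r, 'm, 'z) chain_complex_scheme \<Rightarrow>
   ('r, ('r, 't, 'm) tensor) chain_complex" where
  "base_change R T C =
    \<lparr>cmod = (\<lambda>n. tensor R T (cmod C n)),
     cdiff = (\<lambda>n. tensor_map R T (cmod C (n - 1)) id (cdiff C n))\<rparr>"

text \<open>\<open>Tor\<^sub>n(T, M)\<close>, computed from the projective resolution \<open>Q\<close> of \<open>M\<close>.\<close>

definition Tor ::
  "('r, 'x) ring_scheme \<Rightarrow> ('r, 't) module \<Rightarrow> ('r, 'm, 'a) resolution \<Rightarrow> int \<Rightarrow>
   ('r, ('r, 't, 'm) tensor set) module" where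
  "Tor R T Q n = homology (base_change R T Q) n"

text \<open>\<open>\<mu>\<close> is a chain map lifting the pairing \<open>L \<otimes> M \<rightarrow> N\<close> given by the bilinear map \<open>b\<close>.\<close>

definition lifts_pairing ::
  "('r, 'x) ring_scheme \<Rightarrow> ('r, 'a) module \<Rightarrow> ('r, 'b) module \<Rightarrow> ('r, 'c) module \<Rightarrow> ('a \<Rightarrow> 'b \<Rightarrow> 'c) \<Rightarrow>
   ('r, 'l, 'a) resolution \<Rightarrow> ('r, 'm, 'b) resolution \<Rightarrow> ('r, 'n, 'c) resolution \<Rightarrow>
   (int \<Rightarrow> (int \<Rightarrow> ('r, 'l, 'm) tensor) \<Rightarrow> 'n) \<Rightarrow> bool" where
  "lifts_pairing R L M N b X Y Z \<mu> \<longleftrightarrow> chain_map R (tensor_complex R X Y) Z \<mu> \<and>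
     (\<forall>w\<in>carrier (cmod (tensor_complex R X Y) 0).
        aug Z (\<mu> 0 w) = tensor_lift R N b (tensor_map R L M (aug X) (aug Y) (w 0)))"

text \<open>\<open>(t \<otimes> x) \<cdot> (t' \<otimes> y) = t t' \<otimes> \<mu> (x \<otimes> y)\<close> for \<open>x\<close> of degree \<open>p\<close> and \<open>y\<close> of degree \<open>q\<close>.\<close>

definition chain_pairing ::
  "('r, 'x) ring_scheme \<Rightarrow> ('r, 't) module \<Rightarrow>
   ('r, 'l, 'a) resolution \<Rightarrow> ('r, 'm, 'b) resolution \<Rightarrow> ('r, 'n, 'c) resolution \<Rightarrow>
   (int \<Rightarrow> (int \<Rightarrow> ('r, 'l, 'm) tensor) \<Rightarrow> 'n) \<Rightarrow> int \<Rightarrow> int \<Rightarrow>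
   ('r, 't, 'l) tensor \<Rightarrow> ('r, 't, 'm) tensor \<Rightarrow> ('r, 't, 'n) tensor" where
  "chain_pairing R T X Y Z \<mu> p q u v =
    (let TZ = tensor R T (cmod Z (p + q));
         XY = (\<lambda>j. tensor R (cmod X j) (cmod Y (p + q - j))) in
     tensor_lift R TZ (\<lambda>t x.
       tensor_lift R TZ (\<lambda>t' y.
         pure_tensor R T (cmod Z (p + q)) (t \<otimes>\<^bsub>T\<^esub> t')
           (\<mu> (p + q) (direct_sum_in XY p (pure_tensor R (cmod X p) (cmod Y q) x y)))) v) u)"

definition Tor_pairing ::
  "('r, 'x) ring_scheme \<Rightarrow> ('r, 't) module \<Rightarrow>
   ('r, 'l, 'a) resolution \<Rightarrow> ('r, 'm, 'b) resolution \<Rightarrow> ('r, 'n, 'c) resolution \<Rightarrow>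
   (int \<Rightarrow> (int \<Rightarrow> ('r, 'l, 'm) tensor) \<Rightarrow> 'n) \<Rightarrow> int \<Rightarrow> int \<Rightarrow>
   ('r, 't, 'l) tensor set \<Rightarrow> ('r, 't, 'm) tensor set \<Rightarrow> ('r, 't, 'n) tensor set" where
  "Tor_pairing R T X Y Z \<mu> p q \<alpha> \<beta> =
    (THE \<gamma>. \<exists>u\<in>\<alpha>. \<exists>v\<in>\<beta>.
       \<gamma> = homology_class (base_change R T Z) (p + q) (chain_pairing R T X Y Z \<mu> p q u v))"

definition connecting ::
  "('r, 'x) ring_scheme \<Rightarrow> ('r, 't) module \<Rightarrow>
   ('r, 'l, 'a) resolution \<Rightarrow> ('r, 'm, 'b) resolution \<Rightarrow> ('r, 'n, 'c) resolution \<Rightarrow>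
   (int \<Rightarrow> 'l \<Rightarrow> 'm) \<Rightarrow> (int \<Rightarrow> 'm \<Rightarrow> 'n) \<Rightarrow> int \<Rightarrow>
   ('r, 't, 'n) tensor set \<Rightarrow> ('r, 't, 'l) tensor set" where
  "connecting R T P Q Q' f g n \<alpha> =
    (THE \<gamma>. \<exists>z\<in>\<alpha>. \<exists>y\<in>carrier (cmod (base_change R T Q) n).
       \<exists>x\<in>carrier (cmod (base_change R T P) (n - 1)).
         tensor_map R T (cmod Q' n) id (g n) y = z \<and>
         tensor_map R T (cmod Q (n - 1)) id (f (n - 1)) x = cdiff (base_change R T Q) n y \<and>
         \<gamma> = homology_class (base_change R T P) (n - 1) x)"

end

theory Submission
  imports Defs
begin

text \<open>
  Choose linear sections \<open>s\<close> of \<open>Q \<rightarrow> Q'\<close> and let \<open>\<tau> = d s - s d\<close>, viewed as a map of degree \<open>-1\<close> from \<open>Q'\<close> to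
  \<open>P\<close>. It anticommutes with the differentials and induces the connecting homomorphism. The defect
  \<open>D (x, y) = \<tau> \<mu> (x, y) - \<mu>r (\<tau> x, y) - (-1)\<^sup>p \<mu>l (x, \<tau> y)\<close> satisfies \<open>d D (x, y) = - D (d x, y) - (-1)\<^sup>p D (x, d y)\<close>,
  so it can be contracted inductively: there are bilinear maps \<open>h\<close> from \<open>Q'\<^sub>p \<times> Q'\<^sub>q\<close> to \<open>P\<^bsub>p+q\<^esub>\<close> with
  \<open>d h (x, y) = D (x, y) + h (d x, y) + (-1)\<^sup>p h (x, d y)\<close>. Each step lifts a bilinear map on projective
  modules along a map of \<open>P\<close>, so no projectivity of tensor products is needed. Tensoring with \<open>T\<close>, the
  defect of two cycles becomes a boundary, whatever lifts \<open>\<mu>\<close>, \<open>\<mu>l\<close>, \<open>\<mu>r\<close> were chosen.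
\<close>

section \<open>Linear and bilinear maps\<close>

text \<open>Exactness of \<open>P\<close> contracts the defect in every total degree above 1. In
  total degree 1 the defect takes values in \<open>P\<^sub>0\<close>, where \<open>P\<close> is not
  exact, and its image in \<open>J\<close> has to be removed by means of the ring structure. Let
  \<sigma> be the section on \<open>Q'\<^sub>0\<close> followed by the augmentation to
  \<open>A\<close>. Then \<sigma> d takes values in the image of \<open>J\<close> and equals, up to
  sign, the image of \<tau> there: it is a cocycle classifying \<open>A\<close> as an extension of
  modules. Products of \<open>J\<close> with \<open>A'\<close> may be computed with any lift to
  \<open>A\<close>, in particular with \<sigma>; this is the point at which J J = 0 enters. So for
  \<open>x\<close> of degree 1 and \<open>y\<close> of degree 0 the defect has image \<sigma>(d x)
  \<sigma>(y) - \<sigma>((d x) y) in \<open>A\<close>. This is the expression \<sigma>(x)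
  \<sigma>(y) - \<sigma>(x y) evaluated at d x and y, and that expression is \<open>J\<close>-valued
  on all of \<open>Q'\<^sub>0\<close> because \<pi> is multiplicative. Bidegree (0, 1) is symmetric.
  The sign \<open>(-1)\<^sup>p\<close> in the formula is the Koszul sign for moving \<tau>, a map of
  degree -1, past an element of degree \<open>p\<close>.\<close>

lemma mod_homI:
  assumes "\<And>x. x \<in> carrier M \<Longrightarrow> f x \<in> carrier N"
    and "\<And>x y. \<lbrakk>x \<in> carrier M; y \<in> carrier M\<rbrakk> \<Longrightarrow> f (x \<oplus>\<^bsub>M\<^esub> y) = f x \<oplus>\<^bsub>N\<^esub> f y"
    and "\<And>r x. \<lbrakk>r \<in> carrier R; x \<in> carrier M\<rbrakk> \<Longrightarrow> f (r \<odot>\<^bsub>M\<^esub> x) = r \<odot>\<^bsub>N\<^esub> f x"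
  shows "f \<in> mod_hom R M N"
  using assms by (auto simp: mod_hom_def)

lemma mod_hom_closed: "\<lbrakk>f \<in> mod_hom R M N; x \<in> carrier M\<rbrakk> \<Longrightarrow> f x \<in> carrier N"
  by (auto simp: mod_hom_def)

lemma mod_hom_add:
  "\<lbrakk>f \<in> mod_hom R M N; x \<in> carrier M; y \<in> carrier M\<rbrakk> \<Longrightarrow> f (x \<oplus>\<^bsub>M\<^esub> y) = f x \<oplus>\<^bsub>N\<^esub> f y"
  by (auto simp: mod_hom_def)

lemma mod_hom_smult:
  "\<lbrakk>f \<in> mod_hom R M N; r \<in> carrier R; x \<in> carrier M\<rbrakk> \<Longrightarrow> f (r \<odot>\<^bsub>M\<^esub> x) = r \<odot>\<^bsub>N\<^esub> f x"
  by (auto simp: mod_hom_def)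

lemma mod_hom_group_hom:
  assumes "module R M" "module R N" "f \<in> mod_hom R M N"
  shows "abelian_group_hom M N f"
proof -
  interpret M: module R M by fact
  interpret N: module R N by fact
  show ?thesis
    by (rule abelian_group_homI)
      (auto intro!: M.abelian_group_axioms N.abelian_group_axioms group_hom.intro M.a_group N.a_group
        group_hom_axioms.intro homI simp: mod_hom_closed[OF assms(3)] mod_hom_add[OF assms(3)])
qed

lemma mod_hom_zero:
  assumes "module R M" "module R N" "f \<in> mod_hom R M N"
  shows "f \<zero>\<^bsub>M\<^esub> = \<zero>\<^bsub>N\<^esub>"
proof -
  interpret abelian_group_hom M N f by (rule mod_hom_group_hom[OF assms])
  show ?thesis by simp
qed

lemma mod_hom_minus:
  assumes "module R M" "module R N" "f \<in> mod_hom R M N" "x \<in> carrier M"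
  shows "f (\<ominus>\<^bsub>M\<^esub> x) = \<ominus>\<^bsub>N\<^esub> f x"
proof -
  interpret abelian_group_hom M N f by (rule mod_hom_group_hom[OF assms(1-3)])
  show ?thesis using assms(4) by simp
qed

lemma mod_hom_sign:
  assumes "module R M" "module R N" "f \<in> mod_hom R M N" "x \<in> carrier M"
  shows "f (sign_act M p x) = sign_act N p (f x)"
  using mod_hom_minus[OF assms] by (simp add: sign_act_def)

lemma mod_hom_comp:
  "\<lbrakk>f \<in> mod_hom R L M; g \<in> mod_hom R M N\<rbrakk> \<Longrightarrow> (\<lambda>x. g (f x)) \<in> mod_hom R L N"
  by (rule mod_homI) (simp_all add: mod_hom_closed mod_hom_add mod_hom_smult)

lemma mod_hom_plus:
  assumes "module R N" "f \<in> mod_hom R M N" "g \<in> mod_hom R M N"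
  shows "(\<lambda>x. f x \<oplus>\<^bsub>N\<^esub> g x) \<in> mod_hom R M N"
proof -
  interpret N: module R N by fact
  show ?thesis
    by (rule mod_homI) (simp_all add: assms mod_hom_closed[OF assms(2)] mod_hom_closed[OF assms(3)]
      mod_hom_add[OF assms(2)] mod_hom_add[OF assms(3)] mod_hom_smult[OF assms(2)]
      mod_hom_smult[OF assms(3)] N.smult_r_distr N.a_ac)
qed

lemma mod_hom_uminus:
  assumes "module R N" "f \<in> mod_hom R M N"
  shows "(\<lambda>x. \<ominus>\<^bsub>N\<^esub> f x) \<in> mod_hom R M N"
proof -
  interpret N: module R N by fact
  show ?thesis
    by (rule mod_homI) (simp_all add: assms mod_hom_closed[OF assms(2)]
      mod_hom_add[OF assms(2)] mod_hom_smult[OF assms(2)] N.smult_r_minus N.minus_add)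
qed

lemma mod_hom_sign_act:
  assumes "module R N" "f \<in> mod_hom R M N"
  shows "(\<lambda>x. sign_act N p (f x)) \<in> mod_hom R M N"
  by (cases "even p") (simp_all add: mod_hom_uminus[OF assms] assms(2) sign_act_def)

lemma mod_hom_null:
  assumes "module R N" shows "(\<lambda>_. \<zero>\<^bsub>N\<^esub>) \<in> mod_hom R M N"
proof -
  interpret N: module R N by fact
  show ?thesis by (rule mod_homI) auto
qed

lemma mod_hom_id: "(\<lambda>x. x) \<in> mod_hom R M M"
  by (auto simp: mod_hom_def)

lemma mod_hom_scale:
  assumes "module R N" "f \<in> mod_hom R M N" "r \<in> carrier R"
  shows "(\<lambda>x. r \<odot>\<^bsub>N\<^esub> f x) \<in> mod_hom R M N"
proof -
  interpret N: module R N by fact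
  show ?thesis
    by (rule mod_homI) (simp_all add: assms mod_hom_closed[OF assms(2)]
      mod_hom_add[OF assms(2)] mod_hom_smult[OF assms(2)] N.smult_r_distr N.smult_assoc1[symmetric] N.R.m_comm)
qed

lemma mod_hom_finsum:
  assumes N: "module R N" and f: "\<And>s. s \<in> F \<Longrightarrow> f s \<in> mod_hom R M N"
  shows "(\<lambda>x. \<Oplus>\<^bsub>N\<^esub>s\<in>F. f s x) \<in> mod_hom R M N"
proof -
  interpret N: module R N by fact
  show ?thesis
  proof (cases "finite F")
    case True
    show ?thesis
    proof (rule mod_homI)
      fix x y assume "x \<in> carrier M" "y \<in> carrier M"
      then have "(\<Oplus>\<^bsub>N\<^esub>s\<in>F. f s (x \<oplus>\<^bsub>M\<^esub> y)) = (\<Oplus>\<^bsub>N\<^esub>s\<in>F. f s x \<oplus>\<^bsub>N\<^esub> f s y)"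
        by (intro N.finsum_cong') (auto simp: mod_hom_add[OF f] mod_hom_closed[OF f])
      then show "(\<Oplus>\<^bsub>N\<^esub>s\<in>F. f s (x \<oplus>\<^bsub>M\<^esub> y)) = (\<Oplus>\<^bsub>N\<^esub>s\<in>F. f s x) \<oplus>\<^bsub>N\<^esub> (\<Oplus>\<^bsub>N\<^esub>s\<in>F. f s y)"
        using \<open>x \<in> carrier M\<close> \<open>y \<in> carrier M\<close>
        by (simp add: N.finsum_addf Pi_def mod_hom_closed[OF f])
    next
      fix r x assume rx: "r \<in> carrier R" "x \<in> carrier M"
      then have "(\<Oplus>\<^bsub>N\<^esub>s\<in>F. f s (r \<odot>\<^bsub>M\<^esub> x)) = (\<Oplus>\<^bsub>N\<^esub>s\<in>F. r \<odot>\<^bsub>N\<^esub> f s x)"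
        by (intro N.finsum_cong') (auto simp: mod_hom_smult[OF f] mod_hom_closed[OF f])
      then show "(\<Oplus>\<^bsub>N\<^esub>s\<in>F. f s (r \<odot>\<^bsub>M\<^esub> x)) = r \<odot>\<^bsub>N\<^esub> (\<Oplus>\<^bsub>N\<^esub>s\<in>F. f s x)"
        using True rx by (simp add: N.finsum_smult_ldistr Pi_def mod_hom_closed[OF f])
    qed (auto intro!: N.finsum_closed simp: mod_hom_closed[OF f])
  \<comment> \<open>A sum over an infinite index set is zero by convention.\<close>
  qed (simp add: mod_hom_null[OF N] N.finsum_infinite)
qed

section \<open>Signs as linear maps\<close>

lemma sign_act_closed:
  assumes "module R M" "x \<in> carrier M" shows "sign_act M p x \<in> carrier M"
  using mod_hom_closed[OF mod_hom_sign_act[OF assms(1) mod_hom_id] assms(2)] .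

lemma sign_act_add:
  assumes "module R M" "x \<in> carrier M" "y \<in> carrier M"
  shows "sign_act M p (x \<oplus>\<^bsub>M\<^esub> y) = sign_act M p x \<oplus>\<^bsub>M\<^esub> sign_act M p y"
  using mod_hom_add[OF mod_hom_sign_act[OF assms(1) mod_hom_id] assms(2,3)] .

lemma sign_act_zero:
  assumes "module R M" shows "sign_act M p \<zero>\<^bsub>M\<^esub> = \<zero>\<^bsub>M\<^esub>"
  using mod_hom_zero[OF assms assms mod_hom_sign_act[OF assms mod_hom_id]] .

lemma sign_act_minus:
  assumes "module R M" "x \<in> carrier M"
  shows "sign_act M p (\<ominus>\<^bsub>M\<^esub> x) = \<ominus>\<^bsub>M\<^esub> sign_act M p x"
  using mod_hom_minus[OF assms(1) assms(1) mod_hom_sign_act[OF assms(1) mod_hom_id] assms(2)] .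

text \<open>Both \<tau> and the differential lower the degree by one, so the Leibniz rule at
  \<open>\<tau> x\<close>, or a signed term evaluated at \<open>d x\<close>, carries the opposite
  sign. All cancellations below rest on this change.\<close>

lemma sign_act_pred:
  assumes "module R M" "x \<in> carrier M"
  shows "sign_act M (p - 1) x = \<ominus>\<^bsub>M\<^esub> sign_act M p x"
proof -
  interpret M: module R M by fact
  show ?thesis using assms(2) by (simp add: sign_act_def)
qed

lemma sign_act_twice:
  assumes "module R M" "x \<in> carrier M" shows "sign_act M p (sign_act M p x) = x"
proof -
  interpret M: module R M by fact
  show ?thesis using assms(2) by (simp add: sign_act_def)
qed

text \<open>Bilinear maps are kept curried instead of being turned into linear maps on a tensor
  product. They can then be lifted by choosing values on pairs of basis elements.\<close>

definition bilin ::
  "('r, 'x) ring_scheme \<Rightarrow> ('r, 'l) module \<Rightarrow> ('r, 'm) module \<Rightarrow> ('r, 'n) module \<Rightarrow>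
   ('l \<Rightarrow> 'm \<Rightarrow> 'n) set" where
  "bilin R L M N = {b. (\<forall>x\<in>carrier L. b x \<in> mod_hom R M N) \<and>
     (\<forall>y\<in>carrier M. (\<lambda>x. b x y) \<in> mod_hom R L N)}"

lemma bilinI:
  assumes "\<And>x. x \<in> carrier L \<Longrightarrow> b x \<in> mod_hom R M N"
    and "\<And>y. y \<in> carrier M \<Longrightarrow> (\<lambda>x. b x y) \<in> mod_hom R L N"
  shows "b \<in> bilin R L M N"
  using assms by (simp add: bilin_def)

lemma bilin_left: "\<lbrakk>b \<in> bilin R L M N; y \<in> carrier M\<rbrakk> \<Longrightarrow> (\<lambda>x. b x y) \<in> mod_hom R L N"
  by (simp add: bilin_def)

lemma bilin_right: "\<lbrakk>b \<in> bilin R L M N; x \<in> carrier L\<rbrakk> \<Longrightarrow> b x \<in> mod_hom R M N"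
  by (simp add: bilin_def)

lemma bilin_closed: "\<lbrakk>b \<in> bilin R L M N; x \<in> carrier L; y \<in> carrier M\<rbrakk> \<Longrightarrow> b x y \<in> carrier N"
  using bilin_right mod_hom_closed by metis

lemma bilin_zero_left:
  "\<lbrakk>module R L; module R N; b \<in> bilin R L M N; y \<in> carrier M\<rbrakk> \<Longrightarrow> b \<zero>\<^bsub>L\<^esub> y = \<zero>\<^bsub>N\<^esub>"
  using mod_hom_zero bilin_left by metis

lemma bilin_zero_right:
  "\<lbrakk>module R M; module R N; b \<in> bilin R L M N; x \<in> carrier L\<rbrakk> \<Longrightarrow> b x \<zero>\<^bsub>M\<^esub> = \<zero>\<^bsub>N\<^esub>"
  using mod_hom_zero bilin_right by metis

lemma bilin_comp_hom:
  assumes "b \<in> bilin R L M N" "f \<in> mod_hom R N N'"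
  shows "(\<lambda>x y. f (b x y)) \<in> bilin R L M N'"
  by (rule bilinI)
    (rule mod_hom_comp[OF bilin_right[OF assms(1)] assms(2)] mod_hom_comp[OF bilin_left[OF assms(1)] assms(2)],
      assumption)+

lemma bilin_comp_left:
  assumes "b \<in> bilin R L M N" "f \<in> mod_hom R L' L"
  shows "(\<lambda>x y. b (f x) y) \<in> bilin R L' M N"
proof (rule bilinI)
  fix y assume "y \<in> carrier M"
  from mod_hom_comp[OF assms(2) bilin_left[OF assms(1) this]]
  show "(\<lambda>x. b (f x) y) \<in> mod_hom R L' N" .
qed (rule bilin_right[OF assms(1) mod_hom_closed[OF assms(2)]])

lemma bilin_comp_right:
  assumes "b \<in> bilin R L M N" "f \<in> mod_hom R M' M"
  shows "(\<lambda>x y. b x (f y)) \<in> bilin R L M' N"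
proof (rule bilinI)
  fix x assume "x \<in> carrier L"
  from mod_hom_comp[OF assms(2) bilin_right[OF assms(1) this]]
  show "(\<lambda>y. b x (f y)) \<in> mod_hom R M' N" .
qed (rule bilin_left[OF assms(1) mod_hom_closed[OF assms(2)]])

lemma bilin_plus:
  assumes "module R N" "b \<in> bilin R L M N" "c \<in> bilin R L M N"
  shows "(\<lambda>x y. b x y \<oplus>\<^bsub>N\<^esub> c x y) \<in> bilin R L M N"
  by (rule bilinI)
    (rule mod_hom_plus[OF assms(1) bilin_right[OF assms(2)] bilin_right[OF assms(3)]]
      mod_hom_plus[OF assms(1) bilin_left[OF assms(2)] bilin_left[OF assms(3)]], assumption+)+

lemma bilin_uminus:
  assumes "module R N" "b \<in> bilin R L M N"
  shows "(\<lambda>x y. \<ominus>\<^bsub>N\<^esub> b x y) \<in> bilin R L M N"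
  by (rule bilinI)
    (rule mod_hom_uminus[OF assms(1) bilin_right[OF assms(2)]]
      mod_hom_uminus[OF assms(1) bilin_left[OF assms(2)]], assumption)+

lemma bilin_sign_act:
  assumes "module R N" "b \<in> bilin R L M N"
  shows "(\<lambda>x y. sign_act N p (b x y)) \<in> bilin R L M N"
  using bilin_uminus[OF assms] assms(2) by (cases "even p") (simp_all add: sign_act_def)

lemma bilin_null: "module R N \<Longrightarrow> (\<lambda>_ _. \<zero>\<^bsub>N\<^esub>) \<in> bilin R L M N"
  by (simp add: bilin_def mod_hom_null)


section \<open>Quotients and free modules\<close>

lemma submodule_abelian_subgroup:
  assumes "module R M" "submodule N R M" shows "abelian_subgroup N M"
proof -
  interpret M: module R M by fact
  show ?thesis
    by (intro abelian_subgroupI3 additive_subgroupI submodule.axioms(1)[OF assms(2)] M.abelian_group_axioms)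
qed

lemma quot_module_simps:
  "carrier (quot_module M N) = a_rcosets\<^bsub>M\<^esub> N" "\<zero>\<^bsub>quot_module M N\<^esub> = N"
  "X \<oplus>\<^bsub>quot_module M N\<^esub> Y = X <+>\<^bsub>M\<^esub> Y"
  by (simp_all add: quot_module_def)

text \<open>The scalar multiplication of the quotient is a union over all representatives of the
  coset. The union collapses because multiples of two representatives differ by \<open>r\<close>
  times an element of \<open>N\<close>.\<close>

lemma quot_module_smult:
  assumes "module R M" "submodule N R M" "r \<in> carrier R" "x \<in> carrier M"
  shows "r \<odot>\<^bsub>quot_module M N\<^esub> (N +>\<^bsub>M\<^esub> x) = N +>\<^bsub>M\<^esub> (r \<odot>\<^bsub>M\<^esub> x)"
proof -
  interpret M: module R M by fact
  interpret N: abelian_subgroup N M by (rule submodule_abelian_subgroup[OF assms(1,2)])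
  have "N +>\<^bsub>M\<^esub> (r \<odot>\<^bsub>M\<^esub> y) = N +>\<^bsub>M\<^esub> (r \<odot>\<^bsub>M\<^esub> x)" if y: "y \<in> N +>\<^bsub>M\<^esub> x" for y
  proof (rule N.a_repr_independence'[symmetric])
    from y assms(4) have yc: "y \<in> carrier M" by (rule N.a_elemrcos_carrier[rotated])
    have "r \<odot>\<^bsub>M\<^esub> (y \<oplus>\<^bsub>M\<^esub> \<ominus>\<^bsub>M\<^esub> x) \<in> N"
      using M.submoduleE(4)[OF assms(2,3)] N.a_rcos_module_imp[OF assms(4) y] .
    then have "r \<odot>\<^bsub>M\<^esub> y \<oplus>\<^bsub>M\<^esub> \<ominus>\<^bsub>M\<^esub> (r \<odot>\<^bsub>M\<^esub> x) \<in> N"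
      using assms(3,4) yc by (simp add: M.smult_r_distr M.smult_r_minus)
    then show "r \<odot>\<^bsub>M\<^esub> y \<in> N +>\<^bsub>M\<^esub> (r \<odot>\<^bsub>M\<^esub> x)"
      using assms(3,4) yc by (intro N.a_rcos_module_rev) auto
  qed (simp add: assms)
  then have "(\<Union>y\<in>N +>\<^bsub>M\<^esub> x. N +>\<^bsub>M\<^esub> (r \<odot>\<^bsub>M\<^esub> y)) = N +>\<^bsub>M\<^esub> (r \<odot>\<^bsub>M\<^esub> x)"
    using N.a_rcos_self[OF assms(4)] by blast
  then show ?thesis by (simp add: quot_module_def)
qed

lemma quot_module_add:
  assumes "module R M" "submodule N R M" "x \<in> carrier M" "y \<in> carrier M"
  shows "(N +>\<^bsub>M\<^esub> x) \<oplus>\<^bsub>quot_module M N\<^esub> (N +>\<^bsub>M\<^esub> y) = N +>\<^bsub>M\<^esub> (x \<oplus>\<^bsub>M\<^esub> y)"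
  using abelian_subgroup.a_rcos_sum[OF submodule_abelian_subgroup[OF assms(1,2)] assms(3,4)]
  by (simp add: quot_module_simps)

lemma quot_module_carrierE:
  assumes "X \<in> carrier (quot_module M N)"
  obtains x where "x \<in> carrier M" "X = N +>\<^bsub>M\<^esub> x"
  using assms by (auto simp: quot_module_simps A_RCOSETS_def')

lemma quot_module_carrierI: "x \<in> carrier M \<Longrightarrow> N +>\<^bsub>M\<^esub> x \<in> carrier (quot_module M N)"
  by (auto simp: quot_module_simps A_RCOSETS_def')

lemma module_quot_module:
  assumes M: "module R M" and N: "submodule N R M"
  shows "module R (quot_module M N)"
proof -
  interpret M: module R M by fact
  interpret N: abelian_subgroup N M by (rule submodule_abelian_subgroup[OF M N])
  note simps = quot_module_add[OF M N] quot_module_smult[OF M N]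
  have N0: "\<zero>\<^bsub>quot_module M N\<^esub> = N +>\<^bsub>M\<^esub> \<zero>\<^bsub>M\<^esub>"
    by (simp add: quot_module_simps N.a_rcos_const)
  show ?thesis
  proof (intro moduleI abelian_groupI)
    fix X assume "X \<in> carrier (quot_module M N)"
    then obtain x where x: "x \<in> carrier M" "X = N +>\<^bsub>M\<^esub> x" by (rule quot_module_carrierE)
    then show "\<exists>Y\<in>carrier (quot_module M N). Y \<oplus>\<^bsub>quot_module M N\<^esub> X = \<zero>\<^bsub>quot_module M N\<^esub>"
      by (intro bexI[of _ "N +>\<^bsub>M\<^esub> (\<ominus>\<^bsub>M\<^esub> x)"] quot_module_carrierI) (simp_all add: N0 simps M.l_neg)
  qed (auto elim!: quot_module_carrierE intro!: quot_module_carrierI M.R.cring_axioms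
      simp: N0 simps M.smult_l_distr M.smult_r_distr M.smult_assoc1 M.a_ac)
qed

section \<open>Free modules and their universal property\<close>

lemma free_module_carrier:
  "f \<in> carrier (free_module R S) \<longleftrightarrow>
     (\<forall>s. f s \<in> carrier R) \<and> finite {s. f s \<noteq> \<zero>\<^bsub>R\<^esub>} \<and> (\<forall>s. s \<notin> S \<longrightarrow> f s = \<zero>\<^bsub>R\<^esub>)"
  by (simp add: free_module_def)

lemma free_module_simps:
  "\<zero>\<^bsub>free_module R S\<^esub> = (\<lambda>_. \<zero>\<^bsub>R\<^esub>)"
  "f \<oplus>\<^bsub>free_module R S\<^esub> g = (\<lambda>s. f s \<oplus>\<^bsub>R\<^esub> g s)"
  "r \<odot>\<^bsub>free_module R S\<^esub> f = (\<lambda>s. r \<otimes>\<^bsub>R\<^esub> f s)"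
  by (simp_all add: free_module_def)

lemma module_free_module:
  assumes "cring R" shows "module R (free_module R S)"
proof -
  interpret R: cring R by fact
  have supp: "finite {s. f s \<oplus>\<^bsub>R\<^esub> g s \<noteq> \<zero>\<^bsub>R\<^esub>}"
    if "finite {s. f s \<noteq> \<zero>\<^bsub>R\<^esub>}" "finite {s. g s \<noteq> \<zero>\<^bsub>R\<^esub>}" for f g :: "'c \<Rightarrow> 'a"
    by (rule finite_subset[OF _ finite_UnI[OF that]]) auto
  have supp2: "finite {s. \<ominus>\<^bsub>R\<^esub> f s \<noteq> \<zero>\<^bsub>R\<^esub>}" "r \<in> carrier R \<Longrightarrow> finite {s. r \<otimes>\<^bsub>R\<^esub> f s \<noteq> \<zero>\<^bsub>R\<^esub>}"
    if "finite {s. f s \<noteq> \<zero>\<^bsub>R\<^esub>}" for f :: "'c \<Rightarrow> 'a" and r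
    by (rule finite_subset[OF _ that]; auto)+
  show ?thesis
  proof (intro moduleI abelian_groupI)
    fix x assume x: "x \<in> carrier (free_module R S)"
    show "\<exists>y\<in>carrier (free_module R S). y \<oplus>\<^bsub>free_module R S\<^esub> x = \<zero>\<^bsub>free_module R S\<^esub>"
      using x by (intro bexI[of _ "\<lambda>s. \<ominus>\<^bsub>R\<^esub> x s"])
        (auto simp: free_module_carrier free_module_simps R.l_neg supp2)
  qed (auto simp: assms free_module_carrier free_module_simps supp supp2 R.a_ac
      R.l_distr R.r_distr R.m_assoc)
qed

lemma free_basis_closed:
  assumes "cring R" "s \<in> S" shows "free_basis R s \<in> carrier (free_module R S)"
proof -
  interpret R: cring R by fact
  show ?thesis using assms(2)
    by (auto simp: free_basis_def free_module_carrier intro: finite_subset[of _ "{s}"])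
qed

text \<open>\<open>free_lift\<close> sums over the support, which changes from \<open>f\<close> and
  \<open>g\<close> to their sum. Over a common finite superset the sums can be compared term by
  term.\<close>

lemma free_lift_superset:
  assumes M: "module R M" and b: "\<And>s. s \<in> S \<Longrightarrow> b s \<in> carrier M"
    and f: "f \<in> carrier (free_module R S)"
    and F: "finite F" "F \<subseteq> S" "\<And>s. f s \<noteq> \<zero>\<^bsub>R\<^esub> \<Longrightarrow> s \<in> F"
  shows "free_lift R M b f = (\<Oplus>\<^bsub>M\<^esub>s\<in>F. f s \<odot>\<^bsub>M\<^esub> b s)"
proof -
  interpret M: module R M by fact
  show ?thesis
    unfolding free_lift_def
  proof (rule M.add.finprod_mono_neutral_cong_left)
    show "(\<lambda>s. f s \<odot>\<^bsub>M\<^esub> b s) \<in> F \<rightarrow> carrier M"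
      using b f F(2) by (auto simp: free_module_carrier subset_iff)
    show "f s \<odot>\<^bsub>M\<^esub> b s = \<zero>\<^bsub>M\<^esub>" if "s \<in> F - {s. f s \<noteq> \<zero>\<^bsub>R\<^esub>}" for s
      using that b F(2) by (auto simp: subset_iff)
  qed (use F in auto)
qed

lemma free_lift_hom:
  assumes M: "module R M" and b: "\<And>s. s \<in> S \<Longrightarrow> b s \<in> carrier M"
  shows "free_lift R M b \<in> mod_hom R (free_module R S) M"
proof -
  interpret M: module R M by fact
  interpret F: module R "free_module R S" by (rule module_free_module[OF M.R.cring_axioms])
  have *: "(\<lambda>s. f s \<odot>\<^bsub>M\<^esub> b s) \<in> F \<rightarrow> carrier M" if "f \<in> carrier (free_module R S)" "F \<subseteq> S" for f F
    using that b by (auto simp: free_module_carrier)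
  show ?thesis
  proof (rule mod_homI)
    fix f assume f: "f \<in> carrier (free_module R S)"
    then have "{s. f s \<noteq> \<zero>\<^bsub>R\<^esub>} \<subseteq> S" by (auto simp: free_module_carrier)
    with * f show "free_lift R M b f \<in> carrier M"
      unfolding free_lift_def by (intro M.finsum_closed) auto
  next
    fix f g assume f: "f \<in> carrier (free_module R S)" and g: "g \<in> carrier (free_module R S)"
    let ?F = "{s. f s \<noteq> \<zero>\<^bsub>R\<^esub>} \<union> {s. g s \<noteq> \<zero>\<^bsub>R\<^esub>}"
    have F: "finite ?F" "?F \<subseteq> S" using f g by (auto simp: free_module_carrier)
    note sup = free_lift_superset[OF M b _ F]
    have fg: "f \<oplus>\<^bsub>free_module R S\<^esub> g \<in> carrier (free_module R S)" using f g by simp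
    have "free_lift R M b (f \<oplus>\<^bsub>free_module R S\<^esub> g) =
        (\<Oplus>\<^bsub>M\<^esub>s\<in>?F. (f \<oplus>\<^bsub>free_module R S\<^esub> g) s \<odot>\<^bsub>M\<^esub> b s)"
      by (rule sup[OF _ fg]) (auto simp: free_module_simps)
    also have "\<dots> = (\<Oplus>\<^bsub>M\<^esub>s\<in>?F. f s \<odot>\<^bsub>M\<^esub> b s \<oplus>\<^bsub>M\<^esub> g s \<odot>\<^bsub>M\<^esub> b s)"
      using f g F b
      by (intro M.finsum_cong')
        (auto simp: free_module_simps free_module_carrier M.smult_l_distr subset_iff)
    also have "\<dots> = free_lift R M b f \<oplus>\<^bsub>M\<^esub> free_lift R M b g"
      using sup[OF _ f] sup[OF _ g] *[OF f F(2)] *[OF g F(2)]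
      by (subst M.finsum_addf) auto
    finally show "free_lift R M b (f \<oplus>\<^bsub>free_module R S\<^esub> g) = free_lift R M b f \<oplus>\<^bsub>M\<^esub> free_lift R M b g" .
  next
    fix r f assume r: "r \<in> carrier R" and f: "f \<in> carrier (free_module R S)"
    let ?F = "{s. f s \<noteq> \<zero>\<^bsub>R\<^esub>}"
    have F: "finite ?F" "?F \<subseteq> S" using f by (auto simp: free_module_carrier)
    note sup = free_lift_superset[OF M b _ F]
    have rf: "r \<odot>\<^bsub>free_module R S\<^esub> f \<in> carrier (free_module R S)" using r f by simp
    have "free_lift R M b (r \<odot>\<^bsub>free_module R S\<^esub> f) = (\<Oplus>\<^bsub>M\<^esub>s\<in>?F. (r \<odot>\<^bsub>free_module R S\<^esub> f) s \<odot>\<^bsub>M\<^esub> b s)"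
      by (rule sup[OF _ rf]) (use r in \<open>auto simp: free_module_simps\<close>)
    also have "\<dots> = (\<Oplus>\<^bsub>M\<^esub>s\<in>?F. r \<odot>\<^bsub>M\<^esub> (f s \<odot>\<^bsub>M\<^esub> b s))"
      using r f F b
      by (intro M.finsum_cong')
        (auto simp: free_module_simps free_module_carrier M.smult_assoc1 subset_iff)
    also have "\<dots> = r \<odot>\<^bsub>M\<^esub> free_lift R M b f"
      unfolding free_lift_def using M.finsum_smult_ldistr[OF F(1) r *[OF f F(2)]] by simp
    finally show "free_lift R M b (r \<odot>\<^bsub>free_module R S\<^esub> f) = r \<odot>\<^bsub>M\<^esub> free_lift R M b f" .
  qed
qed

lemma free_lift_basis:
  assumes M: "module R M" and b: "\<And>s. s \<in> S \<Longrightarrow> b s \<in> carrier M" and s: "s \<in> S"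
  shows "free_lift R M b (free_basis R s) = b s"
proof -
  interpret M: module R M by fact
  have "free_lift R M b (free_basis R s) = (\<Oplus>\<^bsub>M\<^esub>t\<in>{s}. free_basis R s t \<odot>\<^bsub>M\<^esub> b t)"
    by (rule free_lift_superset[OF M b free_basis_closed[OF M.R.cring_axioms s]])
      (use s in \<open>auto simp: free_basis_def split: if_splits\<close>)
  then show ?thesis using b[OF s] by (simp add: free_basis_def)
qed

text \<open>Induction on a finite set containing the support, splitting off one coordinate at a
  time. The basis case includes a scalar since \<open>P\<close> may fail to be stable under
  scalars.\<close>

lemma free_module_induct [consumes 2, case_names zero basis add]:
  assumes R: "cring R" and f: "f \<in> carrier (free_module R S)"
    and zero: "P \<zero>\<^bsub>free_module R S\<^esub>"
    and basis: "\<And>r s. \<lbrakk>r \<in> carrier R; s \<in> S\<rbrakk> \<Longrightarrow> P (r \<odot>\<^bsub>free_module R S\<^esub> free_basis R s)"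
    and add: "\<And>f g. \<lbrakk>f \<in> carrier (free_module R S); g \<in> carrier (free_module R S); P f; P g\<rbrakk> \<Longrightarrow>
      P (f \<oplus>\<^bsub>free_module R S\<^esub> g)"
  shows "P f"
proof -
  interpret R: cring R by fact
  have "P f" if "finite F" "f \<in> carrier (free_module R S)" "{s. f s \<noteq> \<zero>\<^bsub>R\<^esub>} \<subseteq> F" for F f
    using that
  proof (induction F arbitrary: f)
    case empty
    then have "f = \<zero>\<^bsub>free_module R S\<^esub>" by (auto simp: free_module_simps)
    then show ?case using zero by simp
  next
    case (insert s F)
    show ?case
    proof (cases "f s = \<zero>\<^bsub>R\<^esub>")
      case True
      then show ?thesis using insert by (intro insert.IH) auto
    next
      case False
      let ?g = "f(s := \<zero>\<^bsub>R\<^esub>)"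
      have sS: "s \<in> S" and fs: "f s \<in> carrier R"
        using False insert.prems by (auto simp: free_module_carrier)
      have "{t. ?g t \<noteq> \<zero>\<^bsub>R\<^esub>} \<subseteq> {t. f t \<noteq> \<zero>\<^bsub>R\<^esub>}" by auto
      then have g: "?g \<in> carrier (free_module R S)"
        using insert.prems by (auto simp: free_module_carrier elim!: rev_finite_subset)
      have "P ?g" by (rule insert.IH[OF g]) (use insert.prems in auto)
      moreover have "f = f s \<odot>\<^bsub>free_module R S\<^esub> free_basis R s \<oplus>\<^bsub>free_module R S\<^esub> ?g"
        using insert.prems by (auto simp: free_module_simps free_basis_def free_module_carrier)
      moreover have "f s \<odot>\<^bsub>free_module R S\<^esub> free_basis R s \<in> carrier (free_module R S)"
        using module.smult_closed[OF module_free_module[OF R] fs free_basis_closed[OF R sS]] .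
      ultimately show ?thesis using add g basis[OF fs sS] by metis
    qed
  qed
  from this[of "{s. f s \<noteq> \<zero>\<^bsub>R\<^esub>}" f] f show ?thesis by (simp add: free_module_carrier)
qed

section \<open>Tensor products\<close>

lemma submodule_span_submodule:
  assumes M: "module R M" and X: "X \<subseteq> carrier M"
  shows "submodule (submodule_span R M X) R M"
proof -
  interpret M: module R M by fact
  \<comment> \<open>The family is nonempty, as the carrier itself belongs to it; an empty
    intersection would be the whole type.\<close>
  have "\<Inter>{N. submodule N R M \<and> X \<subseteq> N} \<subseteq> carrier M"
    using M.carrier_is_submodule X by blast
  moreover have "\<zero>\<^bsub>M\<^esub> \<in> N" if "submodule N R M" for N
    using subgroup.one_closed[OF submodule.axioms(1)[OF that]] by simp
  ultimately show ?thesis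
    unfolding submodule_span_def
    by (intro M.submoduleI) (auto intro: M.submoduleE)
qed

lemma submodule_span_superset: "X \<subseteq> submodule_span R M X"
  by (auto simp: submodule_span_def)

lemma submodule_span_least: "\<lbrakk>submodule N R M; X \<subseteq> N\<rbrakk> \<Longrightarrow> submodule_span R M X \<subseteq> N"
  by (auto simp: submodule_span_def)

lemma submodule_kernel:
  assumes M: "module R M" and N: "module R N" and f: "f \<in> mod_hom R M N"
  shows "submodule {x \<in> carrier M. f x = \<zero>\<^bsub>N\<^esub>} R M"
proof -
  interpret M: module R M by fact
  interpret N: module R N by fact
  show ?thesis
    by (rule M.submoduleI) (auto simp: mod_hom_add[OF f] mod_hom_smult[OF f]
      mod_hom_minus[OF M N f] mod_hom_zero[OF M N f])
qed

lemma coset_eqI: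
  assumes "module R M" "submodule N R M" "x \<in> carrier M" "y \<in> carrier M" "x \<ominus>\<^bsub>M\<^esub> y \<in> N"
  shows "N +>\<^bsub>M\<^esub> x = N +>\<^bsub>M\<^esub> y"
proof -
  interpret N: abelian_subgroup N M by (rule submodule_abelian_subgroup[OF assms(1,2)])
  show ?thesis
    by (rule N.a_repr_independence'[symmetric])
      (use N.a_rcos_module_rev[OF assms(4,3)] assms in \<open>simp_all add: a_minus_def\<close>)
qed

section \<open>The tensor product and its universal property\<close>

lemma module_tensor_free: "module R M \<Longrightarrow> module R (tensor_free R M N)"
  unfolding tensor_free_def by (intro module_free_module module.axioms(1))

lemma tensor_free_basis:
  "\<lbrakk>module R M; x \<in> carrier M; y \<in> carrier N\<rbrakk> \<Longrightarrow> free_basis R (x, y) \<in> carrier (tensor_free R M N)"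
  unfolding tensor_free_def by (intro free_basis_closed module.axioms(1)) auto

lemma tensor_rels_submodule:
  assumes M: "module R M" and N: "module R N"
  shows "submodule (tensor_rels R M N) R (tensor_free R M N)"
proof -
  interpret M: module R M by fact
  interpret N: module R N by fact
  interpret F: module R "tensor_free R M N" by (rule module_tensor_free[OF M])
  show ?thesis
    unfolding tensor_rels_def Let_def
    by (rule submodule_span_submodule[OF F.module_axioms]) (auto intro!: tensor_free_basis[OF M] simp: F.minus_closed)
qed

lemma module_tensor:
  assumes M: "module R M" and N: "module R N" shows "module R (tensor R M N)"
  unfolding tensor_def
  by (rule module_quot_module[OF module_tensor_free[OF M] tensor_rels_submodule[OF M N]])

lemma pure_tensor_bilin:
  assumes M: "module R M" and N: "module R N"
  shows "pure_tensor R M N \<in> bilin R M N (tensor R M N)"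
proof -
  interpret M: module R M by fact
  interpret N: module R N by fact
  let ?F = "tensor_free R M N" and ?K = "tensor_rels R M N"
  interpret F: module R ?F by (rule module_tensor_free[OF M])
  note K = tensor_rels_submodule[OF M N]
  note basis = tensor_free_basis[OF M]
  note eqI = coset_eqI[OF F.module_axioms K]
  note add = quot_module_add[OF F.module_axioms K] and smult = quot_module_smult[OF F.module_axioms K]
  have rels:
    "\<lbrakk>x \<in> carrier M; x' \<in> carrier M; y \<in> carrier N\<rbrakk> \<Longrightarrow>
      free_basis R (x \<oplus>\<^bsub>M\<^esub> x', y) \<ominus>\<^bsub>?F\<^esub> (free_basis R (x, y) \<oplus>\<^bsub>?F\<^esub> free_basis R (x', y)) \<in> ?K"
    "\<lbrakk>x \<in> carrier M; y \<in> carrier N; y' \<in> carrier N\<rbrakk> \<Longrightarrow>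
      free_basis R (x, y \<oplus>\<^bsub>N\<^esub> y') \<ominus>\<^bsub>?F\<^esub> (free_basis R (x, y) \<oplus>\<^bsub>?F\<^esub> free_basis R (x, y')) \<in> ?K"
    "\<lbrakk>r \<in> carrier R; x \<in> carrier M; y \<in> carrier N\<rbrakk> \<Longrightarrow>
      free_basis R (r \<odot>\<^bsub>M\<^esub> x, y) \<ominus>\<^bsub>?F\<^esub> r \<odot>\<^bsub>?F\<^esub> free_basis R (x, y) \<in> ?K"
    "\<lbrakk>r \<in> carrier R; x \<in> carrier M; y \<in> carrier N\<rbrakk> \<Longrightarrow>
      free_basis R (x, r \<odot>\<^bsub>N\<^esub> y) \<ominus>\<^bsub>?F\<^esub> r \<odot>\<^bsub>?F\<^esub> free_basis R (x, y) \<in> ?K"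
    for r x x' y y'
    unfolding tensor_rels_def Let_def
    by (rule subsetD[OF submodule_span_superset], blast)+
  show ?thesis
    unfolding pure_tensor_def tensor_def
    by (intro bilinI mod_homI quot_module_carrierI basis)
      (simp_all add: add smult basis eqI rels)
qed

text \<open>The kernel of the free lift is a submodule, so it contains the span of the relations as
  soon as it contains the four families of generators. For these the claim is the bilinearity of
  \<open>b\<close>.\<close>

lemma free_lift_tensor_rels:
  assumes M: "module R M" and N: "module R N" and L: "module R L" and b: "b \<in> bilin R M N L"
    and k: "k \<in> tensor_rels R M N"
  shows "free_lift R L (case_prod b) k = \<zero>\<^bsub>L\<^esub>"
proof -
  interpret M: module R M by fact
  interpret N: module R N by fact
  interpret L: module R L by fact
  let ?F = "tensor_free R M N" and ?l = "free_lift R L (case_prod b)"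
  interpret F: module R ?F by (rule module_tensor_free[OF M])
  note basis = tensor_free_basis[OF M]
  have b': "s \<in> carrier M \<times> carrier N \<Longrightarrow> case_prod b s \<in> carrier L" for s
    by (auto simp: bilin_closed[OF b])
  have l: "?l \<in> mod_hom R ?F L" unfolding tensor_free_def by (rule free_lift_hom[OF L b'])
  have l_basis: "?l (free_basis R (x, y)) = b x y" if "x \<in> carrier M" "y \<in> carrier N" for x y
    using free_lift_basis[OF L b', where s = "(x, y)"] that by auto
  note simps = a_minus_def basis mod_hom_add[OF l] mod_hom_smult[OF l] mod_hom_minus[OF F.module_axioms L l]
    l_basis bilin_closed[OF b] mod_hom_add[OF bilin_left[OF b]] mod_hom_add[OF bilin_right[OF b]]
    mod_hom_smult[OF bilin_left[OF b]] mod_hom_smult[OF bilin_right[OF b]] L.r_neg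
  have "tensor_rels R M N \<subseteq> {k \<in> carrier ?F. ?l k = \<zero>\<^bsub>L\<^esub>}"
    unfolding tensor_rels_def Let_def
    by (rule submodule_span_least[OF submodule_kernel[OF F.module_axioms L l]]) (auto simp: simps)
  then show ?thesis using k by auto
qed

text \<open>\<open>tensor_lift\<close> takes the only element of the image of a coset. The image is
  a singleton because the free lift vanishes on the relations.\<close>

lemma tensor_lift_coset:
  assumes M: "module R M" and N: "module R N" and L: "module R L" and b: "b \<in> bilin R M N L"
    and f: "f \<in> carrier (tensor_free R M N)"
  shows "tensor_lift R L b (tensor_rels R M N +>\<^bsub>tensor_free R M N\<^esub> f) = free_lift R L (case_prod b) f"
proof -
  interpret L: module R L by fact
  let ?F = "tensor_free R M N" and ?K = "tensor_rels R M N" and ?l = "free_lift R L (case_prod b)"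
  interpret F: module R ?F by (rule module_tensor_free[OF M])
  interpret K: abelian_subgroup ?K ?F
    by (rule submodule_abelian_subgroup[OF F.module_axioms tensor_rels_submodule[OF M N]])
  have l: "?l \<in> mod_hom R ?F L"
    unfolding tensor_free_def by (rule free_lift_hom[OF L]) (auto simp: bilin_closed[OF b])
  have "?l (k \<oplus>\<^bsub>?F\<^esub> f) = ?l f" if "k \<in> ?K" for k
    using that f K.a_subset mod_hom_closed[OF l f]
    by (simp add: mod_hom_add[OF l] free_lift_tensor_rels[OF M N L b] subset_iff)
  then have "?l ` (?K +>\<^bsub>?F\<^esub> f) = {?l f}"
    using K.zero_closed by (auto simp: a_r_coset_def' image_iff simp del: K.zero_closed)
  then show ?thesis by (simp add: tensor_lift_def)
qed

lemma tensor_lift_pure: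
  assumes M: "module R M" and N: "module R N" and L: "module R L" and b: "b \<in> bilin R M N L"
    and x: "x \<in> carrier M" and y: "y \<in> carrier N"
  shows "tensor_lift R L b (pure_tensor R M N x y) = b x y"
proof -
  have "free_lift R L (case_prod b) (free_basis R (x, y)) = case_prod b (x, y)"
    by (rule free_lift_basis[OF L, of "carrier M \<times> carrier N"]) (use x y in \<open>auto simp: bilin_closed[OF b]\<close>)
  then show ?thesis
    unfolding pure_tensor_def by (simp add: tensor_lift_coset[OF M N L b] tensor_free_basis[OF M x y])
qed

lemma tensor_lift_hom:
  assumes M: "module R M" and N: "module R N" and L: "module R L" and b: "b \<in> bilin R M N L"
  shows "tensor_lift R L b \<in> mod_hom R (tensor R M N) L"
proof -
  let ?F = "tensor_free R M N" and ?K = "tensor_rels R M N" and ?l = "free_lift R L (case_prod b)"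
  interpret F: module R ?F by (rule module_tensor_free[OF M])
  have l: "?l \<in> mod_hom R ?F L"
    unfolding tensor_free_def by (rule free_lift_hom[OF L]) (auto simp: bilin_closed[OF b])
  note K = tensor_rels_submodule[OF M N]
  show ?thesis
    unfolding tensor_def
    by (rule mod_homI)
      (auto elim!: quot_module_carrierE simp: tensor_lift_coset[OF M N L b] quot_module_add[OF F.module_axioms K]
        quot_module_smult[OF F.module_axioms K] mod_hom_closed[OF l] mod_hom_add[OF l] mod_hom_smult[OF l])
qed

text \<open>Unlike in the free module, no scalars are needed in the cases: a scalar in front of a
  pure tensor is absorbed into its first factor.\<close>

lemma tensor_induct [consumes 3, case_names zero pure add]:
  assumes M: "module R M" and N: "module R N" and u: "u \<in> carrier (tensor R M N)"
    and zero: "P \<zero>\<^bsub>tensor R M N\<^esub>"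
    and pure: "\<And>x y. \<lbrakk>x \<in> carrier M; y \<in> carrier N\<rbrakk> \<Longrightarrow> P (pure_tensor R M N x y)"
    and add: "\<And>u v. \<lbrakk>u \<in> carrier (tensor R M N); v \<in> carrier (tensor R M N); P u; P v\<rbrakk> \<Longrightarrow>
      P (u \<oplus>\<^bsub>tensor R M N\<^esub> v)"
  shows "P u"
proof -
  let ?F = "tensor_free R M N" and ?K = "tensor_rels R M N"
  interpret M: module R M by fact
  interpret F: module R ?F by (rule module_tensor_free[OF M])
  interpret T: module R "tensor R M N" by (rule module_tensor[OF M N])
  note K = tensor_rels_submodule[OF M N]
  interpret K: abelian_subgroup ?K ?F by (rule submodule_abelian_subgroup[OF F.module_axioms K])
  from u obtain f where f: "f \<in> carrier ?F" and u_eq: "u = ?K +>\<^bsub>?F\<^esub> f"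
    unfolding tensor_def by (rule quot_module_carrierE)
  from M.R.cring_axioms f[unfolded tensor_free_def] have "P (?K +>\<^bsub>?F\<^esub> f)"
  proof (induction rule: free_module_induct)
    case zero
    have "?K +>\<^bsub>?F\<^esub> \<zero>\<^bsub>?F\<^esub> = \<zero>\<^bsub>tensor R M N\<^esub>"
      by (simp add: tensor_def quot_module_simps K.a_rcos_const)
    then show ?case using assms(4) by (simp add: tensor_free_def)
  next
    case (basis r s)
    then obtain x y where s: "s = (x, y)" "x \<in> carrier M" "y \<in> carrier N" by auto
    have "?K +>\<^bsub>?F\<^esub> (r \<odot>\<^bsub>?F\<^esub> free_basis R (x, y)) = r \<odot>\<^bsub>tensor R M N\<^esub> pure_tensor R M N x y"
      unfolding tensor_def pure_tensor_def
      by (simp add: quot_module_smult[OF F.module_axioms K] tensor_free_basis[OF M] s basis)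
    also have "\<dots> = pure_tensor R M N (r \<odot>\<^bsub>M\<^esub> x) y"
      using mod_hom_smult[OF bilin_left[OF pure_tensor_bilin[OF M N]]] s basis by simp
    finally show ?case using pure s basis by (simp add: tensor_free_def)
  next
    case (add f g)
    then show ?case
      using assms(6)[of "?K +>\<^bsub>?F\<^esub> f" "?K +>\<^bsub>?F\<^esub> g"]
      by (simp add: tensor_def tensor_free_def quot_module_carrierI
          quot_module_add[OF F.module_axioms[unfolded tensor_free_def] K[unfolded tensor_free_def]])
  qed
  then show ?thesis by (simp add: u_eq)
qed

lemma tensor_hom_eqI:
  assumes M: "module R M" and N: "module R N" and L: "module R L"
    and f: "f \<in> mod_hom R (tensor R M N) L" and g: "g \<in> mod_hom R (tensor R M N) L"
    and eq: "\<And>x y. \<lbrakk>x \<in> carrier M; y \<in> carrier N\<rbrakk> \<Longrightarrow> f (pure_tensor R M N x y) = g (pure_tensor R M N x y)"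
    and u: "u \<in> carrier (tensor R M N)"
  shows "f u = g u"
  using M N u
proof (induction rule: tensor_induct)
  case zero
  show ?case by (simp add: mod_hom_zero[OF module_tensor[OF M N] L f] mod_hom_zero[OF module_tensor[OF M N] L g])
qed (simp_all add: eq mod_hom_add[OF f] mod_hom_add[OF g])

text \<open>Reduces identities between pairings on base changes to pure tensors, by fixing one
  argument and varying the other. Leibniz rules and homotopy relations are transported along base
  change in this way.\<close>

lemma tensor_bilin_eqI:
  assumes M: "module R M" and N: "module R N" and M': "module R M'" and N': "module R N'" and L: "module R L"
    and b: "b \<in> bilin R (tensor R M N) (tensor R M' N') L" and c: "c \<in> bilin R (tensor R M N) (tensor R M' N') L"
    and eq: "\<And>x y x' y'. \<lbrakk>x \<in> carrier M; y \<in> carrier N; x' \<in> carrier M'; y' \<in> carrier N'\<rbrakk> \<Longrightarrow>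
      b (pure_tensor R M N x y) (pure_tensor R M' N' x' y') = c (pure_tensor R M N x y) (pure_tensor R M' N' x' y')"
    and u: "u \<in> carrier (tensor R M N)" and v: "v \<in> carrier (tensor R M' N')"
  shows "b u v = c u v"
proof (rule tensor_hom_eqI[OF M N L bilin_left[OF b v] bilin_left[OF c v] _ u])
  fix x y assume xy: "x \<in> carrier M" "y \<in> carrier N"
  then have *: "pure_tensor R M N x y \<in> carrier (tensor R M N)"
    by (rule bilin_closed[OF pure_tensor_bilin[OF M N]])
  show "b (pure_tensor R M N x y) v = c (pure_tensor R M N x y) v"
    by (rule tensor_hom_eqI[OF M' N' L bilin_right[OF b *] bilin_right[OF c *] eq[OF xy] v])
qed

lemma tensor_map_bilin:
  assumes "module R M'" "module R N'" "f \<in> mod_hom R M M'" "g \<in> mod_hom R N N'"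
  shows "(\<lambda>x y. pure_tensor R M' N' (f x) (g y)) \<in> bilin R M N (tensor R M' N')"
  by (rule bilin_comp_left[OF bilin_comp_right[OF pure_tensor_bilin[OF assms(1,2)] assms(4)] assms(3)])

lemma tensor_map_hom:
  assumes "module R M" "module R N" "module R M'" "module R N'" "f \<in> mod_hom R M M'" "g \<in> mod_hom R N N'"
  shows "tensor_map R M' N' f g \<in> mod_hom R (tensor R M N) (tensor R M' N')"
  unfolding tensor_map_def
  by (rule tensor_lift_hom[OF assms(1,2) module_tensor[OF assms(3,4)] tensor_map_bilin[OF assms(3-6)]])

lemma tensor_map_pure:
  assumes "module R M" "module R N" "module R M'" "module R N'" "f \<in> mod_hom R M M'" "g \<in> mod_hom R N N'"
    "x \<in> carrier M" "y \<in> carrier N"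
  shows "tensor_map R M' N' f g (pure_tensor R M N x y) = pure_tensor R M' N' (f x) (g y)"
  unfolding tensor_map_def
  by (rule tensor_lift_pure[OF assms(1,2) module_tensor[OF assms(3,4)] tensor_map_bilin[OF assms(3-6)] assms(7,8)])

section \<open>Lifting along maps out of projective modules\<close>

lemma free_module_hom_eqI:
  assumes R: "cring R" and M: "module R M"
    and f: "f \<in> mod_hom R (free_module R S) M" and g: "g \<in> mod_hom R (free_module R S) M"
    and eq: "\<And>s. s \<in> S \<Longrightarrow> f (free_basis R s) = g (free_basis R s)"
    and u: "u \<in> carrier (free_module R S)"
  shows "f u = g u"
  using R u
proof (induction rule: free_module_induct)
  case zero
  show ?case
    by (simp add: mod_hom_zero[OF module_free_module[OF R] M f] mod_hom_zero[OF module_free_module[OF R] M g])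
qed (simp_all add: eq mod_hom_add[OF f] mod_hom_add[OF g] mod_hom_smult[OF f] mod_hom_smult[OF g]
    free_basis_closed[OF R])

text \<open>The condition on \<open>\<phi>\<close> is that it hits the values of \<open>b\<close>,
  not that it is onto. So the lemma serves for the surjection \<open>g n\<close> and also for the
  injection \<open>f n\<close>, where it turns a map with values in the kernel of \<open>g n\<close>
  into a map to \<open>P\<close>.\<close>

lemma projective_lift:
  fixes X :: "('r, 'm) module"
  assumes X: "projective_module R X" and M: "module R M" and N: "module R N"
    and \<phi>: "\<phi> \<in> mod_hom R N M" and b: "b \<in> mod_hom R X M"
    and img: "\<And>x. x \<in> carrier X \<Longrightarrow> b x \<in> \<phi> ` carrier N"
  obtains b' where "b' \<in> mod_hom R X N" "\<And>x. x \<in> carrier X \<Longrightarrow> \<phi> (b' x) = b x"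
proof -
  obtain S :: "'m set" and s r where s: "s \<in> mod_hom R X (free_module R S)"
    and r: "r \<in> mod_hom R (free_module R S) X" and rs: "\<And>x. x \<in> carrier X \<Longrightarrow> r (s x) = x"
    using X unfolding projective_module_def by blast
  interpret M: module R M by fact
  have "\<exists>n. n \<in> carrier N \<and> \<phi> n = b (r (free_basis R t))" if "t \<in> S" for t
    using img[OF mod_hom_closed[OF r free_basis_closed[OF M.R.cring_axioms that]]] by auto
  then have "\<forall>t\<in>S. \<exists>n. n \<in> carrier N \<and> \<phi> n = b (r (free_basis R t))" by blast
  then obtain c where c: "t \<in> S \<Longrightarrow> c t \<in> carrier N \<and> \<phi> (c t) = b (r (free_basis R t))" for t
    unfolding bchoice_iff by blast
  then have l: "free_lift R N c \<in> mod_hom R (free_module R S) N"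
    by (intro free_lift_hom[OF N]) blast
  have "\<phi> (free_lift R N c u) = b (r u)" if "u \<in> carrier (free_module R S)" for u
  proof (rule free_module_hom_eqI[OF M.R.cring_axioms M mod_hom_comp[OF l \<phi>] mod_hom_comp[OF r b] _ that])
    fix t assume t: "t \<in> S"
    have "free_lift R N c (free_basis R t) = c t"
      by (rule free_lift_basis[OF N _ t]) (use c in blast)
    then show "\<phi> (free_lift R N c (free_basis R t)) = b (r (free_basis R t))" using c[OF t] by simp
  qed
  then show ?thesis
    using that[OF mod_hom_comp[OF s l]] rs mod_hom_closed[OF s] by simp
qed

text \<open>Preimages are chosen for pairs of basis elements and extended by two nested free lifts.
  The retractions \<open>r\<close> and \<open>r'\<close> make the outcome a lift of
  \<open>b\<close>, and the sections \<open>s\<close> and \<open>s'\<close> pull it back to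
  \<open>X\<close> and \<open>Y\<close>.\<close>

lemma projective_bilin_lift:
  fixes X :: "('r, 'm) module" and Y :: "('r, 'n) module"
  assumes X: "projective_module R X" and Y: "projective_module R Y" and M: "module R M" and N: "module R N"
    and \<phi>: "\<phi> \<in> mod_hom R N M" and b: "b \<in> bilin R X Y M"
    and img: "\<And>x y. \<lbrakk>x \<in> carrier X; y \<in> carrier Y\<rbrakk> \<Longrightarrow> b x y \<in> \<phi> ` carrier N"
  obtains b' where "b' \<in> bilin R X Y N"
    "\<And>x y. \<lbrakk>x \<in> carrier X; y \<in> carrier Y\<rbrakk> \<Longrightarrow> \<phi> (b' x y) = b x y"
proof -
  obtain S :: "'m set" and s r where s: "s \<in> mod_hom R X (free_module R S)"
    and r: "r \<in> mod_hom R (free_module R S) X" and rs: "\<And>x. x \<in> carrier X \<Longrightarrow> r (s x) = x"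
    using X unfolding projective_module_def by blast
  obtain S' :: "'n set" and s' r' where s': "s' \<in> mod_hom R Y (free_module R S')"
    and r': "r' \<in> mod_hom R (free_module R S') Y" and rs': "\<And>x. x \<in> carrier Y \<Longrightarrow> r' (s' x) = x"
    using Y unfolding projective_module_def by blast
  interpret M: module R M by fact
  interpret N: module R N by fact
  note R = M.R.cring_axioms
  note basis = free_basis_closed[OF R]
  have "\<exists>n. n \<in> carrier N \<and> \<phi> n = b (r (free_basis R t)) (r' (free_basis R t'))"
    if "t \<in> S" "t' \<in> S'" for t t'
    using img[OF mod_hom_closed[OF r basis[OF that(1)]] mod_hom_closed[OF r' basis[OF that(2)]]] by auto
  then have "\<forall>t\<in>S. \<forall>t'\<in>S'. \<exists>n. n \<in> carrier N \<and> \<phi> n = b (r (free_basis R t)) (r' (free_basis R t'))"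
    by blast
  then obtain c where c: "\<lbrakk>t \<in> S; t' \<in> S'\<rbrakk> \<Longrightarrow>
      c t t' \<in> carrier N \<and> \<phi> (c t t') = b (r (free_basis R t)) (r' (free_basis R t'))" for t t'
    unfolding bchoice_iff by blast
  define l where "l f g = free_lift R N (\<lambda>t. free_lift R N (c t) g) f" for f g
  have inner: "free_lift R N (c t) \<in> mod_hom R (free_module R S') N" if "t \<in> S" for t
    using c that by (intro free_lift_hom[OF N]) blast
  have l: "l \<in> bilin R (free_module R S) (free_module R S') N"
  proof (rule bilinI)
    fix g assume "g \<in> carrier (free_module R S')"
    then show "(\<lambda>f. l f g) \<in> mod_hom R (free_module R S) N"
      unfolding l_def by (intro free_lift_hom[OF N] mod_hom_closed[OF inner])
  next
    fix f assume f: "f \<in> carrier (free_module R S)"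
    \<comment> \<open>The outer sum runs over the support of \<open>f\<close>, which does not depend
      on \<open>g\<close>. In \<open>g\<close> it is a fixed sum of linear maps.\<close>
    have "(\<lambda>g. f t \<odot>\<^bsub>N\<^esub> free_lift R N (c t) g) \<in> mod_hom R (free_module R S') N"
      if "t \<in> {t. f t \<noteq> \<zero>\<^bsub>R\<^esub>}" for t
      using f that by (intro mod_hom_scale[OF N inner]) (auto simp: free_module_carrier)
    then show "l f \<in> mod_hom R (free_module R S') N"
      unfolding l_def free_lift_def[of R N "\<lambda>t. free_lift R N (c t) _"] by (rule mod_hom_finsum[OF N])
  qed
  have \<phi>l_basis: "\<phi> (l (free_basis R t) g) = b (r (free_basis R t)) (r' g)"
    if t: "t \<in> S" and g: "g \<in> carrier (free_module R S')" for t g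
  proof (rule free_module_hom_eqI[OF R M _ _ _ g])
    show "(\<lambda>g. \<phi> (l (free_basis R t) g)) \<in> mod_hom R (free_module R S') M"
      by (rule mod_hom_comp[OF bilin_right[OF l basis[OF t]] \<phi>])
    show "(\<lambda>g. b (r (free_basis R t)) (r' g)) \<in> mod_hom R (free_module R S') M"
      by (rule mod_hom_comp[OF r' bilin_right[OF b mod_hom_closed[OF r basis[OF t]]]])
    fix t' assume t': "t' \<in> S'"
    have "l (free_basis R t) (free_basis R t') = free_lift R N (c t) (free_basis R t')"
      unfolding l_def by (rule free_lift_basis[OF N mod_hom_closed[OF inner basis[OF t']] t])
    also have "\<dots> = c t t'"
      by (rule free_lift_basis[OF N _ t']) (use c t in blast)
    finally have "l (free_basis R t) (free_basis R t') = c t t'" .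
    then show "\<phi> (l (free_basis R t) (free_basis R t')) = b (r (free_basis R t)) (r' (free_basis R t'))"
      using c t t' by simp
  qed
  have \<phi>l: "\<phi> (l f g) = b (r f) (r' g)"
    if f: "f \<in> carrier (free_module R S)" and g: "g \<in> carrier (free_module R S')" for f g
    by (rule free_module_hom_eqI[OF R M mod_hom_comp[OF bilin_left[OF l g] \<phi>]
      mod_hom_comp[OF r bilin_left[OF b mod_hom_closed[OF r' g]]] \<phi>l_basis[OF _ g] f])
  show ?thesis
    using that[OF bilin_comp_left[OF bilin_comp_right[OF l s'] s]] \<phi>l rs rs'
      mod_hom_closed[OF s] mod_hom_closed[OF s'] by simp
qed


section \<open>Homology and pairings of complexes\<close>

lemma complex_module: "is_complex R C \<Longrightarrow> module R (cmod C n)"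
  by (simp add: is_complex_def)

lemma complex_diff: "\<lbrakk>is_complex R C; m = n - 1\<rbrakk> \<Longrightarrow> cdiff C n \<in> mod_hom R (cmod C n) (cmod C m)"
  by (simp add: is_complex_def)

lemma complex_diff_diff:
  "\<lbrakk>is_complex R C; x \<in> carrier (cmod C n); m = n - 1; k = n - 2\<rbrakk> \<Longrightarrow>
     cdiff C m (cdiff C n x) = \<zero>\<^bsub>cmod C k\<^esub>"
  by (simp add: is_complex_def)

lemma cycles_submodule:
  assumes C: "is_complex R C" shows "submodule (cycles C n) R (cmod C n)"
  unfolding cycles_def
  by (rule submodule_kernel[OF complex_module[OF C] complex_module[OF C] complex_diff[OF C refl]])

lemma boundaries_subset_cycles:
  assumes C: "is_complex R C" shows "boundaries C n \<subseteq> cycles C n"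
  using mod_hom_closed[OF complex_diff[OF C, of n "n + 1"]] complex_diff_diff[OF C, of _ "n + 1" n "n - 1"]
  by (auto simp: boundaries_def cycles_def)

text \<open>The second form is required because \<open>homology\<close> is a quotient of
  \<open>cmod C n\<close> with its carrier replaced by the cycles.\<close>

lemma boundaries_submodule:
  assumes C: "is_complex R C"
  shows "submodule (boundaries C n) R (cmod C n)"
    and "submodule (boundaries C n) R (cmod C n\<lparr>carrier := cycles C n\<rparr>)"
proof -
  interpret M: module R "cmod C n" by (rule complex_module[OF C])
  interpret N: module R "cmod C (n + 1)" by (rule complex_module[OF C])
  have d: "cdiff C (n + 1) \<in> mod_hom R (cmod C (n + 1)) (cmod C n)" by (rule complex_diff[OF C]) simp
  note minus = mod_hom_minus[OF N.module_axioms M.module_axioms d]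
  show B: "submodule (boundaries C n) R (cmod C n)"
    unfolding boundaries_def
  proof (rule M.submoduleI)
    show "\<zero>\<^bsub>cmod C n\<^esub> \<in> cdiff C (n + 1) ` carrier (cmod C (n + 1))"
      using mod_hom_zero[OF N.module_axioms M.module_axioms d] by (metis N.zero_closed imageI)
  qed (auto simp: mod_hom_closed[OF d] mod_hom_add[OF d, symmetric] mod_hom_smult[OF d, symmetric]
      minus[symmetric])
  have "module R (cmod C n\<lparr>carrier := boundaries C n\<rparr>)"
    by (rule submodule.submodule_is_module[OF B M.module_axioms])
  then show "submodule (boundaries C n) R (cmod C n\<lparr>carrier := cycles C n\<rparr>)"
    using boundaries_subset_cycles[OF C]
    by (intro module.module_incl_imp_submodule submodule.submodule_is_module[OF cycles_submodule[OF C] M.module_axioms])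
      auto
qed

lemma cyclesD:
  assumes "u \<in> cycles C n"
  shows "u \<in> carrier (cmod C n)" "cdiff C n u = \<zero>\<^bsub>cmod C (n - 1)\<^esub>"
  using assms by (simp_all add: cycles_def)

lemma module_homology:
  assumes C: "is_complex R C" shows "module R (homology C n)"
  unfolding homology_def
  by (intro module_quot_module boundaries_submodule[OF C]
      submodule.submodule_is_module[OF cycles_submodule[OF C] complex_module[OF C]])

lemma homology_class_closed: "x \<in> cycles C n \<Longrightarrow> homology_class C n x \<in> carrier (homology C n)"
  by (auto simp: homology_def homology_class_def quot_module_simps A_RCOSETS_def' a_r_coset_def')

lemma homology_class_add:
  assumes C: "is_complex R C" and x: "x \<in> cycles C n" and y: "y \<in> cycles C n"
  shows "homology_class C n (x \<oplus>\<^bsub>cmod C n\<^esub> y) = homology_class C n x \<oplus>\<^bsub>homology C n\<^esub> homology_class C n y"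
  using quot_module_add[OF submodule.submodule_is_module[OF cycles_submodule[OF C] complex_module[OF C]]
      boundaries_submodule(2)[OF C]] x y
  by (simp add: homology_def homology_class_def a_r_coset_def')

lemma homology_class_eqI:
  assumes C: "is_complex R C" and y: "y \<in> carrier (cmod C n)" and z: "z \<in> carrier (cmod C (n + 1))"
    and x: "x = y \<oplus>\<^bsub>cmod C n\<^esub> cdiff C (n + 1) z"
  shows "homology_class C n x = homology_class C n y"
proof -
  interpret M: module R "cmod C n" by (rule complex_module[OF C])
  have d: "cdiff C (n + 1) \<in> mod_hom R (cmod C (n + 1)) (cmod C n)" by (rule complex_diff[OF C]) simp
  have dz: "cdiff C (n + 1) z \<in> carrier (cmod C n)" "cdiff C (n + 1) z \<in> boundaries C n"
    using mod_hom_closed[OF d z] z by (auto simp: boundaries_def)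
  have "x \<ominus>\<^bsub>cmod C n\<^esub> y = cdiff C (n + 1) z"
    using dz y x by (simp add: a_minus_def M.a_comm[of y] M.a_assoc M.r_neg)
  then show ?thesis
    unfolding homology_class_def
    using dz x y by (intro coset_eqI[OF M.module_axioms boundaries_submodule(1)[OF C]]) auto
qed

lemma homology_carrierE:
  assumes "\<alpha> \<in> carrier (homology C n)"
  obtains x where "x \<in> cycles C n" "\<alpha> = homology_class C n x"
  using assms by (auto simp: homology_def homology_class_def quot_module_simps A_RCOSETS_def' a_r_coset_def')

lemma homology_class_self:
  assumes C: "is_complex R C" and x: "x \<in> cycles C n"
  shows "x \<in> homology_class C n x"
  unfolding homology_class_def
  by (rule abelian_subgroup.a_rcos_self[OF
        submodule_abelian_subgroup[OF complex_module[OF C] boundaries_submodule(1)[OF C]] cyclesD(1)[OF x]])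

lemma homology_memE:
  assumes C: "is_complex R C" and \<alpha>: "\<alpha> \<in> carrier (homology C n)" and u: "u \<in> \<alpha>" and v: "v \<in> \<alpha>"
  obtains z where "u \<in> cycles C n" "v \<in> cycles C n" "z \<in> carrier (cmod C (n + 1))"
    "u = v \<oplus>\<^bsub>cmod C n\<^esub> cdiff C (n + 1) z"
proof -
  interpret M: module R "cmod C n" by (rule complex_module[OF C])
  interpret N: module R "cmod C (n + 1)" by (rule complex_module[OF C])
  have d: "cdiff C (n + 1) \<in> mod_hom R (cmod C (n + 1)) (cmod C n)" by (rule complex_diff[OF C]) simp
  note d_minus = mod_hom_minus[OF N.module_axioms M.module_axioms d]
  note Z = M.submoduleE[OF cycles_submodule[OF C, of n]]
  from \<alpha> obtain x where x: "x \<in> cycles C n" and \<alpha>_eq: "\<alpha> = homology_class C n x" by (rule homology_carrierE)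
  obtain a b where ab: "a \<in> carrier (cmod C (n + 1))" "b \<in> carrier (cmod C (n + 1))"
    and ua: "u = cdiff C (n + 1) a \<oplus>\<^bsub>cmod C n\<^esub> x" and vb: "v = cdiff C (n + 1) b \<oplus>\<^bsub>cmod C n\<^esub> x"
    using u v unfolding \<alpha>_eq homology_class_def boundaries_def a_r_coset_def' by auto
  have da: "cdiff C (n + 1) c \<in> cycles C n" if "c \<in> carrier (cmod C (n + 1))" for c
    using boundaries_subset_cycles[OF C] that by (auto simp: boundaries_def)
  have cl: "cdiff C (n + 1) c \<in> carrier (cmod C n)" if "c \<in> carrier (cmod C (n + 1))" for c
    using mod_hom_closed[OF d that] .
  have "u = v \<oplus>\<^bsub>cmod C n\<^esub> cdiff C (n + 1) (a \<oplus>\<^bsub>cmod C (n + 1)\<^esub> \<ominus>\<^bsub>cmod C (n + 1)\<^esub> b)"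
    unfolding ua vb using ab cyclesD(1)[OF x] cl
    by (simp add: mod_hom_add[OF d] d_minus M.a_ac M.r_neg M.r_neg2 M.r_neg1)
  then show ?thesis
    using that[of "a \<oplus>\<^bsub>cmod C (n + 1)\<^esub> \<ominus>\<^bsub>cmod C (n + 1)\<^esub> b"] ab x da Z(5) ua vb by simp
qed

text \<open>Homology classes are cosets, so membership is the same as being a representing cycle.
  The definitions of the Tor pairing and of the connecting map choose representatives in this
  form.\<close>

lemma homology_class_mem:
  assumes C: "is_complex R C" and \<alpha>: "\<alpha> \<in> carrier (homology C n)" and u: "u \<in> \<alpha>"
  shows "u \<in> cycles C n" "\<alpha> = homology_class C n u"
proof -
  obtain x where x: "x \<in> cycles C n" "\<alpha> = homology_class C n x" using \<alpha> by (rule homology_carrierE)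
  obtain z where z: "u \<in> cycles C n" "z \<in> carrier (cmod C (n + 1))" "u = x \<oplus>\<^bsub>cmod C n\<^esub> cdiff C (n + 1) z"
    using homology_memE[OF C \<alpha> u homology_class_self[OF C x(1), folded x(2)]] by metis
  show "u \<in> cycles C n" "\<alpha> = homology_class C n u"
    using z homology_class_eqI[OF C cyclesD(1)[OF x(1)] z(2,3)] x(2) by simp_all
qed

lemma homology_class_sign:
  assumes C: "is_complex R C" and x: "x \<in> cycles C n"
  shows "homology_class C n (sign_act (cmod C n) p x) = sign_act (homology C n) p (homology_class C n x)"
proof -
  interpret M: module R "cmod C n" by (rule complex_module[OF C])
  interpret H: module R "homology C n" by (rule module_homology[OF C])
  have mx: "\<ominus>\<^bsub>cmod C n\<^esub> x \<in> cycles C n" using M.submoduleE(3)[OF cycles_submodule[OF C] x] .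
  have "homology_class C n \<zero>\<^bsub>cmod C n\<^esub> = \<zero>\<^bsub>homology C n\<^esub>"
    using M.submoduleE(1)[OF boundaries_submodule(1)[OF C, of n]]
    by (simp add: homology_class_def homology_def quot_module_simps)
  then have "homology_class C n (\<ominus>\<^bsub>cmod C n\<^esub> x) \<oplus>\<^bsub>homology C n\<^esub> homology_class C n x = \<zero>\<^bsub>homology C n\<^esub>"
    using homology_class_add[OF C mx x] cyclesD(1)[OF x] by (simp add: M.l_neg)
  then have "\<ominus>\<^bsub>homology C n\<^esub> homology_class C n x = homology_class C n (\<ominus>\<^bsub>cmod C n\<^esub> x)"
    by (rule H.minus_equality[OF _ homology_class_closed[OF x] homology_class_closed[OF mx]])
  then show ?thesis by (simp add: sign_act_def)
qed

text \<open>A chain map from the tensor product complex to \<open>Z\<close>, given by its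
  restrictions to the summands. This form avoids direct sums and tensor products, and it passes
  directly to base changes.\<close>

definition dg_pairing ::
  "('r, 'x) ring_scheme \<Rightarrow> ('r, 'l, 'u) chain_complex_scheme \<Rightarrow> ('r, 'm, 'v) chain_complex_scheme \<Rightarrow>
   ('r, 'n, 'w) chain_complex_scheme \<Rightarrow> (int \<Rightarrow> int \<Rightarrow> 'l \<Rightarrow> 'm \<Rightarrow> 'n) \<Rightarrow> bool" where
  "dg_pairing R X Y Z m \<longleftrightarrow>
     (\<forall>p q. m p q \<in> bilin R (cmod X p) (cmod Y q) (cmod Z (p + q))) \<and>
     (\<forall>p q. \<forall>x\<in>carrier (cmod X p). \<forall>y\<in>carrier (cmod Y q).
        cdiff Z (p + q) (m p q x y) =
          m (p - 1) q (cdiff X p x) y \<oplus>\<^bsub>cmod Z (p + q - 1)\<^esub>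
          sign_act (cmod Z (p + q - 1)) p (m p (q - 1) x (cdiff Y q y)))"

lemma dg_pairing_bilin:
  "\<lbrakk>dg_pairing R X Y Z m; n = p + q\<rbrakk> \<Longrightarrow> m p q \<in> bilin R (cmod X p) (cmod Y q) (cmod Z n)"
  by (simp add: dg_pairing_def)

lemma dg_pairing_Leibniz:
  "\<lbrakk>dg_pairing R X Y Z m; x \<in> carrier (cmod X p); y \<in> carrier (cmod Y q); n = p + q; k = n - 1\<rbrakk> \<Longrightarrow>
     cdiff Z n (m p q x y) =
       m (p - 1) q (cdiff X p x) y \<oplus>\<^bsub>cmod Z k\<^esub> sign_act (cmod Z k) p (m p (q - 1) x (cdiff Y q y))"
  by (simp add: dg_pairing_def)

lemma dg_pairing_cycle:
  assumes X: "is_complex R X" and Y: "is_complex R Y" and Z: "is_complex R Z" and m: "dg_pairing R X Y Z m"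
    and x: "x \<in> cycles X p" and y: "y \<in> cycles Y q" and n: "n = p + q"
  shows "m p q x y \<in> cycles Z n"
proof -
  interpret Z1: module R "cmod Z (n - 1)" by (rule complex_module[OF Z])
  have "m (p - 1) q \<zero>\<^bsub>cmod X (p - 1)\<^esub> y = \<zero>\<^bsub>cmod Z (n - 1)\<^esub>"
    using n cyclesD(1)[OF y]
    by (intro bilin_zero_left[OF complex_module[OF X] complex_module[OF Z] dg_pairing_bilin[OF m]]) auto
  moreover have "m p (q - 1) x \<zero>\<^bsub>cmod Y (q - 1)\<^esub> = \<zero>\<^bsub>cmod Z (n - 1)\<^esub>"
    using n cyclesD(1)[OF x]
    by (intro bilin_zero_right[OF complex_module[OF Y] complex_module[OF Z] dg_pairing_bilin[OF m]]) auto
  ultimately show ?thesis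
    using dg_pairing_Leibniz[OF m cyclesD(1)[OF x] cyclesD(1)[OF y] n refl] cyclesD(2)[OF x] cyclesD(2)[OF y]
      bilin_closed[OF dg_pairing_bilin[OF m n] cyclesD(1)[OF x] cyclesD(1)[OF y]]
    by (simp add: cycles_def sign_act_zero[OF Z1.module_axioms])
qed

text \<open>The representatives are replaced one at a time. If \<open>v\<close> is a cycle then
  \<open>m (d a) v\<close> is the boundary of \<open>m a v\<close>; if \<open>u'\<close> is a cycle
  then \<open>m u' (d b)\<close> is, up to sign, the boundary of \<open>m u' b\<close>.\<close>

lemma dg_pairing_class:
  assumes X: "is_complex R X" and Y: "is_complex R Y" and Z: "is_complex R Z" and m: "dg_pairing R X Y Z m"
    and \<alpha>: "\<alpha> \<in> carrier (homology X p)" and u: "u \<in> \<alpha>" "u' \<in> \<alpha>"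
    and \<beta>: "\<beta> \<in> carrier (homology Y q)" and v: "v \<in> \<beta>" "v' \<in> \<beta>" and n: "n = p + q"
  shows "homology_class Z n (m p q u v) = homology_class Z n (m p q u' v')"
proof -
  interpret Z0: module R "cmod Z n" by (rule complex_module[OF Z])
  interpret Z1: module R "cmod Z (n + 1)" by (rule complex_module[OF Z])
  obtain a where uc: "u \<in> cycles X p" "u' \<in> cycles X p" and a: "a \<in> carrier (cmod X (p + 1))"
    and ua: "u = u' \<oplus>\<^bsub>cmod X p\<^esub> cdiff X (p + 1) a"
    using homology_memE[OF X \<alpha> u] by metis
  obtain b where vc: "v \<in> cycles Y q" "v' \<in> cycles Y q" and b: "b \<in> carrier (cmod Y (q + 1))"
    and vb: "v = v' \<oplus>\<^bsub>cmod Y q\<^esub> cdiff Y (q + 1) b"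
    using homology_memE[OF Y \<beta> v] by metis
  note u' = cyclesD[OF uc(2)] and v = cyclesD[OF vc(1)] and v' = cyclesD[OF vc(2)]
  have da: "cdiff X (p + 1) a \<in> carrier (cmod X p)"
    by (rule mod_hom_closed[OF complex_diff[OF X] a]) simp
  have db: "cdiff Y (q + 1) b \<in> carrier (cmod Y q)"
    by (rule mod_hom_closed[OF complex_diff[OF Y] b]) simp
  note mpq = dg_pairing_bilin[OF m n]
  have n1: "p + 1 + q = n + 1" "p + (q + 1) = n + 1" using n by simp_all
  have "m (p + 1) (q - 1) a \<zero>\<^bsub>cmod Y (q - 1)\<^esub> = \<zero>\<^bsub>cmod Z n\<^esub>"
    by (rule bilin_zero_right[OF complex_module[OF Y] complex_module[OF Z] dg_pairing_bilin[OF m] a])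
      (use n in simp)
  then have "cdiff Z (n + 1) (m (p + 1) q a v) = m p q (cdiff X (p + 1) a) v"
    using dg_pairing_Leibniz[OF m a v(1), of "n + 1" n] v(2) bilin_closed[OF mpq da v(1)]
    by (simp add: sign_act_zero[OF Z0.module_axioms] n[symmetric] n1)
  then have 1: "homology_class Z n (m p q u v) = homology_class Z n (m p q u' v)"
    using n ua mod_hom_add[OF bilin_left[OF mpq v(1)] u'(1) da]
    by (intro homology_class_eqI[OF Z bilin_closed[OF mpq u'(1) v(1)]
          bilin_closed[OF dg_pairing_bilin[OF m] a v(1)]]) auto
  have mub: "m p (q + 1) u' b \<in> carrier (cmod Z (n + 1))"
    by (rule bilin_closed[OF dg_pairing_bilin[OF m] u'(1) b]) (use n in simp)
  have "m (p - 1) (q + 1) \<zero>\<^bsub>cmod X (p - 1)\<^esub> b = \<zero>\<^bsub>cmod Z n\<^esub>"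
    by (rule bilin_zero_left[OF complex_module[OF X] complex_module[OF Z] dg_pairing_bilin[OF m] b])
      (use n in simp)
  then have "cdiff Z (n + 1) (m p (q + 1) u' b) = sign_act (cmod Z n) p (m p q u' (cdiff Y (q + 1) b))"
    using dg_pairing_Leibniz[OF m u'(1) b, of "n + 1" n] u'(2) bilin_closed[OF mpq u'(1) db]
    by (simp add: sign_act_closed[OF Z0.module_axioms] n[symmetric] n1)
  \<comment> \<open>The Leibniz rule leaves the sign \<open>(-1)\<^sup>p\<close> in front. Giving
    the bounding chain the same sign removes it.\<close>
  then have "cdiff Z (n + 1) (sign_act (cmod Z (n + 1)) p (m p (q + 1) u' b)) = m p q u' (cdiff Y (q + 1) b)"
    using mod_hom_sign[OF Z1.module_axioms Z0.module_axioms complex_diff[OF Z] mub]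
      bilin_closed[OF mpq u'(1) db]
    by (simp add: sign_act_twice[OF Z0.module_axioms])
  then have "homology_class Z n (m p q u' v) = homology_class Z n (m p q u' v')"
    using vb mod_hom_add[OF bilin_right[OF mpq u'(1)] v'(1) db]
    by (intro homology_class_eqI[OF Z bilin_closed[OF mpq u'(1) v'(1)] sign_act_closed[OF Z1.module_axioms mub, of p]]) auto
  with 1 show ?thesis by simp
qed

section \<open>Pairings after base change\<close>

text \<open>The pairing on base changes nests two lifts. The outer one requires the inner one to
  depend linearly on its parameters, which is inherited from linearity on pure tensors.\<close>

lemma tensor_lift_param:
  assumes M: "module R M" and N: "module R N" and L: "module R L" and A: "module R A"
    and c: "\<And>a. a \<in> carrier A \<Longrightarrow> c a \<in> bilin R M N L"
    and hom: "\<And>x y. \<lbrakk>x \<in> carrier M; y \<in> carrier N\<rbrakk> \<Longrightarrow> (\<lambda>a. c a x y) \<in> mod_hom R A L"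
    and v: "v \<in> carrier (tensor R M N)"
  shows "(\<lambda>a. tensor_lift R L (c a) v) \<in> mod_hom R A L"
proof -
  interpret A: module R A by fact
  note lift = tensor_lift_hom[OF M N L c] and pure = tensor_lift_pure[OF M N L c]
  show ?thesis
  proof (rule mod_homI)
    fix a b assume ab: "a \<in> carrier A" "b \<in> carrier A"
    show "tensor_lift R L (c (a \<oplus>\<^bsub>A\<^esub> b)) v = tensor_lift R L (c a) v \<oplus>\<^bsub>L\<^esub> tensor_lift R L (c b) v"
      by (rule tensor_hom_eqI[OF M N L lift mod_hom_plus[OF L lift lift] _ v])
        (simp_all add: ab pure mod_hom_add[OF hom])
  next
    fix r a assume ra: "r \<in> carrier R" "a \<in> carrier A"
    show "tensor_lift R L (c (r \<odot>\<^bsub>A\<^esub> a)) v = r \<odot>\<^bsub>L\<^esub> tensor_lift R L (c a) v"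
      by (rule tensor_hom_eqI[OF M N L lift mod_hom_scale[OF L lift ra(1)] _ v])
        (simp_all add: ra pure mod_hom_smult[OF hom])
  qed (rule mod_hom_closed[OF lift v])
qed

lemma base_map_hom:
  assumes "module R T" "module R M" "module R N" "f \<in> mod_hom R M N"
  shows "tensor_map R T N id f \<in> mod_hom R (tensor R T M) (tensor R T N)"
  by (rule tensor_map_hom[OF assms(1,2) assms(1,3) _ assms(4)]) (simp add: mod_hom_id id_def)

lemma base_map_pure:
  assumes "module R T" "module R M" "module R N" "f \<in> mod_hom R M N" "t \<in> carrier T" "x \<in> carrier M"
  shows "tensor_map R T N id f (pure_tensor R T M t x) = pure_tensor R T N t (f x)"
  using tensor_map_pure[OF assms(1,2) assms(1,3) _ assms(4-6), of id] by (simp add: mod_hom_id id_def)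

lemma pure_tensor_closed:
  assumes "module R M" "module R N" "x \<in> carrier M" "y \<in> carrier N"
  shows "pure_tensor R M N x y \<in> carrier (tensor R M N)"
  by (rule bilin_closed[OF pure_tensor_bilin[OF assms(1,2)] assms(3,4)])

text \<open>The formula of \<open>chain_pairing\<close> with an arbitrary bilinear map in place of
  the chain map, so that it applies to the homotopy as well.\<close>

definition base_pairing ::
  "('r, 'x) ring_scheme \<Rightarrow> ('r, 't) module \<Rightarrow> ('r, 'n) module \<Rightarrow> ('l \<Rightarrow> 'm \<Rightarrow> 'n) \<Rightarrow>
   ('r, 't, 'l) tensor \<Rightarrow> ('r, 't, 'm) tensor \<Rightarrow> ('r, 't, 'n) tensor" where
  "base_pairing R T Z b u v =
     tensor_lift R (tensor R T Z) (\<lambda>t x. tensor_lift R (tensor R T Z)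
       (\<lambda>t' y. pure_tensor R T Z (t \<otimes>\<^bsub>T\<^esub> t') (b x y)) v) u"

text \<open>The expression \<open>t t' \<otimes> b x y\<close> is linear in each of its four
  variables. The inner lift uses the linearity in \<open>t'\<close> and \<open>y\<close>; the
  linearity in \<open>t\<close> and \<open>x\<close> passes through it by
  \<open>tensor_lift_param\<close>.\<close>

lemma
  assumes T: "algebra R T" and X: "module R X" and Y: "module R Y" and Z: "module R Z"
    and b: "b \<in> bilin R X Y Z"
  shows base_pairing_bilin:
      "base_pairing R T Z b \<in> bilin R (tensor R T X) (tensor R T Y) (tensor R T Z)"
    and base_pairing_pure:
      "\<lbrakk>t \<in> carrier T; x \<in> carrier X; t' \<in> carrier T; y \<in> carrier Y\<rbrakk> \<Longrightarrow>
        base_pairing R T Z b (pure_tensor R T X t x) (pure_tensor R T Y t' y) =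
        pure_tensor R T Z (t \<otimes>\<^bsub>T\<^esub> t') (b x y)"
proof -
  interpret T: algebra R T by fact
  note mT = T.module
  note mTY = module_tensor[OF mT Y] and mTZ = module_tensor[OF mT Z]
  note pure = pure_tensor_bilin[OF mT Z]
  define \<phi> where "\<phi> = (\<lambda>t x t' y. pure_tensor R T Z (t \<otimes>\<^bsub>T\<^esub> t') (b x y))"
  \<comment> \<open>Commutativity of \<open>T\<close> moves the scalar from the right factor to the
    left one.\<close>
  have smult2: "t \<otimes>\<^bsub>T\<^esub> (r \<odot>\<^bsub>T\<^esub> s) = r \<odot>\<^bsub>T\<^esub> (t \<otimes>\<^bsub>T\<^esub> s)"
    if "r \<in> carrier R" "t \<in> carrier T" "s \<in> carrier T" for r t s
    using that T.smult_assoc2[of r s t] by (simp add: T.m_comm[of t])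
  have mult: "(\<otimes>\<^bsub>T\<^esub>) \<in> bilin R T T T"
    by (intro bilinI mod_homI) (simp_all add: T.r_distr T.l_distr smult2 T.smult_assoc2)
  have \<phi>: "\<phi> t x \<in> bilin R T Y (tensor R T Z)" if "t \<in> carrier T" "x \<in> carrier X" for t x
    unfolding \<phi>_def
    by (rule bilin_comp_left[OF bilin_comp_right[OF pure bilin_right[OF b that(2)]] bilin_right[OF mult that(1)]])
  have \<phi>t: "(\<lambda>t. \<phi> t x t' y) \<in> mod_hom R T (tensor R T Z)"
    if "x \<in> carrier X" "t' \<in> carrier T" "y \<in> carrier Y" for x t' y
    unfolding \<phi>_def
    by (rule mod_hom_comp[OF bilin_left[OF mult that(2)] bilin_left[OF pure bilin_closed[OF b that(1,3)]]])
  have \<phi>x: "(\<lambda>x. \<phi> t x t' y) \<in> mod_hom R X (tensor R T Z)"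
    if "t \<in> carrier T" "t' \<in> carrier T" "y \<in> carrier Y" for t t' y
    unfolding \<phi>_def
    by (rule mod_hom_comp[OF bilin_left[OF b that(3)] bilin_right[OF pure bilin_closed[OF mult that(1,2)]]])
  have inner: "(\<lambda>t x. tensor_lift R (tensor R T Z) (\<phi> t x) v) \<in> bilin R T X (tensor R T Z)"
    if v: "v \<in> carrier (tensor R T Y)" for v
  proof (rule bilinI)
    fix t assume t: "t \<in> carrier T"
    show "(\<lambda>x. tensor_lift R (tensor R T Z) (\<phi> t x) v) \<in> mod_hom R X (tensor R T Z)"
      by (rule tensor_lift_param[OF mT Y mTZ X \<phi>[OF t] \<phi>x[OF t] v])
  next
    fix x assume x: "x \<in> carrier X"
    show "(\<lambda>t. tensor_lift R (tensor R T Z) (\<phi> t x) v) \<in> mod_hom R T (tensor R T Z)"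
      by (rule tensor_lift_param[OF mT Y mTZ mT \<phi>[OF _ x] \<phi>t[OF x] v])
  qed
  have eq: "base_pairing R T Z b =
      (\<lambda>u v. tensor_lift R (tensor R T Z) (\<lambda>t x. tensor_lift R (tensor R T Z) (\<phi> t x) v) u)"
    by (intro ext) (simp add: base_pairing_def \<phi>_def)
  show "base_pairing R T Z b \<in> bilin R (tensor R T X) (tensor R T Y) (tensor R T Z)"
    unfolding eq
  proof (rule bilinI)
    fix u assume u: "u \<in> carrier (tensor R T X)"
    show "(\<lambda>v. tensor_lift R (tensor R T Z) (\<lambda>t x. tensor_lift R (tensor R T Z) (\<phi> t x) v) u)
        \<in> mod_hom R (tensor R T Y) (tensor R T Z)"
      by (rule tensor_lift_param[OF mT X mTZ mTY inner tensor_lift_hom[OF mT Y mTZ \<phi>] u])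
  next
    fix v assume "v \<in> carrier (tensor R T Y)"
    then show "(\<lambda>u. tensor_lift R (tensor R T Z) (\<lambda>t x. tensor_lift R (tensor R T Z) (\<phi> t x) v) u)
        \<in> mod_hom R (tensor R T X) (tensor R T Z)"
      by (rule tensor_lift_hom[OF mT X mTZ inner])
  qed
  show "base_pairing R T Z b (pure_tensor R T X t x) (pure_tensor R T Y t' y) =
      pure_tensor R T Z (t \<otimes>\<^bsub>T\<^esub> t') (b x y)"
    if "t \<in> carrier T" "x \<in> carrier X" "t' \<in> carrier T" "y \<in> carrier Y"
    using that tensor_lift_pure[OF mT X mTZ inner[OF pure_tensor_closed[OF mT Y that(3,4)]] that(1,2)]
      tensor_lift_pure[OF mT Y mTZ \<phi>[OF that(1,2)] that(3,4)]
    by (simp add: eq) (simp add: \<phi>_def)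
qed

lemma base_change_simps:
  "cmod (base_change R T C) n = tensor R T (cmod C n)"
  "cdiff (base_change R T C) n = tensor_map R T (cmod C (n - 1)) id (cdiff C n)"
  by (simp_all add: base_change_def)

lemma is_complex_base_change:
  assumes T: "module R T" and C: "is_complex R C"
  shows "is_complex R (base_change R T C)"
proof -
  note mC = complex_module[OF C] and dC = complex_diff[OF C refl]
  note d = base_map_hom[OF T mC mC dC]
  have "tensor_map R T (cmod C (n - 1 - 1)) id (cdiff C (n - 1)) (tensor_map R T (cmod C (n - 1)) id (cdiff C n) u)
      = \<zero>\<^bsub>tensor R T (cmod C (n - 2))\<^esub>"
    if u: "u \<in> carrier (tensor R T (cmod C n))" for n u
  proof -
    have e: "n - 1 - 1 = n - 2" by simp
    note d' = d[of "n - 1", unfolded e]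
    have z: "pure_tensor R T (cmod C (n - 2)) t \<zero>\<^bsub>cmod C (n - 2)\<^esub> = \<zero>\<^bsub>tensor R T (cmod C (n - 2))\<^esub>"
      if "t \<in> carrier T" for t
      by (rule bilin_zero_right[OF mC module_tensor[OF T mC] pure_tensor_bilin[OF T mC] that])
    show ?thesis
      unfolding e
    proof (rule tensor_hom_eqI[OF T mC module_tensor[OF T mC] mod_hom_comp[OF d d'] mod_hom_null[OF module_tensor[OF T mC]] _ u])
      fix t x assume "t \<in> carrier T" "x \<in> carrier (cmod C n)"
      then show "tensor_map R T (cmod C (n - 2)) id (cdiff C (n - 1))
          (tensor_map R T (cmod C (n - 1)) id (cdiff C n) (pure_tensor R T (cmod C n) t x)) = \<zero>\<^bsub>tensor R T (cmod C (n - 2))\<^esub>"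
        by (simp add: base_map_pure[OF T mC mC complex_diff[OF C]] mod_hom_closed[OF dC] z
            complex_diff_diff[OF C _ refl refl])
    qed
  qed
  then show ?thesis
    unfolding is_complex_def base_change_simps using d module_tensor[OF T mC] by simp
qed

text \<open>On pure tensors this is the original Leibniz rule tensored with \<open>t t'\<close>.
  Elements of \<open>T\<close> have degree 0, so interchanging \<open>x\<close> and
  \<open>t'\<close> contributes no sign.\<close>

lemma dg_pairing_base_change:
  assumes T: "algebra R T" and X: "is_complex R X" and Y: "is_complex R Y" and Z: "is_complex R Z"
    and m: "dg_pairing R X Y Z m"
  shows "dg_pairing R (base_change R T X) (base_change R T Y) (base_change R T Z)
    (\<lambda>p q. base_pairing R T (cmod Z (p + q)) (m p q))"
proof -
  note mT = algebra.module[OF T]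
  note mX = complex_module[OF X] and mY = complex_module[OF Y] and mZ = complex_module[OF Z]
  note dX = complex_diff[OF X refl] and dY = complex_diff[OF Y refl] and dZ = complex_diff[OF Z refl]
  note bp = base_pairing_bilin[OF T mX mY mZ dg_pairing_bilin[OF m]]
    and bp_pure = base_pairing_pure[OF T mX mY mZ dg_pairing_bilin[OF m]]
  note d_pure = base_map_pure[OF mT mX mX dX] base_map_pure[OF mT mY mY dY] base_map_pure[OF mT mZ mZ dZ]
  show ?thesis
    unfolding dg_pairing_def base_change_simps
  proof (intro conjI allI ballI)
    fix p q
    show "base_pairing R T (cmod Z (p + q)) (m p q)
        \<in> bilin R (tensor R T (cmod X p)) (tensor R T (cmod Y q)) (tensor R T (cmod Z (p + q)))"
      by (rule bp) simp
    let ?TZ = "tensor R T (cmod Z (p + q - 1))"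
    fix u v assume u: "u \<in> carrier (tensor R T (cmod X p))" and v: "v \<in> carrier (tensor R T (cmod Y q))"
    have e: "p - 1 + q = p + q - 1" "p + (q - 1) = p + q - 1" by simp_all
    note mTZ = module_tensor[OF mT mZ]
    note bl = bilin_comp_left[OF bp base_map_hom[OF mT mX mX dX]]
    note br = bilin_comp_right[OF bp base_map_hom[OF mT mY mY dY]]
    show "tensor_map R T (cmod Z (p + q - 1)) id (cdiff Z (p + q)) (base_pairing R T (cmod Z (p + q)) (m p q) u v) =
        base_pairing R T (cmod Z (p - 1 + q)) (m (p - 1) q) (tensor_map R T (cmod X (p - 1)) id (cdiff X p) u) v
        \<oplus>\<^bsub>?TZ\<^esub> sign_act ?TZ p
          (base_pairing R T (cmod Z (p + (q - 1))) (m p (q - 1)) u (tensor_map R T (cmod Y (q - 1)) id (cdiff Y q) v))"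
      unfolding e
    proof (rule tensor_bilin_eqI[OF mT mX mT mY mTZ _ _ _ u v])
      show "(\<lambda>u v. tensor_map R T (cmod Z (p + q - 1)) id (cdiff Z (p + q)) (base_pairing R T (cmod Z (p + q)) (m p q) u v))
          \<in> bilin R (tensor R T (cmod X p)) (tensor R T (cmod Y q)) ?TZ"
        by (rule bilin_comp_hom[OF bp base_map_hom[OF mT mZ mZ dZ]]) simp
      show "(\<lambda>u v. base_pairing R T (cmod Z (p + q - 1)) (m (p - 1) q) (tensor_map R T (cmod X (p - 1)) id (cdiff X p) u) v
          \<oplus>\<^bsub>?TZ\<^esub> sign_act ?TZ p
          (base_pairing R T (cmod Z (p + q - 1)) (m p (q - 1)) u (tensor_map R T (cmod Y (q - 1)) id (cdiff Y q) v)))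
          \<in> bilin R (tensor R T (cmod X p)) (tensor R T (cmod Y q)) ?TZ"
        by (rule bilin_plus[OF mTZ bl bilin_sign_act[OF mTZ br]]) simp_all
      fix t x t' y
      assume a: "t \<in> carrier T" "x \<in> carrier (cmod X p)" "t' \<in> carrier T" "y \<in> carrier (cmod Y q)"
      interpret T: algebra R T by fact
      have tt: "t \<otimes>\<^bsub>T\<^esub> t' \<in> carrier T" using a by simp
      note P = bilin_right[OF pure_tensor_bilin[OF mT mZ] tt, of "p + q - 1"]
      have c1: "m (p - 1) q (cdiff X p x) y \<in> carrier (cmod Z (p + q - 1))"
        by (rule bilin_closed[OF dg_pairing_bilin[OF m] mod_hom_closed[OF dX a(2)] a(4)]) simp
      have c2: "m p (q - 1) x (cdiff Y q y) \<in> carrier (cmod Z (p + q - 1))"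
        by (rule bilin_closed[OF dg_pairing_bilin[OF m] a(2) mod_hom_closed[OF dY a(4)]]) simp
      have "pure_tensor R T (cmod Z (p + q - 1)) (t \<otimes>\<^bsub>T\<^esub> t') (cdiff Z (p + q) (m p q x y)) =
        pure_tensor R T (cmod Z (p + q - 1)) (t \<otimes>\<^bsub>T\<^esub> t') (m (p - 1) q (cdiff X p x) y) \<oplus>\<^bsub>?TZ\<^esub>
        sign_act ?TZ p (pure_tensor R T (cmod Z (p + q - 1)) (t \<otimes>\<^bsub>T\<^esub> t') (m p (q - 1) x (cdiff Y q y)))"
        using c1 c2
        by (simp add: dg_pairing_Leibniz[OF m a(2,4) refl refl] mod_hom_add[OF P] mod_hom_sign[OF mZ mTZ P]
            sign_act_closed[OF mZ])
      then show "tensor_map R T (cmod Z (p + q - 1)) id (cdiff Z (p + q))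
          (base_pairing R T (cmod Z (p + q)) (m p q) (pure_tensor R T (cmod X p) t x) (pure_tensor R T (cmod Y q) t' y)) =
        base_pairing R T (cmod Z (p + q - 1)) (m (p - 1) q)
          (tensor_map R T (cmod X (p - 1)) id (cdiff X p) (pure_tensor R T (cmod X p) t x)) (pure_tensor R T (cmod Y q) t' y)
        \<oplus>\<^bsub>?TZ\<^esub> sign_act ?TZ p
          (base_pairing R T (cmod Z (p + q - 1)) (m p (q - 1)) (pure_tensor R T (cmod X p) t x)
            (tensor_map R T (cmod Y (q - 1)) id (cdiff Y q) (pure_tensor R T (cmod Y q) t' y)))"
        using a tt by (simp add: d_pure bp_pure mod_hom_closed[OF dX] mod_hom_closed[OF dY]
            bilin_closed[OF dg_pairing_bilin[OF m]])
    qed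
  qed
qed

text \<open>The restriction of \<mu> to the summand with indices \<open>p\<close> and
  \<open>q\<close> of the tensor product complex.\<close>

definition chain_bilin ::
  "('r, 'x) ring_scheme \<Rightarrow> ('r, 'l, 'u) chain_complex_scheme \<Rightarrow> ('r, 'm, 'v) chain_complex_scheme \<Rightarrow>
   (int \<Rightarrow> (int \<Rightarrow> ('r, 'l, 'm) tensor) \<Rightarrow> 'n) \<Rightarrow> int \<Rightarrow> int \<Rightarrow> 'l \<Rightarrow> 'm \<Rightarrow> 'n" where
  "chain_bilin R X Y \<mu> p q x y =
     \<mu> (p + q) (direct_sum_in (\<lambda>j. tensor R (cmod X j) (cmod Y (p + q - j))) p
       (pure_tensor R (cmod X p) (cmod Y q) x y))"

lemma chain_pairing_eq:
  "chain_pairing R T X Y Z \<mu> p q = base_pairing R T (cmod Z (p + q)) (chain_bilin R X Y \<mu> p q)"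
  by (intro ext) (simp add: chain_pairing_def base_pairing_def chain_bilin_def Let_def)

lemma direct_sum_in_hom:
  assumes M: "\<And>i. module R (M i)"
  shows "direct_sum_in M i \<in> mod_hom R (M i) (direct_sum M)"
proof -
  interpret M: module R "M i" for i by (rule M)
  have "finite {j. direct_sum_in M i x j \<noteq> \<zero>\<^bsub>M j\<^esub>}" for x
    by (rule finite_subset[of _ "{i}"]) (auto simp: direct_sum_in_def)
  then show ?thesis
    by (intro mod_homI) (auto simp: direct_sum_def direct_sum_in_def)
qed

text \<open>The differential of an element concentrated in component \<open>p\<close> is
  concentrated in the components \<open>p - 1\<close> and \<open>p\<close>, which hold
  \<open>d x \<otimes> y\<close> and the signed \<open>x \<otimes> d y\<close>. Applying \<mu> gives
  the Leibniz rule.\<close>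

lemma dg_pairing_chain_bilin:
  assumes R: "cring R" and X: "is_complex R X" and Y: "is_complex R Y" and Z: "is_complex R Z"
    and \<mu>: "chain_map R (tensor_complex R X Y) Z \<mu>"
  shows "dg_pairing R X Y Z (chain_bilin R X Y \<mu>)"
proof -
  note mX = complex_module[OF X] and mY = complex_module[OF Y] and mZ = complex_module[OF Z]
  note dX = complex_diff[OF X] and dY = complex_diff[OF Y]
  let ?M = "\<lambda>n j. tensor R (cmod X j) (cmod Y (n - j))"
  have mM: "module R (?M n j)" for n j by (rule module_tensor[OF mX mY])
  have \<mu>_hom: "\<mu> n \<in> mod_hom R (direct_sum (?M n)) (cmod Z n)" for n
    using \<mu> by (simp add: chain_map_def tensor_complex_def)
  have inj: "direct_sum_in (?M n) j \<in> mod_hom R (?M n j) (direct_sum (?M n))" for n j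
    by (rule direct_sum_in_hom[OF mM])
  have \<mu>in: "(\<lambda>w. \<mu> n (direct_sum_in (?M n) j w)) \<in> mod_hom R (?M n j) (cmod Z n)" for n j
    by (rule mod_hom_comp[OF inj \<mu>_hom])
  have \<mu>_diff: "cdiff Z n (\<mu> n w) = \<mu> (n - 1) (cdiff (tensor_complex R X Y) n w)"
    if "w \<in> carrier (direct_sum (?M n))" for n w
    using \<mu> that by (simp add: chain_map_def tensor_complex_def)
  show ?thesis
    unfolding dg_pairing_def
  proof (intro conjI allI ballI)
    fix p q :: int
    have e: "p + q - p = q" by simp
    show "chain_bilin R X Y \<mu> p q \<in> bilin R (cmod X p) (cmod Y q) (cmod Z (p + q))"
      unfolding chain_bilin_def
      by (rule bilin_comp_hom[OF pure_tensor_bilin[OF mX mY] \<mu>in[of "p + q" p, unfolded e]])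
    fix x y assume x: "x \<in> carrier (cmod X p)" and y: "y \<in> carrier (cmod Y q)"
    define n where "n = p + q"
    \<comment> \<open>Component \<open>j\<close> in degree \<open>n\<close> involves
      \<open>Y\<close> in degree \<open>n - j\<close>. These equations identify the modules indexed
      by differences with those indexed by \<open>q\<close>.\<close>
    have n: "n - p = q" "n - 1 - p = q - 1" "n - 1 - (p - 1) = q" "p - 1 + q = n - 1" "p + (q - 1) = n - 1"
      by (simp_all add: n_def)
    let ?w = "pure_tensor R (cmod X p) (cmod Y q) x y"
    let ?a = "pure_tensor R (cmod X (p - 1)) (cmod Y q) (cdiff X p x) y"
    let ?b = "pure_tensor R (cmod X p) (cmod Y (q - 1)) x (cdiff Y q y)"
    have dx: "cdiff X p x \<in> carrier (cmod X (p - 1))" and dy: "cdiff Y q y \<in> carrier (cmod Y (q - 1))"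
      using mod_hom_closed[OF dX[OF refl] x] mod_hom_closed[OF dY[OF refl] y] .
    have w: "?w \<in> carrier (?M n p)" using pure_tensor_closed[OF mX mY x y] by (simp add: n)
    have a: "?a \<in> carrier (?M (n - 1) (p - 1))" using pure_tensor_closed[OF mX mY dx y] by (simp only: n)
    have b: "?b \<in> carrier (?M (n - 1) p)" using pure_tensor_closed[OF mX mY x dy] by (simp add: n)
    have sb: "sign_act (?M (n - 1) p) p ?b \<in> carrier (?M (n - 1) p)" by (rule sign_act_closed[OF mM b])
    have l_hom: "tensor_map R (cmod X j) (cmod Y (n - 1 - j)) (cdiff X (j + 1)) id \<in>
        mod_hom R (?M n (j + 1)) (?M (n - 1) j)" for j
    proof -
      have e: "n - 1 - j = n - (j + 1)" by simp
      show ?thesis unfolding e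
        by (rule tensor_map_hom[OF mX mY mX mY dX]) (simp_all add: mod_hom_id id_def)
    qed
    have r_hom: "tensor_map R (cmod X j) (cmod Y (n - 1 - j)) id (cdiff Y (n - j)) \<in>
        mod_hom R (?M n j) (?M (n - 1) j)" for j
      by (rule tensor_map_hom[OF mX mY mX mY _ dY]) (simp_all add: mod_hom_id id_def)
    have l_w: "tensor_map R (cmod X (p - 1)) (cmod Y q) (cdiff X p) id ?w = ?a"
      using tensor_map_pure[OF mX mY mX mY dX _ x y, of "p - 1" id q] by (simp add: mod_hom_id id_def)
    have r_w: "tensor_map R (cmod X p) (cmod Y (q - 1)) id (cdiff Y q) ?w = ?b"
      using tensor_map_pure[OF mX mY mX mY _ dY x y, of id p "q - 1"] by (simp add: mod_hom_id id_def)
    have "cdiff (tensor_complex R X Y) n (direct_sum_in (?M n) p ?w) j =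
        (direct_sum_in (?M (n - 1)) (p - 1) ?a \<oplus>\<^bsub>direct_sum (?M (n - 1))\<^esub>
         direct_sum_in (?M (n - 1)) p (sign_act (?M (n - 1) p) p ?b)) j" (is "?L j = ?R j") for j
    proof -
      interpret Mj: module R "?M (n - 1) j" by (rule mM)
      note l0 = mod_hom_zero[OF mM mM l_hom] and r0 = mod_hom_zero[OF mM mM r_hom]
      have L: "?L j = tensor_map R (cmod X j) (cmod Y (n - 1 - j)) (cdiff X (j + 1)) id (direct_sum_in (?M n) p ?w (j + 1))
         \<oplus>\<^bsub>?M (n - 1) j\<^esub> sign_act (?M (n - 1) j) j
           (tensor_map R (cmod X j) (cmod Y (n - 1 - j)) id (cdiff Y (n - j)) (direct_sum_in (?M n) p ?w j))"
        by (simp add: tensor_complex_def)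
      have R: "?R j = direct_sum_in (?M (n - 1)) (p - 1) ?a j \<oplus>\<^bsub>?M (n - 1) j\<^esub>
          direct_sum_in (?M (n - 1)) p (sign_act (?M (n - 1) p) p ?b) j"
        by (simp add: direct_sum_def)
      \<comment> \<open>Component \<open>j\<close> of the differential reads components
        \<open>j + 1\<close> and \<open>j\<close>, of which at most one is the component
        \<open>p\<close> holding \<open>x \<otimes> y\<close>.\<close>
      consider "j = p - 1" | "j = p" | "j \<noteq> p - 1" "j \<noteq> p" by blast
      then show ?thesis
      proof cases
        case 1
        then have j: "j + 1 = p" "j \<noteq> p" by simp_all
        have "direct_sum_in (?M n) p ?w j = \<zero>\<^bsub>?M n j\<^esub>" using j by (simp add: direct_sum_in_def)
        moreover have "direct_sum_in (?M n) p ?w (j + 1) = ?w" using j by (simp add: direct_sum_in_def)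
        moreover have "direct_sum_in (?M (n - 1)) p (sign_act (?M (n - 1) p) p ?b) j = \<zero>\<^bsub>?M (n - 1) j\<^esub>"
          using j by (simp add: direct_sum_in_def)
        moreover have "direct_sum_in (?M (n - 1)) (p - 1) ?a j = ?a" using 1 by (simp add: direct_sum_in_def)
        moreover have "n - 1 - j = q" using 1 n by simp
        ultimately show ?thesis
          unfolding L R using l_w r0[of j] 1 by (simp only: diff_add_cancel sign_act_zero[OF module_tensor[OF mX mY]])
      next
        case 2
        then have j: "j + 1 \<noteq> p" "j \<noteq> p - 1" by simp_all
        have "direct_sum_in (?M n) p ?w (j + 1) = \<zero>\<^bsub>?M n (j + 1)\<^esub>" using j by (simp add: direct_sum_in_def)
        moreover have "direct_sum_in (?M n) p ?w j = ?w" using 2 by (simp add: direct_sum_in_def)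
        moreover have "direct_sum_in (?M (n - 1)) p (sign_act (?M (n - 1) p) p ?b) j = sign_act (?M (n - 1) p) p ?b"
          using 2 by (simp add: direct_sum_in_def)
        moreover have "direct_sum_in (?M (n - 1)) (p - 1) ?a j = \<zero>\<^bsub>?M (n - 1) j\<^esub>"
          using j by (simp add: direct_sum_in_def)
        ultimately show ?thesis
          unfolding L R using r_w l0[of j] 2 by (simp only: n)
      next
        case 3
        then have j: "j + 1 \<noteq> p" by simp
        have "direct_sum_in (?M n) p ?w (j + 1) = \<zero>\<^bsub>?M n (j + 1)\<^esub>" using j by (simp add: direct_sum_in_def)
        moreover have "direct_sum_in (?M n) p ?w j = \<zero>\<^bsub>?M n j\<^esub>" using 3 by (simp add: direct_sum_in_def)
        moreover have "direct_sum_in (?M (n - 1)) p (sign_act (?M (n - 1) p) p ?b) j = \<zero>\<^bsub>?M (n - 1) j\<^esub>"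
          "direct_sum_in (?M (n - 1)) (p - 1) ?a j = \<zero>\<^bsub>?M (n - 1) j\<^esub>"
          using 3 by (simp_all add: direct_sum_in_def)
        ultimately show ?thesis
          unfolding L R using l0[of j] r0[of j] by (simp only: sign_act_zero[OF mM])
      qed
    qed
    then have d: "cdiff (tensor_complex R X Y) n (direct_sum_in (?M n) p ?w) =
        direct_sum_in (?M (n - 1)) (p - 1) ?a \<oplus>\<^bsub>direct_sum (?M (n - 1))\<^esub>
         direct_sum_in (?M (n - 1)) p (sign_act (?M (n - 1) p) p ?b)" by (rule ext)
    have "cdiff Z n (\<mu> n (direct_sum_in (?M n) p ?w)) =
        \<mu> (n - 1) (direct_sum_in (?M (n - 1)) (p - 1) ?a) \<oplus>\<^bsub>cmod Z (n - 1)\<^esub>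
        sign_act (cmod Z (n - 1)) p (\<mu> (n - 1) (direct_sum_in (?M (n - 1)) p ?b))"
      unfolding \<mu>_diff[OF mod_hom_closed[OF inj w]] d
        mod_hom_add[OF \<mu>_hom mod_hom_closed[OF inj a] mod_hom_closed[OF inj sb]]
      by (simp only: mod_hom_sign[OF mM mZ \<mu>in b])
    then show "cdiff Z (p + q) (chain_bilin R X Y \<mu> p q x y) =
        chain_bilin R X Y \<mu> (p - 1) q (cdiff X p x) y \<oplus>\<^bsub>cmod Z (p + q - 1)\<^esub>
        sign_act (cmod Z (p + q - 1)) p (chain_bilin R X Y \<mu> p (q - 1) x (cdiff Y q y))"
      unfolding chain_bilin_def n(4,5) n_def[symmetric] .
  qed
qed

lemma chain_bilin_aug:
  assumes X: "is_complex R X" and Y: "is_complex R Y"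
    and L: "module R L" and M: "module R M" and N: "module R N"
    and \<mu>: "lifts_pairing R L M N b X Y Z \<mu>" and b: "b \<in> bilin R L M N"
    and aX: "aug X \<in> mod_hom R (cmod X 0) L" and aY: "aug Y \<in> mod_hom R (cmod Y 0) M"
    and x: "x \<in> carrier (cmod X 0)" and y: "y \<in> carrier (cmod Y 0)"
  shows "aug Z (chain_bilin R X Y \<mu> 0 0 x y) = b (aug X x) (aug Y y)"
proof -
  note mX = complex_module[OF X] and mY = complex_module[OF Y]
  let ?M = "\<lambda>j. tensor R (cmod X j) (cmod Y (0 - j))"
  let ?w = "pure_tensor R (cmod X 0) (cmod Y 0) x y"
  have "?w \<in> carrier (?M 0)" using pure_tensor_closed[OF mX mY x y] by simp
  then have "direct_sum_in ?M 0 ?w \<in> carrier (cmod (tensor_complex R X Y) 0)"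
    using mod_hom_closed[OF direct_sum_in_hom[of R ?M 0, OF module_tensor[OF mX mY]]]
    by (simp add: tensor_complex_def)
  then have "aug Z (\<mu> 0 (direct_sum_in ?M 0 ?w)) =
      tensor_lift R N b (tensor_map R L M (aug X) (aug Y) (direct_sum_in ?M 0 ?w 0))"
    using \<mu> by (simp add: lifts_pairing_def)
  also have "direct_sum_in ?M 0 ?w 0 = ?w" by (simp add: direct_sum_in_def)
  also have "tensor_lift R N b (tensor_map R L M (aug X) (aug Y) ?w) = b (aug X x) (aug Y y)"
    by (simp add: tensor_map_pure[OF mX mY L M aX aY x y] tensor_lift_pure[OF L M N b]
        mod_hom_closed[OF aX x] mod_hom_closed[OF aY y])
  finally show ?thesis by (simp add: chain_bilin_def)
qed

text \<open>By \<open>dg_pairing_class\<close> all choices of representatives give one class, so the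
  definite description may be evaluated at any cycles \<open>u\<close> and \<open>v\<close>.\<close>

lemma Tor_pairing_eq:
  assumes T: "algebra R T" and X: "is_complex R X" and Y: "is_complex R Y" and Z: "is_complex R Z"
    and \<mu>: "chain_map R (tensor_complex R X Y) Z \<mu>"
    and \<alpha>: "\<alpha> \<in> carrier (Tor R T X p)" "u \<in> \<alpha>" and \<beta>: "\<beta> \<in> carrier (Tor R T Y q)" "v \<in> \<beta>"
  shows "Tor_pairing R T X Y Z \<mu> p q \<alpha> \<beta> =
    homology_class (base_change R T Z) (p + q) (base_pairing R T (cmod Z (p + q)) (chain_bilin R X Y \<mu> p q) u v)"
proof -
  note mT = algebra.module[OF T]
  interpret T: algebra R T by fact
  note bc = is_complex_base_change[OF mT]
  note pairing = dg_pairing_base_change[OF T X Y Z dg_pairing_chain_bilin[OF T.R_cring X Y Z \<mu>]]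
  note indep = dg_pairing_class[OF bc[OF X] bc[OF Y] bc[OF Z] pairing \<alpha>(1)[unfolded Tor_def] \<alpha>(2) _
      \<beta>(1)[unfolded Tor_def] \<beta>(2) _ refl]
  show ?thesis
    unfolding Tor_pairing_def chain_pairing_eq
  proof (rule the_equality)
    show "\<exists>u'\<in>\<alpha>. \<exists>v'\<in>\<beta>. homology_class (base_change R T Z) (p + q)
        (base_pairing R T (cmod Z (p + q)) (chain_bilin R X Y \<mu> p q) u v) =
      homology_class (base_change R T Z) (p + q)
        (base_pairing R T (cmod Z (p + q)) (chain_bilin R X Y \<mu> p q) u' v')"
      using \<alpha>(2) \<beta>(2) by blast
  qed (auto simp: indep)
qed

section \<open>The connecting homomorphism of a split extension of complexes\<close>

text \<open>A degreewise splitting \<open>s\<close> of \<open>g\<close> identifies the middle complex with \<open>P \<oplus> Q'\<close>. Its differential is then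
  determined by the component \<open>\<tau>\<close> from \<open>Q'\<close> to \<open>P\<close>, which anticommutes with the differentials and induces the
  connecting homomorphism. Unlike exactness, this data is preserved by base change.\<close>

definition split_extension ::
  "('r, 'x) ring_scheme \<Rightarrow> ('r, 'l, 'u) chain_complex_scheme \<Rightarrow> ('r, 'm, 'v) chain_complex_scheme \<Rightarrow>
   ('r, 'n, 'w) chain_complex_scheme \<Rightarrow> (int \<Rightarrow> 'l \<Rightarrow> 'm) \<Rightarrow> (int \<Rightarrow> 'm \<Rightarrow> 'n) \<Rightarrow>
   (int \<Rightarrow> 'n \<Rightarrow> 'm) \<Rightarrow> (int \<Rightarrow> 'n \<Rightarrow> 'l) \<Rightarrow> (int \<Rightarrow> 'm \<Rightarrow> 'l) \<Rightarrow> bool" where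
  "split_extension R P Q Q' f g s \<tau> \<rho> \<longleftrightarrow> (\<forall>n.
     f n \<in> mod_hom R (cmod P n) (cmod Q n) \<and> g n \<in> mod_hom R (cmod Q n) (cmod Q' n) \<and>
     s n \<in> mod_hom R (cmod Q' n) (cmod Q n) \<and> \<tau> n \<in> mod_hom R (cmod Q' n) (cmod P (n - 1)) \<and>
     \<rho> n \<in> mod_hom R (cmod Q n) (cmod P n) \<and>
     (\<forall>x\<in>carrier (cmod P n). f (n - 1) (cdiff P n x) = cdiff Q n (f n x)) \<and>
     (\<forall>x\<in>carrier (cmod P n). \<rho> n (f n x) = x) \<and>
     (\<forall>z\<in>carrier (cmod Q' n). g n (s n z) = z) \<and>
     (\<forall>z\<in>carrier (cmod Q' n). cdiff Q n (s n z) =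
        f (n - 1) (\<tau> n z) \<oplus>\<^bsub>cmod Q (n - 1)\<^esub> s (n - 1) (cdiff Q' n z)) \<and>
     (\<forall>y\<in>carrier (cmod Q n). y = s n (g n y) \<oplus>\<^bsub>cmod Q n\<^esub> f n (\<rho> n y)))"

lemma split_extensionD:
  assumes "split_extension R P Q Q' f g s \<tau> \<rho>"
  shows "f n \<in> mod_hom R (cmod P n) (cmod Q n)" "g n \<in> mod_hom R (cmod Q n) (cmod Q' n)"
    "s n \<in> mod_hom R (cmod Q' n) (cmod Q n)" "\<tau> n \<in> mod_hom R (cmod Q' n) (cmod P (n - 1))"
    "\<rho> n \<in> mod_hom R (cmod Q n) (cmod P n)"
    "x \<in> carrier (cmod P n) \<Longrightarrow> f (n - 1) (cdiff P n x) = cdiff Q n (f n x)"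
    "x \<in> carrier (cmod P n) \<Longrightarrow> \<rho> n (f n x) = x"
    "z \<in> carrier (cmod Q' n) \<Longrightarrow> g n (s n z) = z"
    "z \<in> carrier (cmod Q' n) \<Longrightarrow> cdiff Q n (s n z) =
      f (n - 1) (\<tau> n z) \<oplus>\<^bsub>cmod Q (n - 1)\<^esub> s (n - 1) (cdiff Q' n z)"
    "y \<in> carrier (cmod Q n) \<Longrightarrow> y = s n (g n y) \<oplus>\<^bsub>cmod Q n\<^esub> f n (\<rho> n y)"
  using assms unfolding split_extension_def by blast+

text \<open>The section \<open>s\<close> lifts the identity along \<open>g\<close>. Both
  \<open>d s - s d\<close> and \<open>1 - s g\<close> take values in the kernel of \<open>g\<close>,
  which is the image of \<open>f\<close>; lifting them along \<open>f\<close> gives \<tau> and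
  \<rho>.\<close>

lemma split_extension_exists:
  assumes P: "is_complex R P" and Q: "is_complex R Q" and Q': "is_complex R Q'"
    and proj: "\<And>n. projective_module R (cmod Q n)" "\<And>n. projective_module R (cmod Q' n)"
    and ses: "short_exact_complexes R P Q Q' f g"
  obtains s \<tau> \<rho> where "split_extension R P Q Q' f g s \<tau> \<rho>"
proof -
  note mP = complex_module[OF P] and mQ = complex_module[OF Q] and mQ' = complex_module[OF Q']
  note dQ = complex_diff[OF Q refl] and dQ' = complex_diff[OF Q' refl]
  have f: "f n \<in> mod_hom R (cmod P n) (cmod Q n)" and g: "g n \<in> mod_hom R (cmod Q n) (cmod Q' n)"
    and fd: "x \<in> carrier (cmod P n) \<Longrightarrow> f (n - 1) (cdiff P n x) = cdiff Q n (f n x)"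
    and gd: "y \<in> carrier (cmod Q n) \<Longrightarrow> g (n - 1) (cdiff Q n y) = cdiff Q' n (g n y)"
    and inj: "inj_on (f n) (carrier (cmod P n))"
    and ker: "f n ` carrier (cmod P n) = {y \<in> carrier (cmod Q n). g n y = \<zero>\<^bsub>cmod Q' n\<^esub>}"
    and surj: "g n ` carrier (cmod Q n) = carrier (cmod Q' n)" for n x y
    using ses by (auto simp: short_exact_complexes_def chain_map_def a_kernel_def')
  have "\<exists>s. s \<in> mod_hom R (cmod Q' n) (cmod Q n) \<and> (\<forall>z\<in>carrier (cmod Q' n). g n (s z) = z)" for n
    using projective_lift[OF proj(2) mQ' mQ g mod_hom_id] surj by metis
  then obtain s where s: "s n \<in> mod_hom R (cmod Q' n) (cmod Q n)"
    and gs: "z \<in> carrier (cmod Q' n) \<Longrightarrow> g n (s n z) = z" for n z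
    by metis
  have "\<exists>t. t \<in> mod_hom R (cmod Q' n) (cmod P (n - 1)) \<and> (\<forall>z\<in>carrier (cmod Q' n). f (n - 1) (t z) =
      cdiff Q n (s n z) \<oplus>\<^bsub>cmod Q (n - 1)\<^esub> \<ominus>\<^bsub>cmod Q (n - 1)\<^esub> s (n - 1) (cdiff Q' n z))" for n
  proof -
    interpret Q'n: module R "cmod Q' (n - 1)" by (rule mQ')
    have hom: "(\<lambda>z. cdiff Q n (s n z) \<oplus>\<^bsub>cmod Q (n - 1)\<^esub> \<ominus>\<^bsub>cmod Q (n - 1)\<^esub> s (n - 1) (cdiff Q' n z))
        \<in> mod_hom R (cmod Q' n) (cmod Q (n - 1))"
      by (rule mod_hom_plus[OF mQ mod_hom_comp[OF s dQ] mod_hom_uminus[OF mQ mod_hom_comp[OF dQ' s]]])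
    have "cdiff Q n (s n z) \<oplus>\<^bsub>cmod Q (n - 1)\<^esub> \<ominus>\<^bsub>cmod Q (n - 1)\<^esub> s (n - 1) (cdiff Q' n z)
        \<in> f (n - 1) ` carrier (cmod P (n - 1))" if z: "z \<in> carrier (cmod Q' n)" for z
    proof -
      interpret Qn: module R "cmod Q (n - 1)" by (rule mQ)
      have c: "cdiff Q n (s n z) \<in> carrier (cmod Q (n - 1))" "s (n - 1) (cdiff Q' n z) \<in> carrier (cmod Q (n - 1))"
        "s n z \<in> carrier (cmod Q n)" "cdiff Q' n z \<in> carrier (cmod Q' (n - 1))"
        using z by (simp_all add: mod_hom_closed[OF s] mod_hom_closed[OF dQ] mod_hom_closed[OF dQ'])
      show ?thesis unfolding ker
        using c z by (simp add: mod_hom_add[OF g] mod_hom_minus[OF mQ mQ' g] gd gs Q'n.r_neg)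
    qed
    from projective_lift[OF proj(2) mQ mP f hom this] show ?thesis by metis
  qed
  then obtain \<tau> where \<tau>: "\<tau> n \<in> mod_hom R (cmod Q' n) (cmod P (n - 1))"
    and f\<tau>: "z \<in> carrier (cmod Q' n) \<Longrightarrow> f (n - 1) (\<tau> n z) =
      cdiff Q n (s n z) \<oplus>\<^bsub>cmod Q (n - 1)\<^esub> \<ominus>\<^bsub>cmod Q (n - 1)\<^esub> s (n - 1) (cdiff Q' n z)" for n z
    by metis
  have "\<exists>t. t \<in> mod_hom R (cmod Q n) (cmod P n) \<and>
      (\<forall>y\<in>carrier (cmod Q n). f n (t y) = y \<oplus>\<^bsub>cmod Q n\<^esub> \<ominus>\<^bsub>cmod Q n\<^esub> s n (g n y))" for n
  proof -
    interpret Q'n: module R "cmod Q' n" by (rule mQ')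
    interpret Qn: module R "cmod Q n" by (rule mQ)
    have hom: "(\<lambda>y. y \<oplus>\<^bsub>cmod Q n\<^esub> \<ominus>\<^bsub>cmod Q n\<^esub> s n (g n y)) \<in> mod_hom R (cmod Q n) (cmod Q n)"
      by (rule mod_hom_plus[OF mQ mod_hom_id mod_hom_uminus[OF mQ mod_hom_comp[OF g s]]])
    have "y \<oplus>\<^bsub>cmod Q n\<^esub> \<ominus>\<^bsub>cmod Q n\<^esub> s n (g n y) \<in> f n ` carrier (cmod P n)" if "y \<in> carrier (cmod Q n)" for y
      unfolding ker using that
      by (simp add: mod_hom_add[OF g] mod_hom_minus[OF mQ mQ' g] mod_hom_closed[OF s] mod_hom_closed[OF g] gs Q'n.r_neg)
    from projective_lift[OF proj(1) mQ mP f hom this] show ?thesis by metis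
  qed
  then obtain \<rho> where \<rho>: "\<rho> n \<in> mod_hom R (cmod Q n) (cmod P n)"
    and f\<rho>: "y \<in> carrier (cmod Q n) \<Longrightarrow> f n (\<rho> n y) = y \<oplus>\<^bsub>cmod Q n\<^esub> \<ominus>\<^bsub>cmod Q n\<^esub> s n (g n y)" for n y
    by metis
  \<comment> \<open>Since \<open>g f = 0\<close>, the correction term \<open>s g\<close> vanishes on
    \<open>f x\<close>, and \<open>f (\<rho> (f x)) = f x\<close>. Injectivity of \<open>f\<close>
    then cancels the outer \<open>f\<close>.\<close>
  have \<rho>f: "\<rho> n (f n x) = x" if x: "x \<in> carrier (cmod P n)" for n x
  proof -
    interpret Qn: module R "cmod Q n" by (rule mQ)
    have fx: "f n x \<in> carrier (cmod Q n)" by (rule mod_hom_closed[OF f x])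
    have "g n (f n x) = \<zero>\<^bsub>cmod Q' n\<^esub>" using ker[of n] x by blast
    then have "f n (\<rho> n (f n x)) = f n x"
      using fx by (simp add: f\<rho> mod_hom_zero[OF mQ' mQ s])
    then show ?thesis
      using inj_onD[OF inj _ mod_hom_closed[OF \<rho> fx] x] by simp
  qed
  have "split_extension R P Q Q' f g s \<tau> \<rho>"
    unfolding split_extension_def
  proof (intro allI conjI ballI)
    fix n z assume z: "z \<in> carrier (cmod Q' n)"
    interpret Qn: module R "cmod Q (n - 1)" by (rule mQ)
    have "cdiff Q n (s n z) \<in> carrier (cmod Q (n - 1))" "s (n - 1) (cdiff Q' n z) \<in> carrier (cmod Q (n - 1))"
      using z by (simp_all add: mod_hom_closed[OF s] mod_hom_closed[OF dQ] mod_hom_closed[OF dQ'])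
    then show "cdiff Q n (s n z) = f (n - 1) (\<tau> n z) \<oplus>\<^bsub>cmod Q (n - 1)\<^esub> s (n - 1) (cdiff Q' n z)"
      using z by (simp add: f\<tau> Qn.a_assoc Qn.l_neg)
  next
    fix n y assume y: "y \<in> carrier (cmod Q n)"
    interpret Qn: module R "cmod Q n" by (rule mQ)
    have "s n (g n y) \<in> carrier (cmod Q n)" using y by (simp add: mod_hom_closed[OF s] mod_hom_closed[OF g])
    then show "y = s n (g n y) \<oplus>\<^bsub>cmod Q n\<^esub> f n (\<rho> n y)"
      using y by (simp add: f\<rho> Qn.a_comm[of y] Qn.r_neg2)
  qed (simp_all add: f g s \<tau> \<rho> fd \<rho>f gs)
  then show ?thesis using that by blast
qed

text \<open>Expanding \<open>d d s z = 0\<close> by means of \<open>d s = f \<tau> + s d\<close>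
  leaves \<open>f (d \<tau> z + \<tau> d z) = 0\<close>, and \<open>\<rho>\<close> removes
  \<open>f\<close>. Arguing with \<open>\<rho>\<close> makes the lemma available after base
  change.\<close>

lemma split_extension_anticommute:
  assumes P: "is_complex R P" and Q: "is_complex R Q" and Q': "is_complex R Q'"
    and split: "split_extension R P Q Q' f g s \<tau> \<rho>" and z: "z \<in> carrier (cmod Q' n)"
  shows "cdiff P (n - 1) (\<tau> n z) = \<ominus>\<^bsub>cmod P (n - 2)\<^esub> \<tau> (n - 1) (cdiff Q' n z)"
proof -
  note D = split_extensionD[OF split]
  have e: "n - 1 - 1 = n - 2" by simp
  interpret P2: module R "cmod P (n - 2)" by (rule complex_module[OF P])
  interpret Q2: module R "cmod Q (n - 2)" by (rule complex_module[OF Q])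
  note mQ = complex_module[OF Q]
  note dP = complex_diff[OF P, of "n - 2" "n - 1"] and dQ = complex_diff[OF Q, of "n - 2" "n - 1"]
  have dz: "cdiff Q' n z \<in> carrier (cmod Q' (n - 1))" by (rule mod_hom_closed[OF complex_diff[OF Q' refl] z])
  have \<tau>z: "\<tau> n z \<in> carrier (cmod P (n - 1))" by (rule mod_hom_closed[OF D(4) z])
  have sz: "s n z \<in> carrier (cmod Q n)" by (rule mod_hom_closed[OF D(3) z])
  have a: "cdiff P (n - 1) (\<tau> n z) \<in> carrier (cmod P (n - 2))" by (rule mod_hom_closed[OF dP \<tau>z]) simp
  have b: "\<tau> (n - 1) (cdiff Q' n z) \<in> carrier (cmod P (n - 2))"
    using mod_hom_closed[OF D(4) dz] by (simp only: e)
  have "cdiff Q (n - 1) (s (n - 1) (cdiff Q' n z)) = f (n - 2) (\<tau> (n - 1) (cdiff Q' n z))"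
    using D(9)[OF dz] b mod_hom_closed[OF D(1) b]
    by (simp add: complex_diff_diff[OF Q' z refl refl] mod_hom_zero[OF complex_module[OF Q'] mQ D(3)])
  moreover have "cdiff Q (n - 1) (cdiff Q n (s n z)) =
      cdiff Q (n - 1) (f (n - 1) (\<tau> n z)) \<oplus>\<^bsub>cmod Q (n - 2)\<^esub> cdiff Q (n - 1) (s (n - 1) (cdiff Q' n z))"
    unfolding D(9)[OF z]
    by (rule mod_hom_add[OF dQ mod_hom_closed[OF D(1) \<tau>z] mod_hom_closed[OF D(3) dz]]) simp
  moreover have "cdiff Q (n - 1) (f (n - 1) (\<tau> n z)) = f (n - 2) (cdiff P (n - 1) (\<tau> n z))"
    using D(6)[OF \<tau>z] by simp
  ultimately have "f (n - 2) (cdiff P (n - 1) (\<tau> n z)) \<oplus>\<^bsub>cmod Q (n - 2)\<^esub> f (n - 2) (\<tau> (n - 1) (cdiff Q' n z))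
      = \<zero>\<^bsub>cmod Q (n - 2)\<^esub>"
    using complex_diff_diff[OF Q sz refl refl] by simp
  then have "f (n - 2) (cdiff P (n - 1) (\<tau> n z) \<oplus>\<^bsub>cmod P (n - 2)\<^esub> \<tau> (n - 1) (cdiff Q' n z)) = \<zero>\<^bsub>cmod Q (n - 2)\<^esub>"
    using mod_hom_add[OF D(1) a b] by simp
  then have "\<rho> (n - 2) (f (n - 2) (cdiff P (n - 1) (\<tau> n z) \<oplus>\<^bsub>cmod P (n - 2)\<^esub> \<tau> (n - 1) (cdiff Q' n z))) =
      \<zero>\<^bsub>cmod P (n - 2)\<^esub>"
    by (simp add: mod_hom_zero[OF mQ complex_module[OF P] D(5)])
  then have "cdiff P (n - 1) (\<tau> n z) \<oplus>\<^bsub>cmod P (n - 2)\<^esub> \<tau> (n - 1) (cdiff Q' n z) = \<zero>\<^bsub>cmod P (n - 2)\<^esub>"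
    using D(7)[of "cdiff P (n - 1) (\<tau> n z) \<oplus>\<^bsub>cmod P (n - 2)\<^esub> \<tau> (n - 1) (cdiff Q' n z)" "n - 2"] a b by simp
  then show ?thesis using P2.minus_equality[OF _ b a] by simp
qed

text \<open>All clauses are equations between composites of linear maps, so it suffices to check
  them on pure tensors. The equation \<open>\<rho> f = 1\<close> is what keeps \<open>f\<close>
  injective.\<close>

lemma split_extension_base_change:
  assumes T: "module R T" and P: "is_complex R P" and Q: "is_complex R Q" and Q': "is_complex R Q'"
    and split: "split_extension R P Q Q' f g s \<tau> \<rho>"
  shows "split_extension R (base_change R T P) (base_change R T Q) (base_change R T Q')
    (\<lambda>n. tensor_map R T (cmod Q n) id (f n)) (\<lambda>n. tensor_map R T (cmod Q' n) id (g n))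
    (\<lambda>n. tensor_map R T (cmod Q n) id (s n)) (\<lambda>n. tensor_map R T (cmod P (n - 1)) id (\<tau> n))
    (\<lambda>n. tensor_map R T (cmod P n) id (\<rho> n))"
proof -
  note D = split_extensionD[OF split]
  note mP = complex_module[OF P] and mQ = complex_module[OF Q] and mQ' = complex_module[OF Q']
  note dP = complex_diff[OF P refl] and dQ = complex_diff[OF Q refl] and dQ' = complex_diff[OF Q' refl]
  note mTP = module_tensor[OF T mP] and mTQ = module_tensor[OF T mQ] and mTQ' = module_tensor[OF T mQ']
  note hf = base_map_hom[OF T mP mQ D(1)] and hg = base_map_hom[OF T mQ mQ' D(2)]
    and hs = base_map_hom[OF T mQ' mQ D(3)] and h\<tau> = base_map_hom[OF T mQ' mP D(4)]
    and h\<rho> = base_map_hom[OF T mQ mP D(5)]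
    and hdP = base_map_hom[OF T mP mP dP] and hdQ = base_map_hom[OF T mQ mQ dQ] and hdQ' = base_map_hom[OF T mQ' mQ' dQ']
  note pure = base_map_pure[OF T mP mQ D(1)] base_map_pure[OF T mQ mQ' D(2)] base_map_pure[OF T mQ' mQ D(3)]
    base_map_pure[OF T mQ' mP D(4)] base_map_pure[OF T mQ mP D(5)]
    base_map_pure[OF T mP mP dP] base_map_pure[OF T mQ mQ dQ] base_map_pure[OF T mQ' mQ' dQ']
  note cl = mod_hom_closed[OF D(1)] mod_hom_closed[OF D(2)] mod_hom_closed[OF D(3)] mod_hom_closed[OF D(4)]
    mod_hom_closed[OF D(5)] mod_hom_closed[OF dP] mod_hom_closed[OF dQ] mod_hom_closed[OF dQ']
  note add = mod_hom_add[OF bilin_right[OF pure_tensor_bilin[OF T mQ]]]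
  show ?thesis
    unfolding split_extension_def base_change_simps
  proof (intro allI conjI ballI)
    fix n u assume u: "u \<in> carrier (tensor R T (cmod P n))"
    show "tensor_map R T (cmod Q (n - 1)) id (f (n - 1)) (tensor_map R T (cmod P (n - 1)) id (cdiff P n) u) =
        tensor_map R T (cmod Q (n - 1)) id (cdiff Q n) (tensor_map R T (cmod Q n) id (f n) u)"
      by (rule tensor_hom_eqI[OF T mP mTQ mod_hom_comp[OF hdP hf] mod_hom_comp[OF hf hdQ] _ u])
        (simp add: pure cl D(6))
    show "tensor_map R T (cmod P n) id (\<rho> n) (tensor_map R T (cmod Q n) id (f n) u) = u"
      by (rule tensor_hom_eqI[OF T mP mTP mod_hom_comp[OF hf h\<rho>] mod_hom_id _ u]) (simp add: pure cl D(7))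
  next
    fix n u assume u: "u \<in> carrier (tensor R T (cmod Q' n))"
    show "tensor_map R T (cmod Q' n) id (g n) (tensor_map R T (cmod Q n) id (s n) u) = u"
      by (rule tensor_hom_eqI[OF T mQ' mTQ' mod_hom_comp[OF hs hg] mod_hom_id _ u]) (simp add: pure cl D(8))
    show "tensor_map R T (cmod Q (n - 1)) id (cdiff Q n) (tensor_map R T (cmod Q n) id (s n) u) =
        tensor_map R T (cmod Q (n - 1)) id (f (n - 1)) (tensor_map R T (cmod P (n - 1)) id (\<tau> n) u)
        \<oplus>\<^bsub>tensor R T (cmod Q (n - 1))\<^esub>
        tensor_map R T (cmod Q (n - 1)) id (s (n - 1)) (tensor_map R T (cmod Q' (n - 1)) id (cdiff Q' n) u)"
      by (rule tensor_hom_eqI[OF T mQ' mTQ mod_hom_comp[OF hs hdQ]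
            mod_hom_plus[OF mTQ mod_hom_comp[OF h\<tau> hf] mod_hom_comp[OF hdQ' hs]] _ u])
        (simp add: pure cl D(9) add)
  next
    fix n u assume u: "u \<in> carrier (tensor R T (cmod Q n))"
    show "u = tensor_map R T (cmod Q n) id (s n) (tensor_map R T (cmod Q' n) id (g n) u) \<oplus>\<^bsub>tensor R T (cmod Q n)\<^esub>
        tensor_map R T (cmod Q n) id (f n) (tensor_map R T (cmod P n) id (\<rho> n) u)"
      by (rule tensor_hom_eqI[OF T mQ mTQ mod_hom_id
            mod_hom_plus[OF mTQ mod_hom_comp[OF hg hs] mod_hom_comp[OF h\<rho> hf]] _ u])
        (simp add: pure cl D(10)[symmetric] add[symmetric])
  qed (rule hf hg hs h\<tau> h\<rho>)+
qed

lemma split_extension_cycle: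
  assumes P: "is_complex R P" and Q: "is_complex R Q" and Q': "is_complex R Q'"
    and split: "split_extension R P Q Q' f g s \<tau> \<rho>" and z: "z \<in> cycles Q' n"
  shows "\<tau> n z \<in> cycles P (n - 1)"
proof -
  note D = split_extensionD[OF split]
  interpret P2: module R "cmod P (n - 2)" by (rule complex_module[OF P])
  have "\<tau> (n - 1) \<zero>\<^bsub>cmod Q' (n - 1)\<^esub> = \<zero>\<^bsub>cmod P (n - 2)\<^esub>"
    using mod_hom_zero[OF complex_module[OF Q'] complex_module[OF P] D(4), of "n - 1"] by simp
  then show ?thesis
    using split_extension_anticommute[OF P Q Q' split cyclesD(1)[OF z]] cyclesD[OF z] mod_hom_closed[OF D(4)]
    by (simp add: cycles_def)
qed

text \<open>By anticommutation, \<open>\<tau> (d w)\<close> is the boundary of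
  \<open>- \<tau> w\<close>, so changing a cycle by a boundary changes its image by a
  boundary.\<close>

lemma split_extension_class:
  assumes P: "is_complex R P" and Q: "is_complex R Q" and Q': "is_complex R Q'"
    and split: "split_extension R P Q Q' f g s \<tau> \<rho>"
    and \<alpha>: "\<alpha> \<in> carrier (homology Q' n)" and z: "z \<in> \<alpha>" "z' \<in> \<alpha>"
  shows "homology_class P (n - 1) (\<tau> n z) = homology_class P (n - 1) (\<tau> n z')"
proof -
  note D = split_extensionD[OF split]
  obtain w where zc: "z \<in> cycles Q' n" "z' \<in> cycles Q' n" and w: "w \<in> carrier (cmod Q' (n + 1))"
    and zw: "z = z' \<oplus>\<^bsub>cmod Q' n\<^esub> cdiff Q' (n + 1) w"
    using homology_memE[OF Q' \<alpha> z] by metis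
  interpret P0: module R "cmod P n" by (rule complex_module[OF P])
  interpret P1: module R "cmod P (n - 1)" by (rule complex_module[OF P])
  have dw: "cdiff Q' (n + 1) w \<in> carrier (cmod Q' n)" by (rule mod_hom_closed[OF complex_diff[OF Q'] w]) simp
  have \<tau>w: "\<tau> (n + 1) w \<in> carrier (cmod P n)" using mod_hom_closed[OF D(4) w] by simp
  have "cdiff P n (\<tau> (n + 1) w) = \<ominus>\<^bsub>cmod P (n - 1)\<^esub> \<tau> n (cdiff Q' (n + 1) w)"
    using split_extension_anticommute[OF P Q Q' split w] by simp
  then have "cdiff P n (\<ominus>\<^bsub>cmod P n\<^esub> \<tau> (n + 1) w) = \<tau> n (cdiff Q' (n + 1) w)"
    using mod_hom_minus[OF P0.module_axioms P1.module_axioms complex_diff[OF P refl] \<tau>w]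
      mod_hom_closed[OF D(4) dw] by simp
  then show ?thesis
    using mod_hom_add[OF D(4) cyclesD(1)[OF zc(2)] dw] \<tau>w zw
    by (intro homology_class_eqI[OF P mod_hom_closed[OF D(4) cyclesD(1)[OF zc(2)]], of "\<ominus>\<^bsub>cmod P n\<^esub> \<tau> (n + 1) w"]) simp_all
qed

text \<open>The lift \<open>y = s z\<close> with \<open>x = \<tau> z\<close> is one admissible
  choice. Any other lift of a representative \<open>z'\<close> has the form
  \<open>y = s z' + f (\<rho> y)\<close>, which forces \<open>x = \<tau> z' + d (\<rho> y)\<close>;
  this has the class of \<open>\<tau> z'\<close>.\<close>

lemma connecting_eq:
  assumes T: "module R T" and P: "is_complex R P" and Q: "is_complex R Q" and Q': "is_complex R Q'"
    and split: "split_extension R P Q Q' f g s \<tau> \<rho>"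
    and \<alpha>: "\<alpha> \<in> carrier (Tor R T Q' n)" "z \<in> \<alpha>"
  shows "connecting R T P Q Q' f g n \<alpha> =
    homology_class (base_change R T P) (n - 1) (tensor_map R T (cmod P (n - 1)) id (\<tau> n) z)"
proof -
  let ?P = "base_change R T P" and ?Q = "base_change R T Q" and ?Q' = "base_change R T Q'"
  let ?f = "\<lambda>n. tensor_map R T (cmod Q n) id (f n)" and ?s = "\<lambda>n. tensor_map R T (cmod Q n) id (s n)"
  let ?\<tau> = "\<lambda>n. tensor_map R T (cmod P (n - 1)) id (\<tau> n)" and ?\<rho> = "\<lambda>n. tensor_map R T (cmod P n) id (\<rho> n)"
  let ?g = "\<lambda>n. tensor_map R T (cmod Q' n) id (g n)"
  note bP = is_complex_base_change[OF T P] and bQ = is_complex_base_change[OF T Q] and bQ' = is_complex_base_change[OF T Q']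
  note split' = split_extension_base_change[OF T P Q Q' split]
  note D = split_extensionD[OF split']
  note mem = homology_class_mem[OF bQ' \<alpha>(1)[unfolded Tor_def]]
  interpret Q1: module R "cmod ?Q (n - 1)" by (rule complex_module[OF bQ])
  \<comment> \<open>On cycles the summand \<open>s (d z')\<close> of \<open>d (s z')\<close>
    disappears.\<close>
  have ds: "cdiff ?Q n (?s n z') = ?f (n - 1) (?\<tau> n z')" if "z' \<in> \<alpha>" for z'
  proof -
    note c = cyclesD[OF mem(1)[OF that]]
    show ?thesis
      using D(9)[OF c(1)] c(2) mod_hom_zero[OF complex_module[OF bQ'] complex_module[OF bQ] D(3)]
        mod_hom_closed[OF D(1) mod_hom_closed[OF D(4) c(1)]] by simp
  qed
  have indep: "homology_class ?P (n - 1) x = homology_class ?P (n - 1) (?\<tau> n z)"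
    if z': "z' \<in> \<alpha>" and y: "y \<in> carrier (cmod ?Q n)" and x: "x \<in> carrier (cmod ?P (n - 1))"
      and gy: "?g n y = z'" and fx: "?f (n - 1) x = cdiff ?Q n y" for z' y x
  proof -
    have \<tau>z': "?\<tau> n z' \<in> carrier (cmod ?P (n - 1))"
      by (rule mod_hom_closed[OF D(4) cyclesD(1)[OF mem(1)[OF z']]])
    have \<rho>y: "?\<rho> n y \<in> carrier (cmod ?P n)" by (rule mod_hom_closed[OF D(5) y])
    have d\<rho>y: "cdiff ?P n (?\<rho> n y) \<in> carrier (cmod ?P (n - 1))"
      by (rule mod_hom_closed[OF complex_diff[OF bP refl] \<rho>y])
    interpret P1: module R "cmod ?P (n - 1)" by (rule complex_module[OF bP])
    have "cdiff ?Q n y = cdiff ?Q n (?s n z' \<oplus>\<^bsub>cmod ?Q n\<^esub> ?f n (?\<rho> n y))"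
      using D(10)[OF y] gy by simp
    also have "\<dots> = cdiff ?Q n (?s n z') \<oplus>\<^bsub>cmod ?Q (n - 1)\<^esub> cdiff ?Q n (?f n (?\<rho> n y))"
      by (rule mod_hom_add[OF complex_diff[OF bQ refl] mod_hom_closed[OF D(3) cyclesD(1)[OF mem(1)[OF z']]]
            mod_hom_closed[OF D(1) \<rho>y]])
    also have "\<dots> = ?f (n - 1) (?\<tau> n z' \<oplus>\<^bsub>cmod ?P (n - 1)\<^esub> cdiff ?P n (?\<rho> n y))"
      unfolding ds[OF z'] D(6)[OF \<rho>y, symmetric] by (rule mod_hom_add[OF D(1) \<tau>z' d\<rho>y, symmetric])
    \<comment> \<open>The retraction is applied to both sides in order to cancel the base-changed
      \<open>f\<close>.\<close>
    finally have "?\<rho> (n - 1) (?f (n - 1) x) =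
        ?\<rho> (n - 1) (?f (n - 1) (?\<tau> n z' \<oplus>\<^bsub>cmod ?P (n - 1)\<^esub> cdiff ?P n (?\<rho> n y)))"
      using fx by simp
    then have "x = ?\<tau> n z' \<oplus>\<^bsub>cmod ?P (n - 1)\<^esub> cdiff ?P n (?\<rho> n y)"
      using D(7)[OF x] D(7)[OF P1.a_closed[OF \<tau>z' d\<rho>y]] by simp
    then have "homology_class ?P (n - 1) x = homology_class ?P (n - 1) (?\<tau> n z')"
      using \<rho>y by (intro homology_class_eqI[OF bP \<tau>z', of "?\<rho> n y"]) simp_all
    also have "\<dots> = homology_class ?P (n - 1) (?\<tau> n z)"
      by (rule split_extension_class[OF bP bQ bQ' split' \<alpha>(1)[unfolded Tor_def] z' \<alpha>(2)])
    finally show ?thesis .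
  qed
  show ?thesis
    unfolding connecting_def
  proof (rule the_equality)
    have zc: "z \<in> carrier (cmod ?Q' n)" by (rule cyclesD(1)[OF mem(1)[OF \<alpha>(2)]])
    show "\<exists>z'\<in>\<alpha>. \<exists>y\<in>carrier (cmod ?Q n). \<exists>x\<in>carrier (cmod ?P (n - 1)).
        ?g n y = z' \<and> ?f (n - 1) x = cdiff ?Q n y \<and>
        homology_class ?P (n - 1) (?\<tau> n z) = homology_class ?P (n - 1) x"
      using ds[OF \<alpha>(2)] D(8)[OF zc]
      by (intro bexI[of _ z] bexI[of _ "?s n z"] bexI[of _ "?\<tau> n z"] conjI)
        (simp_all add: \<alpha>(2) mod_hom_closed[OF D(3) zc] mod_hom_closed[OF D(4) zc])
  qed (use indep in blast)
qed

section \<open>Pairings of degree -1\<close>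

text \<open>A family of total degree -1 that is a cycle of the Hom complex, that is, it anticommutes
  with the differentials of source and target. Written as a sum equal to zero, the condition is
  visibly preserved by sums and negatives.\<close>

definition anti_Leibniz ::
  "('r, 'x) ring_scheme \<Rightarrow> ('r, 'l, 'u) chain_complex_scheme \<Rightarrow> ('r, 'm, 'v) chain_complex_scheme \<Rightarrow>
   ('r, 'n, 'w) chain_complex_scheme \<Rightarrow> (int \<Rightarrow> int \<Rightarrow> 'l \<Rightarrow> 'm \<Rightarrow> 'n) \<Rightarrow> bool" where
  "anti_Leibniz R X Y Z D \<longleftrightarrow>
     (\<forall>p q. D p q \<in> bilin R (cmod X p) (cmod Y q) (cmod Z (p + q - 1))) \<and>
     (\<forall>p q. \<forall>x\<in>carrier (cmod X p). \<forall>y\<in>carrier (cmod Y q).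
        cdiff Z (p + q - 1) (D p q x y) \<oplus>\<^bsub>cmod Z (p + q - 2)\<^esub>
        (D (p - 1) q (cdiff X p x) y \<oplus>\<^bsub>cmod Z (p + q - 2)\<^esub>
         sign_act (cmod Z (p + q - 2)) p (D p (q - 1) x (cdiff Y q y))) = \<zero>\<^bsub>cmod Z (p + q - 2)\<^esub>)"

lemma anti_Leibniz_bilin:
  "\<lbrakk>anti_Leibniz R X Y Z D; n = p + q - 1\<rbrakk> \<Longrightarrow> D p q \<in> bilin R (cmod X p) (cmod Y q) (cmod Z n)"
  by (simp add: anti_Leibniz_def)

lemma anti_Leibniz_diff:
  assumes Z: "is_complex R Z" and X: "is_complex R X" and Y: "is_complex R Y" and D: "anti_Leibniz R X Y Z D"
    and x: "x \<in> carrier (cmod X p)" and y: "y \<in> carrier (cmod Y q)" and n: "n = p + q - 1" and k: "k = p + q - 2"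
  shows "cdiff Z n (D p q x y) \<oplus>\<^bsub>cmod Z k\<^esub>
        (D (p - 1) q (cdiff X p x) y \<oplus>\<^bsub>cmod Z k\<^esub> sign_act (cmod Z k) p (D p (q - 1) x (cdiff Y q y))) = \<zero>\<^bsub>cmod Z k\<^esub>"
    "D (p - 1) q (cdiff X p x) y \<in> carrier (cmod Z k)"
    "sign_act (cmod Z k) p (D p (q - 1) x (cdiff Y q y)) \<in> carrier (cmod Z k)"
    "cdiff Z n (D p q x y) \<in> carrier (cmod Z k)"
proof -
  show "cdiff Z n (D p q x y) \<oplus>\<^bsub>cmod Z k\<^esub>
        (D (p - 1) q (cdiff X p x) y \<oplus>\<^bsub>cmod Z k\<^esub> sign_act (cmod Z k) p (D p (q - 1) x (cdiff Y q y))) = \<zero>\<^bsub>cmod Z k\<^esub>"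
    using D x y n k by (simp add: anti_Leibniz_def)
  show "D (p - 1) q (cdiff X p x) y \<in> carrier (cmod Z k)"
    by (rule bilin_closed[OF anti_Leibniz_bilin[OF D] mod_hom_closed[OF complex_diff[OF X refl] x] y]) (simp add: k)
  show "sign_act (cmod Z k) p (D p (q - 1) x (cdiff Y q y)) \<in> carrier (cmod Z k)"
    by (rule sign_act_closed[OF complex_module[OF Z]
          bilin_closed[OF anti_Leibniz_bilin[OF D] x mod_hom_closed[OF complex_diff[OF Y refl] y]]]) (simp add: k)
  show "cdiff Z n (D p q x y) \<in> carrier (cmod Z k)"
    by (rule mod_hom_closed[OF complex_diff[OF Z] bilin_closed[OF anti_Leibniz_bilin[OF D n] x y]]) (simp add: n k)
qed

lemma anti_Leibniz_plus:
  assumes X: "is_complex R X" and Y: "is_complex R Y" and Z: "is_complex R Z"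
    and D: "anti_Leibniz R X Y Z D" and E: "anti_Leibniz R X Y Z E"
  shows "anti_Leibniz R X Y Z (\<lambda>p q x y. D p q x y \<oplus>\<^bsub>cmod Z (p + q - 1)\<^esub> E p q x y)"
  unfolding anti_Leibniz_def
proof (intro allI conjI ballI)
  fix p q
  show "(\<lambda>x y. D p q x y \<oplus>\<^bsub>cmod Z (p + q - 1)\<^esub> E p q x y) \<in> bilin R (cmod X p) (cmod Y q) (cmod Z (p + q - 1))"
    by (rule bilin_plus[OF complex_module[OF Z] anti_Leibniz_bilin[OF D refl] anti_Leibniz_bilin[OF E refl]])
  fix x y assume x: "x \<in> carrier (cmod X p)" and y: "y \<in> carrier (cmod Y q)"
  have e: "p - 1 + q - 1 = p + q - 2" "p + (q - 1) - 1 = p + q - 2" by simp_all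
  let ?Z = "cmod Z (p + q - 2)"
  interpret Z2: module R ?Z by (rule complex_module[OF Z])
  note d = anti_Leibniz_diff[OF Z X Y D x y refl refl] and d' = anti_Leibniz_diff[OF Z X Y E x y refl refl]
  have c: "D p (q - 1) x (cdiff Y q y) \<in> carrier ?Z" "E p (q - 1) x (cdiff Y q y) \<in> carrier ?Z"
    by (rule bilin_closed[OF anti_Leibniz_bilin[OF D] x mod_hom_closed[OF complex_diff[OF Y refl] y]], simp)
      (rule bilin_closed[OF anti_Leibniz_bilin[OF E] x mod_hom_closed[OF complex_diff[OF Y refl] y]], simp)
  have "cdiff Z (p + q - 1) (D p q x y \<oplus>\<^bsub>cmod Z (p + q - 1)\<^esub> E p q x y) =
      cdiff Z (p + q - 1) (D p q x y) \<oplus>\<^bsub>?Z\<^esub> cdiff Z (p + q - 1) (E p q x y)"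
    by (rule mod_hom_add[OF complex_diff[OF Z] bilin_closed[OF anti_Leibniz_bilin[OF D refl] x y]
          bilin_closed[OF anti_Leibniz_bilin[OF E refl] x y]]) simp
  then have "cdiff Z (p + q - 1) (D p q x y \<oplus>\<^bsub>cmod Z (p + q - 1)\<^esub> E p q x y) \<oplus>\<^bsub>?Z\<^esub>
        (D (p - 1) q (cdiff X p x) y \<oplus>\<^bsub>?Z\<^esub> E (p - 1) q (cdiff X p x) y \<oplus>\<^bsub>?Z\<^esub>
         sign_act ?Z p (D p (q - 1) x (cdiff Y q y) \<oplus>\<^bsub>?Z\<^esub> E p (q - 1) x (cdiff Y q y))) =
      (cdiff Z (p + q - 1) (D p q x y) \<oplus>\<^bsub>?Z\<^esub>
        (D (p - 1) q (cdiff X p x) y \<oplus>\<^bsub>?Z\<^esub> sign_act ?Z p (D p (q - 1) x (cdiff Y q y)))) \<oplus>\<^bsub>?Z\<^esub>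
      (cdiff Z (p + q - 1) (E p q x y) \<oplus>\<^bsub>?Z\<^esub>
        (E (p - 1) q (cdiff X p x) y \<oplus>\<^bsub>?Z\<^esub> sign_act ?Z p (E p (q - 1) x (cdiff Y q y))))"
    using d(2-4) d'(2-4) by (simp add: sign_act_add[OF Z2.module_axioms c] Z2.a_ac)
  then show "cdiff Z (p + q - 1) (D p q x y \<oplus>\<^bsub>cmod Z (p + q - 1)\<^esub> E p q x y) \<oplus>\<^bsub>?Z\<^esub>
        (D (p - 1) q (cdiff X p x) y \<oplus>\<^bsub>cmod Z (p - 1 + q - 1)\<^esub> E (p - 1) q (cdiff X p x) y \<oplus>\<^bsub>?Z\<^esub>
         sign_act ?Z p (D p (q - 1) x (cdiff Y q y) \<oplus>\<^bsub>cmod Z (p + (q - 1) - 1)\<^esub> E p (q - 1) x (cdiff Y q y))) =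
      \<zero>\<^bsub>?Z\<^esub>"
    unfolding e d(1) d'(1) by simp
qed

lemma anti_Leibniz_uminus:
  assumes X: "is_complex R X" and Y: "is_complex R Y" and Z: "is_complex R Z" and D: "anti_Leibniz R X Y Z D"
  shows "anti_Leibniz R X Y Z (\<lambda>p q x y. \<ominus>\<^bsub>cmod Z (p + q - 1)\<^esub> D p q x y)"
  unfolding anti_Leibniz_def
proof (intro allI conjI ballI)
  fix p q
  show "(\<lambda>x y. \<ominus>\<^bsub>cmod Z (p + q - 1)\<^esub> D p q x y) \<in> bilin R (cmod X p) (cmod Y q) (cmod Z (p + q - 1))"
    by (rule bilin_uminus[OF complex_module[OF Z] anti_Leibniz_bilin[OF D refl]])
  fix x y assume x: "x \<in> carrier (cmod X p)" and y: "y \<in> carrier (cmod Y q)"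
  have e: "p - 1 + q - 1 = p + q - 2" "p + (q - 1) - 1 = p + q - 2" by simp_all
  let ?Z = "cmod Z (p + q - 2)"
  interpret Z2: module R ?Z by (rule complex_module[OF Z])
  note d = anti_Leibniz_diff[OF Z X Y D x y refl refl]
  have c: "D p (q - 1) x (cdiff Y q y) \<in> carrier ?Z"
    by (rule bilin_closed[OF anti_Leibniz_bilin[OF D] x mod_hom_closed[OF complex_diff[OF Y refl] y]]) simp
  have "cdiff Z (p + q - 1) (\<ominus>\<^bsub>cmod Z (p + q - 1)\<^esub> D p q x y) = \<ominus>\<^bsub>?Z\<^esub> cdiff Z (p + q - 1) (D p q x y)"
    by (rule mod_hom_minus[OF complex_module[OF Z] complex_module[OF Z] complex_diff[OF Z]
          bilin_closed[OF anti_Leibniz_bilin[OF D refl] x y]]) simp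
  then have "cdiff Z (p + q - 1) (\<ominus>\<^bsub>cmod Z (p + q - 1)\<^esub> D p q x y) \<oplus>\<^bsub>?Z\<^esub>
        (\<ominus>\<^bsub>?Z\<^esub> D (p - 1) q (cdiff X p x) y \<oplus>\<^bsub>?Z\<^esub> sign_act ?Z p (\<ominus>\<^bsub>?Z\<^esub> D p (q - 1) x (cdiff Y q y))) =
      \<ominus>\<^bsub>?Z\<^esub> (cdiff Z (p + q - 1) (D p q x y) \<oplus>\<^bsub>?Z\<^esub>
        (D (p - 1) q (cdiff X p x) y \<oplus>\<^bsub>?Z\<^esub> sign_act ?Z p (D p (q - 1) x (cdiff Y q y))))"
    using d(2-4) by (simp add: sign_act_minus[OF Z2.module_axioms c] Z2.minus_add)
  then show "cdiff Z (p + q - 1) (\<ominus>\<^bsub>cmod Z (p + q - 1)\<^esub> D p q x y) \<oplus>\<^bsub>?Z\<^esub>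
        (\<ominus>\<^bsub>cmod Z (p - 1 + q - 1)\<^esub> D (p - 1) q (cdiff X p x) y \<oplus>\<^bsub>?Z\<^esub>
         sign_act ?Z p (\<ominus>\<^bsub>cmod Z (p + (q - 1) - 1)\<^esub> D p (q - 1) x (cdiff Y q y))) = \<zero>\<^bsub>?Z\<^esub>"
    unfolding e d(1) by simp
qed

section \<open>Composites of a pairing with a map of degree -1\<close>

definition anti_chain_map ::
  "('r, 'x) ring_scheme \<Rightarrow> ('r, 'm, 'u) chain_complex_scheme \<Rightarrow> ('r, 'n, 'v) chain_complex_scheme \<Rightarrow>
   (int \<Rightarrow> 'm \<Rightarrow> 'n) \<Rightarrow> bool" where
  "anti_chain_map R X Z \<tau> \<longleftrightarrow> (\<forall>n. \<tau> n \<in> mod_hom R (cmod X n) (cmod Z (n - 1)) \<and>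
     (\<forall>x\<in>carrier (cmod X n). cdiff Z (n - 1) (\<tau> n x) = \<ominus>\<^bsub>cmod Z (n - 2)\<^esub> \<tau> (n - 1) (cdiff X n x)))"

lemma anti_chain_map_hom:
  "\<lbrakk>anti_chain_map R X Z \<tau>; k = n - 1\<rbrakk> \<Longrightarrow> \<tau> n \<in> mod_hom R (cmod X n) (cmod Z k)"
  by (simp add: anti_chain_map_def)

lemma anti_chain_map_diff:
  "\<lbrakk>anti_chain_map R X Z \<tau>; x \<in> carrier (cmod X n); k = n - 1; l = n - 2\<rbrakk> \<Longrightarrow>
     cdiff Z k (\<tau> n x) = \<ominus>\<^bsub>cmod Z l\<^esub> \<tau> k (cdiff X n x)"
  by (simp add: anti_chain_map_def)

lemma anti_Leibniz_post:
  assumes X: "is_complex R X" and Y: "is_complex R Y" and W: "is_complex R W" and Z: "is_complex R Z"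
    and m: "dg_pairing R X Y W m" and \<tau>: "anti_chain_map R W Z \<tau>"
  shows "anti_Leibniz R X Y Z (\<lambda>p q x y. \<tau> (p + q) (m p q x y))"
  unfolding anti_Leibniz_def
proof (intro allI conjI ballI)
  fix p q
  note mb = dg_pairing_bilin[OF m]
  show "(\<lambda>x y. \<tau> (p + q) (m p q x y)) \<in> bilin R (cmod X p) (cmod Y q) (cmod Z (p + q - 1))"
    by (rule bilin_comp_hom[OF mb[OF refl] anti_chain_map_hom[OF \<tau> refl]])
  fix x y assume x: "x \<in> carrier (cmod X p)" and y: "y \<in> carrier (cmod Y q)"
  have e: "p - 1 + q = p + q - 1" "p + (q - 1) = p + q - 1" by simp_all
  let ?W = "cmod W (p + q - 1)" and ?Z = "cmod Z (p + q - 2)" and ?t = "\<tau> (p + q - 1)"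
  interpret Z2: module R ?Z by (rule complex_module[OF Z])
  have mW: "module R ?W" by (rule complex_module[OF W])
  have t: "?t \<in> mod_hom R ?W ?Z" by (rule anti_chain_map_hom[OF \<tau>]) simp
  have a: "m (p - 1) q (cdiff X p x) y \<in> carrier ?W"
    by (rule bilin_closed[OF mb mod_hom_closed[OF complex_diff[OF X refl] x] y]) simp
  have b: "m p (q - 1) x (cdiff Y q y) \<in> carrier ?W"
    by (rule bilin_closed[OF mb x mod_hom_closed[OF complex_diff[OF Y refl] y]]) simp
  have "cdiff Z (p + q - 1) (\<tau> (p + q) (m p q x y)) = \<ominus>\<^bsub>?Z\<^esub> ?t (cdiff W (p + q) (m p q x y))"
    by (rule anti_chain_map_diff[OF \<tau> bilin_closed[OF mb[OF refl] x y] refl refl])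
  also have "\<dots> = \<ominus>\<^bsub>?Z\<^esub> (?t (m (p - 1) q (cdiff X p x) y) \<oplus>\<^bsub>?Z\<^esub> sign_act ?Z p (?t (m p (q - 1) x (cdiff Y q y))))"
    unfolding dg_pairing_Leibniz[OF m x y refl refl] mod_hom_add[OF t a sign_act_closed[OF mW b]]
      mod_hom_sign[OF mW Z2.module_axioms t b] ..
  finally show "cdiff Z (p + q - 1) (\<tau> (p + q) (m p q x y)) \<oplus>\<^bsub>?Z\<^esub>
      (\<tau> (p - 1 + q) (m (p - 1) q (cdiff X p x) y) \<oplus>\<^bsub>?Z\<^esub>
       sign_act ?Z p (\<tau> (p + (q - 1)) (m p (q - 1) x (cdiff Y q y)))) = \<zero>\<^bsub>?Z\<^esub>"
    unfolding e
    by (simp add: Z2.l_neg mod_hom_closed[OF t a] sign_act_closed[OF Z2.module_axioms mod_hom_closed[OF t b]])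
qed

text \<open>The Leibniz rule is applied to \<open>\<tau> x\<close>, whose degree is
  \<open>p - 1\<close>. Its sign is therefore opposite to the one in \<open>anti_Leibniz\<close>,
  and the terms with \<open>d y\<close> cancel.\<close>

lemma anti_Leibniz_pre_left:
  assumes X: "is_complex R X" and Y: "is_complex R Y" and W: "is_complex R W" and Z: "is_complex R Z"
    and m: "dg_pairing R W Y Z m" and \<tau>: "anti_chain_map R X W \<tau>"
  shows "anti_Leibniz R X Y Z (\<lambda>p q x y. m (p - 1) q (\<tau> p x) y)"
  unfolding anti_Leibniz_def
proof (intro allI conjI ballI)
  fix p q
  note mb = dg_pairing_bilin[OF m]
  show "(\<lambda>x y. m (p - 1) q (\<tau> p x) y) \<in> bilin R (cmod X p) (cmod Y q) (cmod Z (p + q - 1))"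
    by (rule bilin_comp_left[OF mb anti_chain_map_hom[OF \<tau> refl]]) simp
  fix x y assume x: "x \<in> carrier (cmod X p)" and y: "y \<in> carrier (cmod Y q)"
  have e: "p - 1 - 1 = p - 2" by simp
  let ?Z = "cmod Z (p + q - 2)" and ?dx = "cdiff X p x" and ?dy = "cdiff Y q y"
  interpret Z2: module R ?Z by (rule complex_module[OF Z])
  have dx: "?dx \<in> carrier (cmod X (p - 1))" by (rule mod_hom_closed[OF complex_diff[OF X refl] x])
  have \<tau>x: "\<tau> p x \<in> carrier (cmod W (p - 1))" by (rule mod_hom_closed[OF anti_chain_map_hom[OF \<tau> refl] x])
  have \<tau>dx: "\<tau> (p - 1) ?dx \<in> carrier (cmod W (p - 2))"
    by (rule mod_hom_closed[OF anti_chain_map_hom[OF \<tau>] dx]) simp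
  have a: "m (p - 2) q (\<tau> (p - 1) ?dx) y \<in> carrier ?Z" by (rule bilin_closed[OF mb \<tau>dx y]) simp
  have b: "m (p - 1) (q - 1) (\<tau> p x) ?dy \<in> carrier ?Z"
    by (rule bilin_closed[OF mb \<tau>x mod_hom_closed[OF complex_diff[OF Y refl] y]]) simp
  have "cdiff Z (p + q - 1) (m (p - 1) q (\<tau> p x) y) =
      m (p - 2) q (cdiff W (p - 1) (\<tau> p x)) y \<oplus>\<^bsub>?Z\<^esub> sign_act ?Z (p - 1) (m (p - 1) (q - 1) (\<tau> p x) ?dy)"
    using dg_pairing_Leibniz[OF m \<tau>x y, of "p + q - 1" "p + q - 2"] by simp
  also have "m (p - 2) q (cdiff W (p - 1) (\<tau> p x)) y = \<ominus>\<^bsub>?Z\<^esub> m (p - 2) q (\<tau> (p - 1) ?dx) y"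
    unfolding anti_chain_map_diff[OF \<tau> x refl refl]
    by (rule mod_hom_minus[OF complex_module[OF W] Z2.module_axioms bilin_left[OF mb y] \<tau>dx]) simp
  finally show "cdiff Z (p + q - 1) (m (p - 1) q (\<tau> p x) y) \<oplus>\<^bsub>?Z\<^esub>
      (m (p - 1 - 1) q (\<tau> (p - 1) ?dx) y \<oplus>\<^bsub>?Z\<^esub> sign_act ?Z p (m (p - 1) (q - 1) (\<tau> p x) ?dy)) = \<zero>\<^bsub>?Z\<^esub>"
    unfolding e sign_act_pred[OF Z2.module_axioms b] using a sign_act_closed[OF Z2.module_axioms b]
    by (simp add: Z2.minus_add[symmetric] Z2.l_neg)
qed

text \<open>The sign \<open>(-1)\<^sup>p\<close> is the Koszul sign for moving \<tau> past
  \<open>x\<close>. Since \<open>d x\<close> has degree \<open>p - 1\<close>, it makes the two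
  occurrences of \<open>m (d x) (\<tau> y)\<close> cancel; without it they would add up.\<close>

lemma anti_Leibniz_pre_right:
  assumes X: "is_complex R X" and Y: "is_complex R Y" and W: "is_complex R W" and Z: "is_complex R Z"
    and m: "dg_pairing R X W Z m" and \<tau>: "anti_chain_map R Y W \<tau>"
  shows "anti_Leibniz R X Y Z (\<lambda>p q x y. sign_act (cmod Z (p + q - 1)) p (m p (q - 1) x (\<tau> q y)))"
  unfolding anti_Leibniz_def
proof (intro allI conjI ballI)
  fix p q
  note mb = dg_pairing_bilin[OF m]
  show "(\<lambda>x y. sign_act (cmod Z (p + q - 1)) p (m p (q - 1) x (\<tau> q y))) \<in> bilin R (cmod X p) (cmod Y q) (cmod Z (p + q - 1))"
    by (rule bilin_sign_act[OF complex_module[OF Z] bilin_comp_right[OF mb anti_chain_map_hom[OF \<tau> refl]]]) simp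
  fix x y assume x: "x \<in> carrier (cmod X p)" and y: "y \<in> carrier (cmod Y q)"
  have e: "p - 1 + q - 1 = p + q - 2" "p + (q - 1) - 1 = p + q - 2" "q - 1 - 1 = q - 2" by simp_all
  let ?Z = "cmod Z (p + q - 2)" and ?dx = "cdiff X p x" and ?dy = "cdiff Y q y"
  interpret Z2: module R ?Z by (rule complex_module[OF Z])
  note sc = sign_act_closed[OF Z2.module_axioms]
  have dx: "?dx \<in> carrier (cmod X (p - 1))" by (rule mod_hom_closed[OF complex_diff[OF X refl] x])
  have dy: "?dy \<in> carrier (cmod Y (q - 1))" by (rule mod_hom_closed[OF complex_diff[OF Y refl] y])
  have \<tau>y: "\<tau> q y \<in> carrier (cmod W (q - 1))" by (rule mod_hom_closed[OF anti_chain_map_hom[OF \<tau> refl] y])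
  have \<tau>dy: "\<tau> (q - 1) ?dy \<in> carrier (cmod W (q - 2))"
    by (rule mod_hom_closed[OF anti_chain_map_hom[OF \<tau>] dy]) simp
  have a: "m (p - 1) (q - 1) ?dx (\<tau> q y) \<in> carrier ?Z" by (rule bilin_closed[OF mb dx \<tau>y]) simp
  have b: "m p (q - 2) x (\<tau> (q - 1) ?dy) \<in> carrier ?Z" by (rule bilin_closed[OF mb x \<tau>dy]) simp
  have xy: "m p (q - 1) x (\<tau> q y) \<in> carrier (cmod Z (p + q - 1))" by (rule bilin_closed[OF mb x \<tau>y]) simp
  have "cdiff Z (p + q - 1) (sign_act (cmod Z (p + q - 1)) p (m p (q - 1) x (\<tau> q y))) =
      sign_act ?Z p (cdiff Z (p + q - 1) (m p (q - 1) x (\<tau> q y)))"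
    by (rule mod_hom_sign[OF complex_module[OF Z] Z2.module_axioms complex_diff[OF Z] xy]) simp
  also have "cdiff Z (p + q - 1) (m p (q - 1) x (\<tau> q y)) =
      m (p - 1) (q - 1) ?dx (\<tau> q y) \<oplus>\<^bsub>?Z\<^esub> sign_act ?Z p (m p (q - 2) x (cdiff W (q - 1) (\<tau> q y)))"
    using dg_pairing_Leibniz[OF m x \<tau>y, of "p + q - 1" "p + q - 2"] by simp
  also have "m p (q - 2) x (cdiff W (q - 1) (\<tau> q y)) = \<ominus>\<^bsub>?Z\<^esub> m p (q - 2) x (\<tau> (q - 1) ?dy)"
    unfolding anti_chain_map_diff[OF \<tau> y refl refl]
    by (rule mod_hom_minus[OF complex_module[OF W] Z2.module_axioms bilin_right[OF mb x] \<tau>dy]) simp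
  also have "sign_act ?Z p (m (p - 1) (q - 1) ?dx (\<tau> q y) \<oplus>\<^bsub>?Z\<^esub> sign_act ?Z p (\<ominus>\<^bsub>?Z\<^esub> m p (q - 2) x (\<tau> (q - 1) ?dy))) =
      sign_act ?Z p (m (p - 1) (q - 1) ?dx (\<tau> q y)) \<oplus>\<^bsub>?Z\<^esub> \<ominus>\<^bsub>?Z\<^esub> m p (q - 2) x (\<tau> (q - 1) ?dy)"
    using a b by (simp add: sign_act_add[OF Z2.module_axioms] sc sign_act_twice[OF Z2.module_axioms])
  finally show "cdiff Z (p + q - 1) (sign_act (cmod Z (p + q - 1)) p (m p (q - 1) x (\<tau> q y))) \<oplus>\<^bsub>?Z\<^esub>
      (sign_act (cmod Z (p - 1 + q - 1)) (p - 1) (m (p - 1) (q - 1) ?dx (\<tau> q y)) \<oplus>\<^bsub>?Z\<^esub>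
       sign_act ?Z p (sign_act (cmod Z (p + (q - 1) - 1)) p (m p (q - 1 - 1) x (\<tau> (q - 1) ?dy)))) = \<zero>\<^bsub>?Z\<^esub>"
    unfolding e sign_act_pred[OF Z2.module_axioms a] sign_act_twice[OF Z2.module_axioms b]
    using sc[OF a] b by (simp add: Z2.a_ac Z2.r_neg2 Z2.r_neg1 Z2.r_neg Z2.l_neg)
qed

text \<open>The value required of \<open>d (h x y)\<close> for \<open>h\<close> to be a contraction
  of \<open>D\<close>. It involves \<open>h\<close> only in total degree \<open>p + q - 1\<close>,
  so the next stage of \<open>h\<close> is obtained by lifting it.\<close>

definition homotopy_rhs ::
  "('r, 'l, 'u) chain_complex_scheme \<Rightarrow> ('r, 'm, 'v) chain_complex_scheme \<Rightarrow> ('r, 'n, 'w) chain_complex_scheme \<Rightarrow>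
   (int \<Rightarrow> int \<Rightarrow> 'l \<Rightarrow> 'm \<Rightarrow> 'n) \<Rightarrow> (int \<Rightarrow> int \<Rightarrow> 'l \<Rightarrow> 'm \<Rightarrow> 'n) \<Rightarrow> int \<Rightarrow> int \<Rightarrow> 'l \<Rightarrow> 'm \<Rightarrow> 'n" where
  "homotopy_rhs X Y Z D h p q x y = D p q x y \<oplus>\<^bsub>cmod Z (p + q - 1)\<^esub>
     (h (p - 1) q (cdiff X p x) y \<oplus>\<^bsub>cmod Z (p + q - 1)\<^esub>
      sign_act (cmod Z (p + q - 1)) p (h p (q - 1) x (cdiff Y q y)))"

lemma homotopy_rhs_bilin:
  assumes X: "is_complex R X" and Y: "is_complex R Y" and Z: "is_complex R Z" and D: "anti_Leibniz R X Y Z D"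
    and h: "\<And>p q. h p q \<in> bilin R (cmod X p) (cmod Y q) (cmod Z (p + q))"
  shows "homotopy_rhs X Y Z D h p q \<in> bilin R (cmod X p) (cmod Y q) (cmod Z (p + q - 1))"
proof -
  have e: "p - 1 + q = p + q - 1" "p + (q - 1) = p + q - 1" by simp_all
  note mZ = complex_module[OF Z]
  have "(\<lambda>x y. homotopy_rhs X Y Z D h p q x y) \<in> bilin R (cmod X p) (cmod Y q) (cmod Z (p + q - 1))"
    unfolding homotopy_rhs_def
    by (rule bilin_plus[OF mZ anti_Leibniz_bilin[OF D refl] bilin_plus[OF mZ
          bilin_comp_left[OF h[of "p - 1" q, unfolded e] complex_diff[OF X refl]]
          bilin_sign_act[OF mZ bilin_comp_right[OF h[of p "q - 1", unfolded e] complex_diff[OF Y refl]]]]])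
  then show ?thesis .
qed

text \<open>Applying \<open>d\<close> and inserting the relation in the two preceding bidegrees
  leaves three groups of terms. Those in \<open>D\<close> cancel by \<open>anti_Leibniz\<close>,
  those with a repeated differential vanish, and the two terms \<open>h (d x) (d y)\<close> have
  opposite signs.\<close>

lemma homotopy_rhs_cycle:
  assumes X: "is_complex R X" and Y: "is_complex R Y" and Z: "is_complex R Z" and D: "anti_Leibniz R X Y Z D"
    and h: "\<And>p q. h p q \<in> bilin R (cmod X p) (cmod Y q) (cmod Z (p + q))"
    and rel: "\<And>x y. \<lbrakk>x \<in> carrier (cmod X (p - 1)); y \<in> carrier (cmod Y q)\<rbrakk> \<Longrightarrow>
        cdiff Z (p - 1 + q) (h (p - 1) q x y) = homotopy_rhs X Y Z D h (p - 1) q x y"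
      "\<And>x y. \<lbrakk>x \<in> carrier (cmod X p); y \<in> carrier (cmod Y (q - 1))\<rbrakk> \<Longrightarrow>
        cdiff Z (p + (q - 1)) (h p (q - 1) x y) = homotopy_rhs X Y Z D h p (q - 1) x y"
    and x: "x \<in> carrier (cmod X p)" and y: "y \<in> carrier (cmod Y q)"
  shows "homotopy_rhs X Y Z D h p q x y \<in> cycles Z (p + q - 1)"
proof -
  have e: "p - 1 + q = p + q - 1" "p + (q - 1) = p + q - 1" "p + q - 1 - 1 = p + q - 2"
    "p - 1 - 1 = p - 2" "q - 1 - 1 = q - 2" by simp_all
  let ?Z1 = "cmod Z (p + q - 1)" and ?Z = "cmod Z (p + q - 2)" and ?dx = "cdiff X p x" and ?dy = "cdiff Y q y"
  note mZ = complex_module[OF Z]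
  interpret Z2: module R ?Z by (rule mZ)
  note sc = sign_act_closed[OF Z2.module_axioms]
  have dx: "?dx \<in> carrier (cmod X (p - 1))" by (rule mod_hom_closed[OF complex_diff[OF X refl] x])
  have dy: "?dy \<in> carrier (cmod Y (q - 1))" by (rule mod_hom_closed[OF complex_diff[OF Y refl] y])
  have dZ: "cdiff Z (p + q - 1) \<in> mod_hom R ?Z1 ?Z" by (rule complex_diff[OF Z]) simp
  have hx: "h (p - 1) q ?dx y \<in> carrier ?Z1" using bilin_closed[OF h dx y] by (simp only: e)
  have hy: "h p (q - 1) x ?dy \<in> carrier ?Z1" using bilin_closed[OF h x dy] by (simp only: e)
  have hxy: "h (p - 1) (q - 1) ?dx ?dy \<in> carrier ?Z" using bilin_closed[OF h dx dy] by simp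
  have Dc: "D p q x y \<in> carrier ?Z1" by (rule bilin_closed[OF anti_Leibniz_bilin[OF D refl] x y])
  have Dy: "D p (q - 1) x ?dy \<in> carrier ?Z" by (rule bilin_closed[OF anti_Leibniz_bilin[OF D] x dy]) simp
  note d = anti_Leibniz_diff[OF Z X Y D x y refl refl]
  have z1: "h (p - 2) q (cdiff X (p - 1) ?dx) y = \<zero>\<^bsub>?Z\<^esub>"
    using bilin_zero_left[OF complex_module[OF X] mZ h y, of "p - 2"] complex_diff_diff[OF X x refl refl]
    by (simp add: algebra_simps)
  have z2: "h p (q - 2) x (cdiff Y (q - 1) ?dy) = \<zero>\<^bsub>?Z\<^esub>"
    using bilin_zero_right[OF complex_module[OF Y] mZ h x, of "q - 2"] complex_diff_diff[OF Y y refl refl]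
    by (simp add: algebra_simps)
  have 1: "cdiff Z (p + q - 1) (h (p - 1) q ?dx y) = D (p - 1) q ?dx y \<oplus>\<^bsub>?Z\<^esub> \<ominus>\<^bsub>?Z\<^esub> sign_act ?Z p (h (p - 1) (q - 1) ?dx ?dy)"
    using rel(1)[OF dx y] hxy sc[OF hxy] unfolding homotopy_rhs_def e
    by (simp add: z1 sign_act_pred[OF Z2.module_axioms])
  have 2: "cdiff Z (p + q - 1) (h p (q - 1) x ?dy) = D p (q - 1) x ?dy \<oplus>\<^bsub>?Z\<^esub> h (p - 1) (q - 1) ?dx ?dy"
    using rel(2)[OF x dy] hxy unfolding homotopy_rhs_def e
    by (simp add: z2 sign_act_zero[OF Z2.module_axioms])
  have "cdiff Z (p + q - 1) (homotopy_rhs X Y Z D h p q x y) =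
      cdiff Z (p + q - 1) (D p q x y) \<oplus>\<^bsub>?Z\<^esub>
      (cdiff Z (p + q - 1) (h (p - 1) q ?dx y) \<oplus>\<^bsub>?Z\<^esub> sign_act ?Z p (cdiff Z (p + q - 1) (h p (q - 1) x ?dy)))"
  proof -
    interpret Z1: module R ?Z1 by (rule mZ)
    note sc1 = sign_act_closed[OF Z1.module_axioms]
    show ?thesis
      unfolding homotopy_rhs_def using Dc hx hy
      by (simp add: mod_hom_add[OF dZ] sc1 mod_hom_sign[OF mZ mZ dZ])
  qed
  also have "\<dots> = (cdiff Z (p + q - 1) (D p q x y) \<oplus>\<^bsub>?Z\<^esub>
        (D (p - 1) q ?dx y \<oplus>\<^bsub>?Z\<^esub> sign_act ?Z p (D p (q - 1) x ?dy))) \<oplus>\<^bsub>?Z\<^esub>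
      (\<ominus>\<^bsub>?Z\<^esub> sign_act ?Z p (h (p - 1) (q - 1) ?dx ?dy) \<oplus>\<^bsub>?Z\<^esub> sign_act ?Z p (h (p - 1) (q - 1) ?dx ?dy))"
    unfolding 1 2 using d(2-4) sc[OF hxy] hxy Dy by (simp add: sign_act_add[OF Z2.module_axioms] Z2.a_ac)
  also have "\<dots> = \<zero>\<^bsub>?Z\<^esub>"
    unfolding d(1) using sc[OF hxy] by (simp add: Z2.l_neg)
  finally show ?thesis
    using bilin_closed[OF homotopy_rhs_bilin[OF X Y Z D h] x y] by (simp add: cycles_def e)
qed

text \<open>The inductive construction of a chain homotopy, by total degree, as in the comparison
  theorem for projective resolutions. Exactness of \<open>Z\<close> takes over from total degree 2
  on; total degree 1 meets the homology of \<open>Z\<close> in degree 0, so there solvability is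
  assumed for the initial \<open>h0\<close>.\<close>

lemma anti_Leibniz_null_homotopic:
  fixes h0 :: "int \<Rightarrow> int \<Rightarrow> 'l \<Rightarrow> 'm \<Rightarrow> 'n"
  assumes X: "is_complex R X" and Y: "is_complex R Y" and Z: "is_complex R Z" and D: "anti_Leibniz R X Y Z D"
    and projX: "\<And>n. projective_module R (cmod X n)" and projY: "\<And>n. projective_module R (cmod Y n)"
    and neg: "\<And>n. n < 0 \<Longrightarrow> carrier (cmod Z n) = {\<zero>\<^bsub>cmod Z n\<^esub>}"
    and exact: "\<And>n. n > 0 \<Longrightarrow> cycles Z n = boundaries Z n"
    and h0: "\<And>p q. h0 p q \<in> bilin R (cmod X p) (cmod Y q) (cmod Z (p + q))"
    and h0_rhs: "\<And>p q x y. \<lbrakk>p + q = 1; x \<in> carrier (cmod X p); y \<in> carrier (cmod Y q)\<rbrakk> \<Longrightarrow>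
      homotopy_rhs X Y Z D h0 p q x y \<in> boundaries Z 0"
  obtains h where "\<And>p q. h p q \<in> bilin R (cmod X p) (cmod Y q) (cmod Z (p + q))"
    "\<And>p q x y. \<lbrakk>x \<in> carrier (cmod X p); y \<in> carrier (cmod Y q)\<rbrakk> \<Longrightarrow>
      cdiff Z (p + q) (h p q x y) = homotopy_rhs X Y Z D h p q x y"
proof -
  define rel where "rel h p q \<longleftrightarrow> (\<forall>x\<in>carrier (cmod X p). \<forall>y\<in>carrier (cmod Y q).
      cdiff Z (p + q) (h p q x y) = homotopy_rhs X Y Z D h p q x y)" for h p q
  \<comment> \<open>The invariant includes solvability of the next degree. For \<open>k = 0\<close>
    it is the hypothesis on \<open>h0\<close>, and later it follows from exactness, so one induction
    step treats both situations.\<close>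
  define S where "S k h \<longleftrightarrow> (\<forall>p q. h p q \<in> bilin R (cmod X p) (cmod Y q) (cmod Z (p + q))) \<and>
      (\<forall>p q. p + q \<le> int k \<longrightarrow> rel h p q) \<and>
      (\<forall>p q. p + q = int k + 1 \<longrightarrow> (\<forall>x\<in>carrier (cmod X p). \<forall>y\<in>carrier (cmod Y q).
        homotopy_rhs X Y Z D h p q x y \<in> boundaries Z (int k)))" for k h
  define step where "step k h h' \<longleftrightarrow> (\<forall>p q. p + q \<le> int k \<longrightarrow> h' p q = h p q)"
    for k and h h' :: "int \<Rightarrow> int \<Rightarrow> 'l \<Rightarrow> 'm \<Rightarrow> 'n"
  have base: "S 0 h0"
  proof -
    \<comment> \<open>Both sides lie in a negative degree of \<open>Z\<close>, which is
      zero.\<close>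
    have "rel h0 p q" if pq: "p + q \<le> 0" for p q
      unfolding rel_def
    proof (intro ballI)
      fix x y assume xy: "x \<in> carrier (cmod X p)" "y \<in> carrier (cmod Y q)"
      have "cdiff Z (p + q) (h0 p q x y) \<in> carrier (cmod Z (p + q - 1))"
        by (rule mod_hom_closed[OF complex_diff[OF Z refl] bilin_closed[OF h0 xy]])
      moreover have "homotopy_rhs X Y Z D h0 p q x y \<in> carrier (cmod Z (p + q - 1))"
        by (rule bilin_closed[OF homotopy_rhs_bilin[OF X Y Z D h0] xy])
      ultimately show "cdiff Z (p + q) (h0 p q x y) = homotopy_rhs X Y Z D h0 p q x y"
        using neg[of "p + q - 1"] pq by simp
    qed
    then show ?thesis unfolding S_def using h0 h0_rhs by simp
  qed
  have next_step: "\<exists>h'. S (Suc k) h' \<and> step k h h'" if "S k h" for k h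
  proof -
    have h: "h p q \<in> bilin R (cmod X p) (cmod Y q) (cmod Z (p + q))" for p q
      using that by (simp add: S_def)
    have rel_h: "rel h p q" if "p + q \<le> int k" for p q
      using \<open>S k h\<close> that by (simp add: S_def)
    have "\<exists>b. b \<in> bilin R (cmod X p) (cmod Y q) (cmod Z (p + q)) \<and>
        (\<forall>x\<in>carrier (cmod X p). \<forall>y\<in>carrier (cmod Y q). cdiff Z (p + q) (b x y) = homotopy_rhs X Y Z D h p q x y)"
      if pq: "p + q = int k + 1" for p q
    proof -
      have "homotopy_rhs X Y Z D h p q x y \<in> cdiff Z (p + q) ` carrier (cmod Z (p + q))"
        if "x \<in> carrier (cmod X p)" "y \<in> carrier (cmod Y q)" for x y
        using \<open>S k h\<close> that pq by (simp add: S_def boundaries_def)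
      from projective_bilin_lift[OF projX projY complex_module[OF Z] complex_module[OF Z] complex_diff[OF Z refl]
          homotopy_rhs_bilin[OF X Y Z D h] this]
      show ?thesis by metis
    qed
    then obtain b where b: "p + q = int k + 1 \<Longrightarrow> b p q \<in> bilin R (cmod X p) (cmod Y q) (cmod Z (p + q)) \<and>
        (\<forall>x\<in>carrier (cmod X p). \<forall>y\<in>carrier (cmod Y q).
          cdiff Z (p + q) (b p q x y) = homotopy_rhs X Y Z D h p q x y)" for p q
      by metis
    define h' where "h' p q = (if p + q = int k + 1 then b p q else h p q)" for p q
    have h': "h' p q \<in> bilin R (cmod X p) (cmod Y q) (cmod Z (p + q))" for p q
      using b h by (simp add: h'_def)
    \<comment> \<open>Up to total degree \<open>k + 1\<close> the right hand side only reads total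
      degrees up to \<open>k\<close>, where \<open>h'\<close> and \<open>h\<close> agree.\<close>
    have rhs: "homotopy_rhs X Y Z D h' p q = homotopy_rhs X Y Z D h p q" if "p + q \<le> int k + 1" for p q
      using that by (intro ext) (simp add: homotopy_rhs_def h'_def)
    have rel_h': "rel h' p q" if pq: "p + q \<le> int (Suc k)" for p q
    proof (cases "p + q = int k + 1")
      case True
      then show ?thesis using b[OF True] rhs[of p q] by (simp add: rel_def h'_def)
    next
      case False
      then show ?thesis using pq rel_h[of p q] rhs[of p q] by (simp add: rel_def h'_def)
    qed
    have "homotopy_rhs X Y Z D h' p q x y \<in> boundaries Z (int (Suc k))"
      if pq: "p + q = int (Suc k) + 1" and xy: "x \<in> carrier (cmod X p)" "y \<in> carrier (cmod Y q)" for p q x y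
    proof -
      have "homotopy_rhs X Y Z D h' p q x y \<in> cycles Z (p + q - 1)"
        by (rule homotopy_rhs_cycle[OF X Y Z D h' _ _ xy])
          (use rel_h'[of "p - 1" q] rel_h'[of p "q - 1"] pq in \<open>simp_all add: rel_def\<close>)
      moreover have "p + q - 1 = int (Suc k)" using pq by simp
      ultimately show ?thesis using exact[of "int (Suc k)"] by simp
    qed
    then have "S (Suc k) h'" unfolding S_def using h' rel_h' by blast
    moreover have "step k h h'" by (simp add: step_def h'_def)
    ultimately show ?thesis by blast
  qed
  \<comment> \<open>Lifts are not unique, so the stages come from dependent choice;
    \<open>step\<close> guarantees that what has been settled stays fixed.\<close>
  obtain F where F: "\<And>k. S k (F k)" and F_step: "\<And>k. step k (F k) (F (Suc k))"
    using dependent_nat_choice[of S step, OF exI[of _ h0]] base next_step by blast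
  have F_stable: "F (k + l) p q = F k p q" if "p + q \<le> int k" for k l p q
  proof (induction l)
    case (Suc l)
    then show ?case using F_step[of "k + l"] that by (simp add: step_def)
  qed simp
  \<comment> \<open>The stagewise constant sequence is read off on the diagonal. In negative total
    degree \<open>nat\<close> gives 0, and stage 0 already satisfies the relation there.\<close>
  define h where "h p q = F (nat (p + q)) p q" for p q
  have h_eq: "h p q = F k p q" if "p + q \<le> int k" for k p q
  proof -
    have "nat (p + q) \<le> k" using that by simp
    then obtain l where "k = nat (p + q) + l" by (rule le_Suc_ex[THEN exE])
    then show ?thesis using F_stable[of p q "nat (p + q)" l] by (simp add: h_def)
  qed
  show ?thesis
  proof (rule that)
    show "h p q \<in> bilin R (cmod X p) (cmod Y q) (cmod Z (p + q))" for p q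
      using F by (simp add: h_def S_def)
    fix p q x y assume xy: "x \<in> carrier (cmod X p)" "y \<in> carrier (cmod Y q)"
    let ?k = "nat (p + q)"
    have "homotopy_rhs X Y Z D h p q = homotopy_rhs X Y Z D (F ?k) p q"
      using h_eq[of "p - 1" q ?k] h_eq[of p "q - 1" ?k] by (intro ext) (simp add: homotopy_rhs_def)
    moreover have "rel (F ?k) p q" using F[of ?k] by (simp add: S_def)
    ultimately show "cdiff Z (p + q) (h p q x y) = homotopy_rhs X Y Z D h p q x y"
      using xy by (simp add: rel_def h_def)
  qed
qed


section \<open>Singular extensions\<close>

lemma assoc_algebra_mult_bilin:
  assumes "assoc_algebra R A" shows "(\<lambda>x y. x \<otimes>\<^bsub>A\<^esub> y) \<in> bilin R A A A"
proof -
  interpret A: assoc_algebra R A by fact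
  show ?thesis
    by (intro bilinI mod_homI)
      (simp_all add: A.r_distr A.l_distr A.smult_mult_left A.smult_mult_right)
qed

section \<open>The actions of \<open>A'\<close> on the kernel of a singular extension\<close>

context
  fixes R :: "('r, 'x) ring_scheme" and J :: "('r, 'j) module" and A :: "('r, 'a) module"
    and A' :: "('r, 'b) module" and i :: "'j \<Rightarrow> 'a" and \<pi> :: "'a \<Rightarrow> 'b"
  assumes ext: "singular_extension R J A A' i \<pi>"
begin

lemma singular_extensionD:
  shows "module R J" "assoc_algebra R A" "assoc_algebra R A'" "module R A" "module R A'"
    "i \<in> mod_hom R J A" "\<pi> \<in> mod_hom R A A'" "inj_on i (carrier J)" "\<pi> ` carrier A = carrier A'"
    "x \<in> carrier J \<Longrightarrow> \<pi> (i x) = \<zero>\<^bsub>A'\<^esub>"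
    "\<lbrakk>a \<in> carrier A; \<pi> a = \<zero>\<^bsub>A'\<^esub>\<rbrakk> \<Longrightarrow> a \<in> i ` carrier J"
    "\<lbrakk>a \<in> carrier A; b \<in> carrier A\<rbrakk> \<Longrightarrow> \<pi> (a \<otimes>\<^bsub>A\<^esub> b) = \<pi> a \<otimes>\<^bsub>A'\<^esub> \<pi> b"
    "\<lbrakk>x \<in> carrier J; y \<in> carrier J\<rbrakk> \<Longrightarrow> i x \<otimes>\<^bsub>A\<^esub> i y = \<zero>\<^bsub>A\<^esub>"
  using ext unfolding singular_extension_def
  by (auto simp: a_kernel_def' assoc_algebra_def ring_hom_def)

text \<open>Two lifts of \<open>\<pi> a\<close> differ by an element of \<open>i J\<close>, whose
  product with \<open>i x\<close> vanishes since the extension is singular. Hence the definite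
  description may be evaluated with any lift.\<close>

lemma left_act_lift:
  assumes a: "a \<in> carrier A" and x: "x \<in> carrier J"
  shows "left_act J A i \<pi> (\<pi> a) x \<in> carrier J" "i (left_act J A i \<pi> (\<pi> a) x) = a \<otimes>\<^bsub>A\<^esub> i x"
proof -
  note D = singular_extensionD
  interpret A: assoc_algebra R A by (rule D(2))
  interpret A': assoc_algebra R A' by (rule D(3))
  have ix: "i x \<in> carrier A" by (rule mod_hom_closed[OF D(6) x])
  have "a \<otimes>\<^bsub>A\<^esub> i x \<in> i ` carrier J"
    by (rule D(11)) (use a ix x mod_hom_closed[OF D(7)] in \<open>simp_all add: D(10,12)\<close>)
  then obtain y where y: "y \<in> carrier J" "i y = a \<otimes>\<^bsub>A\<^esub> i x" by auto
  have indep: "b \<otimes>\<^bsub>A\<^esub> i x = a \<otimes>\<^bsub>A\<^esub> i x" if b: "b \<in> carrier A" "\<pi> b = \<pi> a" for b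
  proof -
    have "b \<ominus>\<^bsub>A\<^esub> a \<in> i ` carrier J"
      by (rule D(11)) (use a b mod_hom_closed[OF D(7)] in \<open>simp_all add: a_minus_def mod_hom_add[OF D(7)]
          mod_hom_minus[OF D(4,5,7)] A'.r_neg\<close>)
    then have "(b \<ominus>\<^bsub>A\<^esub> a) \<otimes>\<^bsub>A\<^esub> i x = \<zero>\<^bsub>A\<^esub>" using D(13) x by auto
    then have "b \<otimes>\<^bsub>A\<^esub> i x \<ominus>\<^bsub>A\<^esub> a \<otimes>\<^bsub>A\<^esub> i x = \<zero>\<^bsub>A\<^esub>"
      using a b ix by (simp add: a_minus_def A.l_distr A.l_minus)
    then show ?thesis using a b ix A.minus_equality by (fastforce simp: a_minus_def)
  qed
  have "left_act J A i \<pi> (\<pi> a) x = y"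
    unfolding left_act_def
  proof (rule the_equality)
    fix y' assume "y' \<in> carrier J \<and> (\<exists>b\<in>carrier A. \<pi> b = \<pi> a \<and> i y' = b \<otimes>\<^bsub>A\<^esub> i x)"
    then show "y' = y" using y indep inj_onD[OF D(8)] by metis
  qed (use y a in blast)
  then show "left_act J A i \<pi> (\<pi> a) x \<in> carrier J" "i (left_act J A i \<pi> (\<pi> a) x) = a \<otimes>\<^bsub>A\<^esub> i x"
    using y by simp_all
qed

lemma right_act_lift:
  assumes a: "a \<in> carrier A" and x: "x \<in> carrier J"
  shows "right_act J A i \<pi> x (\<pi> a) \<in> carrier J" "i (right_act J A i \<pi> x (\<pi> a)) = i x \<otimes>\<^bsub>A\<^esub> a"
proof -
  note D = singular_extensionD
  interpret A: assoc_algebra R A by (rule D(2))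
  interpret A': assoc_algebra R A' by (rule D(3))
  have ix: "i x \<in> carrier A" by (rule mod_hom_closed[OF D(6) x])
  have "i x \<otimes>\<^bsub>A\<^esub> a \<in> i ` carrier J"
    by (rule D(11)) (use a ix x mod_hom_closed[OF D(7)] in \<open>simp_all add: D(10,12)\<close>)
  then obtain y where y: "y \<in> carrier J" "i y = i x \<otimes>\<^bsub>A\<^esub> a" by auto
  have indep: "i x \<otimes>\<^bsub>A\<^esub> b = i x \<otimes>\<^bsub>A\<^esub> a" if b: "b \<in> carrier A" "\<pi> b = \<pi> a" for b
  proof -
    have "b \<ominus>\<^bsub>A\<^esub> a \<in> i ` carrier J"
      by (rule D(11)) (use a b mod_hom_closed[OF D(7)] in \<open>simp_all add: a_minus_def mod_hom_add[OF D(7)]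
          mod_hom_minus[OF D(4,5,7)] A'.r_neg\<close>)
    then have "i x \<otimes>\<^bsub>A\<^esub> (b \<ominus>\<^bsub>A\<^esub> a) = \<zero>\<^bsub>A\<^esub>" using D(13) x by auto
    then have "i x \<otimes>\<^bsub>A\<^esub> b \<ominus>\<^bsub>A\<^esub> i x \<otimes>\<^bsub>A\<^esub> a = \<zero>\<^bsub>A\<^esub>"
      using a b ix by (simp add: a_minus_def A.r_distr A.r_minus)
    then show ?thesis using a b ix A.minus_equality by (fastforce simp: a_minus_def)
  qed
  have "right_act J A i \<pi> x (\<pi> a) = y"
    unfolding right_act_def
  proof (rule the_equality)
    fix y' assume "y' \<in> carrier J \<and> (\<exists>b\<in>carrier A. \<pi> b = \<pi> a \<and> i y' = i x \<otimes>\<^bsub>A\<^esub> b)"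
    then show "y' = y" using y indep inj_onD[OF D(8)] by metis
  qed (use y a in blast)
  then show "right_act J A i \<pi> x (\<pi> a) \<in> carrier J" "i (right_act J A i \<pi> x (\<pi> a)) = i x \<otimes>\<^bsub>A\<^esub> a"
    using y by simp_all
qed

text \<open>As \<open>i\<close> is injective, the identities may be checked in \<open>A\<close>
  after choosing lifts, where they are distributivity and compatibility with scalars.\<close>

lemma left_act_bilin: "left_act J A i \<pi> \<in> bilin R A' J J"
proof -
  note D = singular_extensionD
  interpret A: assoc_algebra R A by (rule D(2))
  interpret J: module R J by (rule D(1))
  note L = left_act_lift and inj = inj_onD[OF D(8)] and ix = mod_hom_closed[OF D(6)]
  note simps = L mod_hom_add[OF D(6)] mod_hom_smult[OF D(6)] ix A.l_distr A.r_distr A.smult_mult_left A.smult_mult_right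
  note lin = mod_hom_add[OF D(7), symmetric] mod_hom_smult[OF D(7), symmetric]
  show ?thesis
  proof (intro bilinI mod_homI)
    fix a' assume "a' \<in> carrier A'"
    then obtain a where a: "a \<in> carrier A" "a' = \<pi> a" using D(9) by blast
    fix x assume x: "x \<in> carrier J"
    show "left_act J A i \<pi> a' x \<in> carrier J" using a x by (simp add: L)
    show "left_act J A i \<pi> a' (x \<oplus>\<^bsub>J\<^esub> y) = left_act J A i \<pi> a' x \<oplus>\<^bsub>J\<^esub> left_act J A i \<pi> a' y" if "y \<in> carrier J" for y
      using a x that by (intro inj) (simp_all add: simps)
    show "left_act J A i \<pi> a' (r \<odot>\<^bsub>J\<^esub> x) = r \<odot>\<^bsub>J\<^esub> left_act J A i \<pi> a' x" if "r \<in> carrier R" for r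
      using a x that by (intro inj) (simp_all add: simps)
  next
    fix x a' assume x: "x \<in> carrier J" and "a' \<in> carrier A'"
    then obtain a where a: "a \<in> carrier A" "a' = \<pi> a" using D(9) by blast
    show "left_act J A i \<pi> a' x \<in> carrier J" using a x by (simp add: L)
    show "left_act J A i \<pi> (a' \<oplus>\<^bsub>A'\<^esub> b') x = left_act J A i \<pi> a' x \<oplus>\<^bsub>J\<^esub> left_act J A i \<pi> b' x"
      if "b' \<in> carrier A'" for b'
    proof -
      from that obtain b where b: "b \<in> carrier A" "b' = \<pi> b" using D(9) by blast
      show ?thesis using a b x by (intro inj) (simp_all add: simps lin)
    qed
    show "left_act J A i \<pi> (r \<odot>\<^bsub>A'\<^esub> a') x = r \<odot>\<^bsub>J\<^esub> left_act J A i \<pi> a' x" if "r \<in> carrier R" for r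
      using a x that by (intro inj) (simp_all add: simps lin)
  qed
qed

lemma right_act_bilin: "right_act J A i \<pi> \<in> bilin R J A' J"
proof -
  note D = singular_extensionD
  interpret A: assoc_algebra R A by (rule D(2))
  interpret J: module R J by (rule D(1))
  note L = right_act_lift and inj = inj_onD[OF D(8)] and ix = mod_hom_closed[OF D(6)]
  note simps = L mod_hom_add[OF D(6)] mod_hom_smult[OF D(6)] ix A.l_distr A.r_distr A.smult_mult_left A.smult_mult_right
  note lin = mod_hom_add[OF D(7), symmetric] mod_hom_smult[OF D(7), symmetric]
  show ?thesis
  proof (intro bilinI mod_homI)
    fix x a' assume x: "x \<in> carrier J" and "a' \<in> carrier A'"
    then obtain a where a: "a \<in> carrier A" "a' = \<pi> a" using D(9) by blast
    show "right_act J A i \<pi> x a' \<in> carrier J" using a x by (simp add: L)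
    show "right_act J A i \<pi> x (a' \<oplus>\<^bsub>A'\<^esub> b') = right_act J A i \<pi> x a' \<oplus>\<^bsub>J\<^esub> right_act J A i \<pi> x b'"
      if "b' \<in> carrier A'" for b'
    proof -
      from that obtain b where b: "b \<in> carrier A" "b' = \<pi> b" using D(9) by blast
      show ?thesis using a b x by (intro inj) (simp_all add: simps lin)
    qed
    show "right_act J A i \<pi> x (r \<odot>\<^bsub>A'\<^esub> a') = r \<odot>\<^bsub>J\<^esub> right_act J A i \<pi> x a'" if "r \<in> carrier R" for r
      using a x that by (intro inj) (simp_all add: simps lin)
  next
    fix a' assume "a' \<in> carrier A'"
    then obtain a where a: "a \<in> carrier A" "a' = \<pi> a" using D(9) by blast
    fix x assume x: "x \<in> carrier J"
    show "right_act J A i \<pi> x a' \<in> carrier J" using a x by (simp add: L)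
    show "right_act J A i \<pi> (x \<oplus>\<^bsub>J\<^esub> y) a' = right_act J A i \<pi> x a' \<oplus>\<^bsub>J\<^esub> right_act J A i \<pi> y a'" if "y \<in> carrier J" for y
      using a x that by (intro inj) (simp_all add: simps)
    show "right_act J A i \<pi> (r \<odot>\<^bsub>J\<^esub> x) a' = r \<odot>\<^bsub>J\<^esub> right_act J A i \<pi> x a'" if "r \<in> carrier R" for r
      using a x that by (intro inj) (simp_all add: simps)
  qed
qed

end

section \<open>The derivation property\<close>

definition Leibniz_defect ::
  "('r, 'l, 'u) chain_complex_scheme \<Rightarrow> (int \<Rightarrow> 'n \<Rightarrow> 'l) \<Rightarrow> (int \<Rightarrow> int \<Rightarrow> 'n \<Rightarrow> 'n \<Rightarrow> 'n) \<Rightarrow>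
   (int \<Rightarrow> int \<Rightarrow> 'l \<Rightarrow> 'n \<Rightarrow> 'l) \<Rightarrow> (int \<Rightarrow> int \<Rightarrow> 'n \<Rightarrow> 'l \<Rightarrow> 'l) \<Rightarrow> int \<Rightarrow> int \<Rightarrow> 'n \<Rightarrow> 'n \<Rightarrow> 'l" where
  "Leibniz_defect P \<tau> m mr ml p q x y = \<tau> (p + q) (m p q x y) \<oplus>\<^bsub>cmod P (p + q - 1)\<^esub>
     \<ominus>\<^bsub>cmod P (p + q - 1)\<^esub> (mr (p - 1) q (\<tau> p x) y \<oplus>\<^bsub>cmod P (p + q - 1)\<^esub>
       sign_act (cmod P (p + q - 1)) p (ml p (q - 1) x (\<tau> q y)))"

lemma projective_resolutionD:
  assumes "projective_resolution R M Q"
  shows "module R M" "is_complex R Q" "projective_module R (cmod Q n)"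
    "n < 0 \<Longrightarrow> carrier (cmod Q n) = {\<zero>\<^bsub>cmod Q n\<^esub>}" "n > 0 \<Longrightarrow> cycles Q n = boundaries Q n"
    "aug Q \<in> mod_hom R (cmod Q 0) M" "aug Q ` carrier (cmod Q 0) = carrier M"
    "\<lbrakk>x \<in> carrier (cmod Q 0); aug Q x = \<zero>\<^bsub>M\<^esub>\<rbrakk> \<Longrightarrow> x \<in> boundaries Q 0"
    "z \<in> carrier (cmod Q 1) \<Longrightarrow> aug Q (cdiff Q 1 z) = \<zero>\<^bsub>M\<^esub>"
proof -
  show "module R M" "is_complex R Q" "projective_module R (cmod Q n)"
    "n < 0 \<Longrightarrow> carrier (cmod Q n) = {\<zero>\<^bsub>cmod Q n\<^esub>}" "n > 0 \<Longrightarrow> cycles Q n = boundaries Q n"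
    "aug Q \<in> mod_hom R (cmod Q 0) M" "aug Q ` carrier (cmod Q 0) = carrier M"
    using assms by (simp_all add: projective_resolution_def)
  have ker: "{x \<in> carrier (cmod Q 0). aug Q x = \<zero>\<^bsub>M\<^esub>} = boundaries Q 0"
    using assms by (simp add: projective_resolution_def a_kernel_def')
  then show "\<lbrakk>x \<in> carrier (cmod Q 0); aug Q x = \<zero>\<^bsub>M\<^esub>\<rbrakk> \<Longrightarrow> x \<in> boundaries Q 0" by blast
  show "z \<in> carrier (cmod Q 1) \<Longrightarrow> aug Q (cdiff Q 1 z) = \<zero>\<^bsub>M\<^esub>"
    using ker by (auto simp: boundaries_def)
qed

text \<open>In degree 0 the homotopy is a lift of \<open>\<sigma> (x y) - \<sigma> x \<sigma> y\<close>, the failure of the linear section \<open>\<sigma>\<close> of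
  \<open>\<pi>\<close> on \<open>Q'\<^sub>0\<close> to be multiplicative.\<close>

lemma Leibniz_defect_null_homotopic:
  fixes P :: "('r, 'l, 'j) resolution" and Q :: "('r, 'm, 'a) resolution" and Q' :: "('r, 'n, 'b) resolution"
  assumes ext: "singular_extension R J A A' i \<pi>"
    and P: "projective_resolution R J P" and Q: "projective_resolution R A Q" and Q': "projective_resolution R A' Q'"
    and fi: "\<And>x. x \<in> carrier (cmod P 0) \<Longrightarrow> aug Q (f 0 x) = i (aug P x)"
    and g\<pi>: "\<And>x. x \<in> carrier (cmod Q 0) \<Longrightarrow> aug Q' (g 0 x) = \<pi> (aug Q x)"
    and split: "split_extension R P Q Q' f g s \<tau> \<rho>"
    and m: "dg_pairing R Q' Q' Q' m" and mr: "dg_pairing R P Q' P mr" and ml: "dg_pairing R Q' P P ml"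
    and aug_m: "\<And>x y. \<lbrakk>x \<in> carrier (cmod Q' 0); y \<in> carrier (cmod Q' 0)\<rbrakk> \<Longrightarrow>
        aug Q' (m 0 0 x y) = aug Q' x \<otimes>\<^bsub>A'\<^esub> aug Q' y"
    and aug_mr: "\<And>x y. \<lbrakk>x \<in> carrier (cmod P 0); y \<in> carrier (cmod Q' 0)\<rbrakk> \<Longrightarrow>
        aug P (mr 0 0 x y) = right_act J A i \<pi> (aug P x) (aug Q' y)"
    and aug_ml: "\<And>x y. \<lbrakk>x \<in> carrier (cmod Q' 0); y \<in> carrier (cmod P 0)\<rbrakk> \<Longrightarrow>
        aug P (ml 0 0 x y) = left_act J A i \<pi> (aug Q' x) (aug P y)"
  obtains h where "\<And>p q. h p q \<in> bilin R (cmod Q' p) (cmod Q' q) (cmod P (p + q))"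
    "\<And>p q x y. \<lbrakk>x \<in> carrier (cmod Q' p); y \<in> carrier (cmod Q' q)\<rbrakk> \<Longrightarrow>
      cdiff P (p + q) (h p q x y) = homotopy_rhs Q' Q' P (Leibniz_defect P \<tau> m mr ml) h p q x y"
proof -
  note E = singular_extensionD[OF ext] and D = split_extensionD[OF split]
  note rP = projective_resolutionD[OF P] and rQ = projective_resolutionD[OF Q] and rQ' = projective_resolutionD[OF Q']
  note cP = rP(2) and cQ = rQ(2) and cQ' = rQ'(2)
  note mP = complex_module[OF cP] and mQ' = complex_module[OF cQ']
  interpret A: assoc_algebra R A by (rule E(2))
  interpret A': assoc_algebra R A' by (rule E(3))
  interpret P0: module R "cmod P 0" by (rule mP)
  have anti: "anti_chain_map R Q' P \<tau>"
    unfolding anti_chain_map_def using D(4) split_extension_anticommute[OF cP cQ cQ' split] by blast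
  \<comment> \<open>Each of the three summands of the defect anticommutes with the differentials by
    itself.\<close>
  have AL: "anti_Leibniz R Q' Q' P (Leibniz_defect P \<tau> m mr ml)"
    unfolding Leibniz_defect_def[abs_def]
    by (rule anti_Leibniz_plus[OF cQ' cQ' cP anti_Leibniz_post[OF cQ' cQ' cQ' cP m anti]
          anti_Leibniz_uminus[OF cQ' cQ' cP anti_Leibniz_plus[OF cQ' cQ' cP
            anti_Leibniz_pre_left[OF cQ' cQ' cP cP mr anti] anti_Leibniz_pre_right[OF cQ' cQ' cP cP ml anti]]]])
  define \<sigma> where "\<sigma> x = aug Q (s 0 x)" for x
  \<comment> \<open>Comparing elements of \<open>P\<^sub>0\<close> through their images in
    \<open>A\<close> replaces the two actions by products in \<open>A\<close>.\<close>
  define ia where "ia x = i (aug P x)" for x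
  have \<sigma>: "\<sigma> \<in> mod_hom R (cmod Q' 0) A"
    unfolding \<sigma>_def[abs_def] by (rule mod_hom_comp[OF D(3) rQ(6)])
  have ia: "ia \<in> mod_hom R (cmod P 0) A"
    unfolding ia_def[abs_def] by (rule mod_hom_comp[OF rP(6) E(6)])
  note \<sigma>c = mod_hom_closed[OF \<sigma>] and iac = mod_hom_closed[OF ia]
  have \<pi>\<sigma>: "\<pi> (\<sigma> x) = aug Q' x" if "x \<in> carrier (cmod Q' 0)" for x
    unfolding \<sigma>_def using g\<pi>[OF mod_hom_closed[OF D(3) that]] D(8)[OF that] by simp
  \<comment> \<open>Because \<open>i\<close> is injective, \<open>ia\<close> and the augmentation of
    \<open>P\<close> have the same kernel.\<close>
  have ia_ker: "x \<in> boundaries P 0" if "x \<in> carrier (cmod P 0)" "ia x = \<zero>\<^bsub>A\<^esub>" for x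
  proof (rule rP(8)[OF that(1)])
    interpret J: module R J by (rule rP(1))
    have "i (aug P x) = i \<zero>\<^bsub>J\<^esub>" using that(2) mod_hom_zero[OF E(1,4,6)] by (simp add: ia_def)
    then show "aug P x = \<zero>\<^bsub>J\<^esub>"
      by (rule inj_onD[OF E(8) _ mod_hom_closed[OF rP(6) that(1)] J.zero_closed])
  qed
  \<comment> \<open>The augmentation of \<open>Q\<close> kills boundaries. Applied to
    \<open>d (s z) = f (\<tau> z) + s (d z)\<close>, it gives 0 on the left and the two terms in
    question on the right.\<close>
  have ia_\<tau>: "ia (\<tau> 1 z) = \<ominus>\<^bsub>A\<^esub> \<sigma> (cdiff Q' 1 z)" if z: "z \<in> carrier (cmod Q' 1)" for z
  proof -
    have \<tau>z: "\<tau> 1 z \<in> carrier (cmod P 0)" using mod_hom_closed[OF D(4) z] by simp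
    have dz: "cdiff Q' 1 z \<in> carrier (cmod Q' 0)" by (rule mod_hom_closed[OF complex_diff[OF cQ'] z]) simp
    have "aug Q (cdiff Q 1 (s 1 z)) = \<zero>\<^bsub>A\<^esub>" by (rule rQ(9)[OF mod_hom_closed[OF D(3) z]])
    moreover have "cdiff Q 1 (s 1 z) = f 0 (\<tau> 1 z) \<oplus>\<^bsub>cmod Q 0\<^esub> s 0 (cdiff Q' 1 z)"
      using D(9)[OF z] by simp
    ultimately have "ia (\<tau> 1 z) \<oplus>\<^bsub>A\<^esub> \<sigma> (cdiff Q' 1 z) = \<zero>\<^bsub>A\<^esub>"
      using mod_hom_add[OF rQ(6) mod_hom_closed[OF D(1) \<tau>z] mod_hom_closed[OF D(3) dz]] fi[OF \<tau>z]
      by (simp add: ia_def \<sigma>_def)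
    then show ?thesis using A.minus_equality[OF _ \<sigma>c[OF dz] iac[OF \<tau>z]] by simp
  qed
  \<comment> \<open>The element \<open>\<sigma> y\<close> is a lift of \<open>aug Q' y\<close>, so
    the action can be computed with it.\<close>
  have ia_mr: "ia (mr 0 0 x y) = ia x \<otimes>\<^bsub>A\<^esub> \<sigma> y" if "x \<in> carrier (cmod P 0)" "y \<in> carrier (cmod Q' 0)" for x y
    unfolding ia_def aug_mr[OF that] \<pi>\<sigma>[OF that(2), symmetric]
    by (rule right_act_lift(2)[OF ext \<sigma>c[OF that(2)] mod_hom_closed[OF rP(6) that(1)]])
  have ia_ml: "ia (ml 0 0 x y) = \<sigma> x \<otimes>\<^bsub>A\<^esub> ia y" if "x \<in> carrier (cmod Q' 0)" "y \<in> carrier (cmod P 0)" for x y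
    unfolding ia_def aug_ml[OF that] \<pi>\<sigma>[OF that(1), symmetric]
    by (rule left_act_lift(2)[OF ext \<sigma>c[OF that(1)] mod_hom_closed[OF rP(6) that(2)]])
  have m00: "m 0 0 \<in> bilin R (cmod Q' 0) (cmod Q' 0) (cmod Q' 0)" by (rule dg_pairing_bilin[OF m]) simp
  define b where "b x y = \<sigma> (m 0 0 x y) \<oplus>\<^bsub>A\<^esub> \<ominus>\<^bsub>A\<^esub> (\<sigma> x \<otimes>\<^bsub>A\<^esub> \<sigma> y)" for x y
  have b: "b \<in> bilin R (cmod Q' 0) (cmod Q' 0) A"
    unfolding b_def[abs_def]
    by (rule bilin_plus[OF E(4) bilin_comp_hom[OF m00 \<sigma>]
          bilin_uminus[OF E(4) bilin_comp_left[OF bilin_comp_right[OF assoc_algebra_mult_bilin[OF E(2)] \<sigma>] \<sigma>]]])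
  have b_img: "b x y \<in> ia ` carrier (cmod P 0)"
    if xy: "x \<in> carrier (cmod Q' 0)" "y \<in> carrier (cmod Q' 0)" for x y
  proof -
    have mxy: "m 0 0 x y \<in> carrier (cmod Q' 0)" by (rule bilin_closed[OF m00 xy])
    \<comment> \<open>Here \<pi> is multiplicative and \<open>m\<close> covers the product of
      \<open>A'\<close>, so \<open>b\<close> takes values in the kernel of \<pi>, which is the image
      of \<open>i\<close>.\<close>
    have "\<pi> (b x y) = aug Q' (m 0 0 x y) \<oplus>\<^bsub>A'\<^esub> \<ominus>\<^bsub>A'\<^esub> (aug Q' x \<otimes>\<^bsub>A'\<^esub> aug Q' y)"
      unfolding b_def using xy mxy
      by (simp add: mod_hom_add[OF E(7)] mod_hom_minus[OF E(4,5,7)] \<sigma>c E(12) \<pi>\<sigma>)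
    also have "\<dots> = \<zero>\<^bsub>A'\<^esub>"
      using xy aug_m[OF xy] by (simp add: A'.r_neg mod_hom_closed[OF rQ'(6)])
    finally have "b x y \<in> i ` carrier J" by (intro E(11) bilin_closed[OF b xy])
    then show ?thesis
      unfolding rP(7)[symmetric] ia_def[abs_def] by auto
  qed
  obtain h00 where h00: "h00 \<in> bilin R (cmod Q' 0) (cmod Q' 0) (cmod P 0)"
    and ia_h00: "\<And>x y. \<lbrakk>x \<in> carrier (cmod Q' 0); y \<in> carrier (cmod Q' 0)\<rbrakk> \<Longrightarrow> ia (h00 x y) = b x y"
    using projective_bilin_lift[OF rQ'(3) rQ'(3) E(4) mP ia b b_img] by metis
  \<comment> \<open>In total degree 0 every other bidegree has a negative index and hence a zero
    argument; in negative total degree the target is zero. Values in positive total degree are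
    replaced by the inductive construction.\<close>
  define h0 where "h0 p q = (if p = 0 \<and> q = 0 then h00 else (\<lambda>_ _. \<zero>\<^bsub>cmod P (p + q)\<^esub>))" for p q :: int
  have h0: "h0 p q \<in> bilin R (cmod Q' p) (cmod Q' q) (cmod P (p + q))" for p q
    using h00 by (simp add: h0_def bilin_null[OF mP])
  have rhs_closed: "homotopy_rhs Q' Q' P (Leibniz_defect P \<tau> m mr ml) h0 p q x y \<in> carrier (cmod P 0)"
    if pq: "p + q = 1" and xy: "x \<in> carrier (cmod Q' p)" "y \<in> carrier (cmod Q' q)" for p q x y
    using bilin_closed[OF homotopy_rhs_bilin[OF cQ' cQ' cP AL h0] xy] pq by simp
  have h0_rhs: "homotopy_rhs Q' Q' P (Leibniz_defect P \<tau> m mr ml) h0 p q x y \<in> boundaries P 0"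
    if pq: "p + q = 1" and x: "x \<in> carrier (cmod Q' p)" and y: "y \<in> carrier (cmod Q' q)" for p q x y
  proof -
    \<comment> \<open>If an index is negative, that argument is zero. The bidegrees that remain have
      to be computed.\<close>
    have "p < 0 \<or> q < 0 \<or> (p = 1 \<and> q = 0) \<or> (p = 0 \<and> q = 1)" using pq by linarith
    then consider "p < 0" | "q < 0" | "p = 1" "q = 0" | "p = 0" "q = 1" by blast
    then have "ia (homotopy_rhs Q' Q' P (Leibniz_defect P \<tau> m mr ml) h0 p q x y) = \<zero>\<^bsub>A\<^esub>"
    proof cases
      case 1
      then have "x = \<zero>\<^bsub>cmod Q' p\<^esub>" using rQ'(4) x by blast
      then show ?thesis
        using bilin_zero_left[OF mQ' mP homotopy_rhs_bilin[OF cQ' cQ' cP AL h0] y] pq mod_hom_zero[OF mP E(4) ia]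
        by simp
    next
      case 2
      then have "y = \<zero>\<^bsub>cmod Q' q\<^esub>" using rQ'(4) y by blast
      then show ?thesis
        using bilin_zero_right[OF mQ' mP homotopy_rhs_bilin[OF cQ' cQ' cP AL h0] x] pq mod_hom_zero[OF mP E(4) ia]
        by simp
    next
      case 3
      note x = x[unfolded 3] and y = y[unfolded 3]
      have dx: "cdiff Q' 1 x \<in> carrier (cmod Q' 0)" by (rule mod_hom_closed[OF complex_diff[OF cQ'] x]) simp
      have \<tau>x: "\<tau> 1 x \<in> carrier (cmod P 0)" using mod_hom_closed[OF D(4) x] by simp
      have mxy: "m 1 0 x y \<in> carrier (cmod Q' 1)" by (rule bilin_closed[OF dg_pairing_bilin[OF m] x y]) simp
      have \<tau>m: "\<tau> 1 (m 1 0 x y) \<in> carrier (cmod P 0)" using mod_hom_closed[OF D(4) mxy] by simp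
      have mr0: "mr 0 0 (\<tau> 1 x) y \<in> carrier (cmod P 0)" by (rule bilin_closed[OF dg_pairing_bilin[OF mr] \<tau>x y]) simp
      \<comment> \<open>In degree 0 both \<open>\<tau> y\<close> and \<open>d y\<close> land in
        modules of degree -1, which are zero. This removes the left action from the defect and one
        term from the Leibniz rule.\<close>
      have \<tau>y: "\<tau> 0 y = \<zero>\<^bsub>cmod P (-1)\<^esub>" using mod_hom_closed[OF D(4) y] rP(4)[of "-1"] by simp
      have ml0: "ml 1 (-1) x \<zero>\<^bsub>cmod P (-1)\<^esub> = \<zero>\<^bsub>cmod P 0\<^esub>"
        by (rule bilin_zero_right[OF mP mP dg_pairing_bilin[OF ml] x]) simp
      have dy: "cdiff Q' 0 y = \<zero>\<^bsub>cmod Q' (-1)\<^esub>"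
        using mod_hom_closed[OF complex_diff[OF cQ', of "-1" 0] y] rQ'(4)[of "-1"] by simp
      have m0: "m 1 (-1) x \<zero>\<^bsub>cmod Q' (-1)\<^esub> = \<zero>\<^bsub>cmod Q' 0\<^esub>"
        by (rule bilin_zero_right[OF mQ' mQ' dg_pairing_bilin[OF m] x]) simp
      interpret Q'0: module R "cmod Q' 0" by (rule mQ')
      have dm: "cdiff Q' 1 (m 1 0 x y) = m 0 0 (cdiff Q' 1 x) y"
        using dg_pairing_Leibniz[OF m x y, of 1 0] bilin_closed[OF m00 dx y]
        by (simp add: dy m0 sign_act_zero[OF mQ'])
      have hx: "h00 (cdiff Q' 1 x) y \<in> carrier (cmod P 0)" by (rule bilin_closed[OF h00 dx y])
      have "homotopy_rhs Q' Q' P (Leibniz_defect P \<tau> m mr ml) h0 1 0 x y =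
          (\<tau> 1 (m 1 0 x y) \<oplus>\<^bsub>cmod P 0\<^esub> \<ominus>\<^bsub>cmod P 0\<^esub> mr 0 0 (\<tau> 1 x) y) \<oplus>\<^bsub>cmod P 0\<^esub> h00 (cdiff Q' 1 x) y"
        using mr0 hx by (simp add: homotopy_rhs_def Leibniz_defect_def h0_def \<tau>y ml0 sign_act_zero[OF mP])
      \<comment> \<open>The first bracket comes from the defect and equals
        \<open>- b (d x) y\<close>; the second is \<open>b (d x) y\<close>, the contribution of
        \<open>h00\<close>.\<close>
      then have "ia (homotopy_rhs Q' Q' P (Leibniz_defect P \<tau> m mr ml) h0 1 0 x y) =
          (\<ominus>\<^bsub>A\<^esub> \<sigma> (m 0 0 (cdiff Q' 1 x) y) \<oplus>\<^bsub>A\<^esub> \<sigma> (cdiff Q' 1 x) \<otimes>\<^bsub>A\<^esub> \<sigma> y) \<oplus>\<^bsub>A\<^esub>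
          (\<sigma> (m 0 0 (cdiff Q' 1 x) y) \<oplus>\<^bsub>A\<^esub> \<ominus>\<^bsub>A\<^esub> (\<sigma> (cdiff Q' 1 x) \<otimes>\<^bsub>A\<^esub> \<sigma> y))"
        using \<tau>m mr0 hx dx y
        by (simp add: mod_hom_add[OF ia] mod_hom_minus[OF mP E(4) ia] ia_\<tau>[OF mxy] ia_\<tau>[OF x] ia_mr[OF \<tau>x y]
            ia_h00[OF dx y] dm b_def A.l_minus \<sigma>c)
      also have "\<dots> = \<zero>\<^bsub>A\<^esub>"
        using \<sigma>c[OF bilin_closed[OF m00 dx y]] \<sigma>c[OF dx] \<sigma>c[OF y]
        by (simp add: A.a_ac A.r_neg A.r_neg1 A.r_neg2 A.l_neg)
      finally show ?thesis by (simp add: 3)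
    next
      case 4
      note x = x[unfolded 4] and y = y[unfolded 4]
      have dy: "cdiff Q' 1 y \<in> carrier (cmod Q' 0)" by (rule mod_hom_closed[OF complex_diff[OF cQ'] y]) simp
      have \<tau>y: "\<tau> 1 y \<in> carrier (cmod P 0)" using mod_hom_closed[OF D(4) y] by simp
      have mxy: "m 0 1 x y \<in> carrier (cmod Q' 1)" by (rule bilin_closed[OF dg_pairing_bilin[OF m] x y]) simp
      have \<tau>m: "\<tau> 1 (m 0 1 x y) \<in> carrier (cmod P 0)" using mod_hom_closed[OF D(4) mxy] by simp
      have ml0: "ml 0 0 x (\<tau> 1 y) \<in> carrier (cmod P 0)" by (rule bilin_closed[OF dg_pairing_bilin[OF ml] x \<tau>y]) simp
      have \<tau>x: "\<tau> 0 x = \<zero>\<^bsub>cmod P (-1)\<^esub>" using mod_hom_closed[OF D(4) x] rP(4)[of "-1"] by simp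
      have mr0: "mr (-1) 1 \<zero>\<^bsub>cmod P (-1)\<^esub> y = \<zero>\<^bsub>cmod P 0\<^esub>"
        by (rule bilin_zero_left[OF mP mP dg_pairing_bilin[OF mr] y]) simp
      have dx: "cdiff Q' 0 x = \<zero>\<^bsub>cmod Q' (-1)\<^esub>"
        using mod_hom_closed[OF complex_diff[OF cQ', of "-1" 0] x] rQ'(4)[of "-1"] by simp
      have m0: "m (-1) 1 \<zero>\<^bsub>cmod Q' (-1)\<^esub> y = \<zero>\<^bsub>cmod Q' 0\<^esub>"
        by (rule bilin_zero_left[OF mQ' mQ' dg_pairing_bilin[OF m] y]) simp
      interpret Q'0: module R "cmod Q' 0" by (rule mQ')
      have dm: "cdiff Q' 1 (m 0 1 x y) = m 0 0 x (cdiff Q' 1 y)"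
        using dg_pairing_Leibniz[OF m x y, of 1 0] bilin_closed[OF m00 x dy]
        by (simp add: dx m0 sign_act_def)
      have hy: "h00 x (cdiff Q' 1 y) \<in> carrier (cmod P 0)" by (rule bilin_closed[OF h00 x dy])
      have "homotopy_rhs Q' Q' P (Leibniz_defect P \<tau> m mr ml) h0 0 1 x y =
          (\<tau> 1 (m 0 1 x y) \<oplus>\<^bsub>cmod P 0\<^esub> \<ominus>\<^bsub>cmod P 0\<^esub> ml 0 0 x (\<tau> 1 y)) \<oplus>\<^bsub>cmod P 0\<^esub> h00 x (cdiff Q' 1 y)"
        using ml0 hy by (simp add: homotopy_rhs_def Leibniz_defect_def h0_def \<tau>x mr0 sign_act_def)
      \<comment> \<open>As before, with \<open>- b x (d y)\<close> from the defect and
        \<open>b x (d y)\<close> from \<open>h00\<close>.\<close>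
      then have "ia (homotopy_rhs Q' Q' P (Leibniz_defect P \<tau> m mr ml) h0 0 1 x y) =
          (\<ominus>\<^bsub>A\<^esub> \<sigma> (m 0 0 x (cdiff Q' 1 y)) \<oplus>\<^bsub>A\<^esub> \<sigma> x \<otimes>\<^bsub>A\<^esub> \<sigma> (cdiff Q' 1 y)) \<oplus>\<^bsub>A\<^esub>
          (\<sigma> (m 0 0 x (cdiff Q' 1 y)) \<oplus>\<^bsub>A\<^esub> \<ominus>\<^bsub>A\<^esub> (\<sigma> x \<otimes>\<^bsub>A\<^esub> \<sigma> (cdiff Q' 1 y)))"
        using \<tau>m ml0 hy dy x
        by (simp add: mod_hom_add[OF ia] mod_hom_minus[OF mP E(4) ia] ia_\<tau>[OF mxy] ia_\<tau>[OF y] ia_ml[OF x \<tau>y]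
            ia_h00[OF x dy] dm b_def A.r_minus \<sigma>c)
      also have "\<dots> = \<zero>\<^bsub>A\<^esub>"
        using \<sigma>c[OF bilin_closed[OF m00 x dy]] \<sigma>c[OF dy] \<sigma>c[OF x]
        by (simp add: A.a_ac A.r_neg A.r_neg1 A.r_neg2 A.l_neg)
      finally show ?thesis by (simp add: 4)
    qed
    then show ?thesis by (rule ia_ker[OF rhs_closed[OF that]])
  qed
  show ?thesis
    by (rule anti_Leibniz_null_homotopic[OF cQ' cQ' cP AL rQ'(3) rQ'(3) rP(4) rP(5) h0 h0_rhs that])
qed

text \<open>The homotopy relation survives base change. At a pair of cycles its terms with
  \<open>d u\<close> and \<open>d v\<close> vanish, so the defect is the boundary of
  \<open>h u v\<close>; solved for the term with \<tau> on the product, this is the derivation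
  formula on cycles up to a boundary.\<close>

lemma base_change_Leibniz_defect:
  assumes T: "algebra R T" and X: "is_complex R X" and P: "is_complex R P" and anti: "anti_chain_map R X P \<tau>"
    and m: "dg_pairing R X X X m" and mr: "dg_pairing R P X P mr" and ml: "dg_pairing R X P P ml"
    and h: "\<And>p q. h p q \<in> bilin R (cmod X p) (cmod X q) (cmod P (p + q))"
    and rel: "\<And>p q x y. \<lbrakk>x \<in> carrier (cmod X p); y \<in> carrier (cmod X q)\<rbrakk> \<Longrightarrow>
      cdiff P (p + q) (h p q x y) = homotopy_rhs X X P (Leibniz_defect P \<tau> m mr ml) h p q x y"
    and u: "u \<in> cycles (base_change R T X) p" and v: "v \<in> cycles (base_change R T X) q" and n: "n = p + q - 1"
  shows "tensor_map R T (cmod P n) id (\<tau> (p + q)) (base_pairing R T (cmod X (p + q)) (m p q) u v) =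
    (base_pairing R T (cmod P n) (mr (p - 1) q) (tensor_map R T (cmod P (p - 1)) id (\<tau> p) u) v
      \<oplus>\<^bsub>tensor R T (cmod P n)\<^esub> sign_act (tensor R T (cmod P n)) p
      (base_pairing R T (cmod P n) (ml p (q - 1)) u (tensor_map R T (cmod P (q - 1)) id (\<tau> q) v)))
    \<oplus>\<^bsub>tensor R T (cmod P n)\<^esub> cdiff (base_change R T P) (p + q) (base_pairing R T (cmod P (p + q)) (h p q) u v)"
proof -
  note mT = algebra.module[OF T]
  interpret T: algebra R T by fact
  note mX = complex_module[OF X] and mP = complex_module[OF P]
  note dX = complex_diff[OF X refl]
  let ?N = "cmod P n" and ?TN = "tensor R T (cmod P n)"
  have e: "p - 1 + q = n" "p + (q - 1) = n" "p + q - 1 = n" using n by simp_all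
  note mTN = module_tensor[OF mT mP[of n]]
  interpret N: module R ?N by (rule mP)
  interpret TN: module R ?TN by (rule mTN)
  have \<tau>pq: "\<tau> (p + q) \<in> mod_hom R (cmod X (p + q)) ?N" by (rule anti_chain_map_hom[OF anti n])
  note \<tau> = anti_chain_map_hom[OF anti refl]
  have bm: "m p q \<in> bilin R (cmod X p) (cmod X q) (cmod X (p + q))" by (rule dg_pairing_bilin[OF m refl])
  have bmr: "mr (p - 1) q \<in> bilin R (cmod P (p - 1)) (cmod X q) ?N" by (rule dg_pairing_bilin[OF mr]) (simp add: n)
  have bml: "ml p (q - 1) \<in> bilin R (cmod X p) (cmod P (q - 1)) ?N" by (rule dg_pairing_bilin[OF ml]) (simp add: n)
  have hl: "h (p - 1) q \<in> bilin R (cmod X (p - 1)) (cmod X q) ?N" using h[of "p - 1" q] by (simp only: e)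
  have hr: "h p (q - 1) \<in> bilin R (cmod X p) (cmod X (q - 1)) ?N" using h[of p "q - 1"] by (simp only: e)
  have dP: "cdiff P (p + q) \<in> mod_hom R (cmod P (p + q)) ?N" by (rule complex_diff[OF P n])
  note Bm = base_pairing_bilin[OF T mX mX mX bm] and Bmr = base_pairing_bilin[OF T mP mX mP bmr]
    and Bml = base_pairing_bilin[OF T mX mP mP bml] and Bh = base_pairing_bilin[OF T mX mX mP h]
    and Bhl = base_pairing_bilin[OF T mX mX mP hl] and Bhr = base_pairing_bilin[OF T mX mX mP hr]
  note pure = base_pairing_pure[OF T mX mX mX bm] base_pairing_pure[OF T mP mX mP bmr]
    base_pairing_pure[OF T mX mP mP bml] base_pairing_pure[OF T mX mX mP h]
    base_pairing_pure[OF T mX mX mP hl] base_pairing_pure[OF T mX mX mP hr]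
    base_map_pure[OF mT mX mP \<tau>] base_map_pure[OF mT mX mP \<tau>pq] base_map_pure[OF mT mX mX dX]
    base_map_pure[OF mT mP mP dP]
  note closed = bilin_closed[OF bm] bilin_closed[OF bmr] bilin_closed[OF bml] bilin_closed[OF h] bilin_closed[OF hl]
    bilin_closed[OF hr] mod_hom_closed[OF \<tau>] mod_hom_closed[OF \<tau>pq] mod_hom_closed[OF dX]
    sign_act_closed[OF mP]
  let ?lhs = "\<lambda>u v. tensor_map R T ?N id (cdiff P (p + q)) (base_pairing R T (cmod P (p + q)) (h p q) u v)"
  let ?a = "\<lambda>u v. tensor_map R T ?N id (\<tau> (p + q)) (base_pairing R T (cmod X (p + q)) (m p q) u v)"
  let ?b = "\<lambda>u v. base_pairing R T ?N (mr (p - 1) q) (tensor_map R T (cmod P (p - 1)) id (\<tau> p) u) v"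
  let ?c = "\<lambda>u v. base_pairing R T ?N (ml p (q - 1)) u (tensor_map R T (cmod P (q - 1)) id (\<tau> q) v)"
  let ?hl = "\<lambda>u v. base_pairing R T ?N (h (p - 1) q) (tensor_map R T (cmod X (p - 1)) id (cdiff X p) u) v"
  let ?hr = "\<lambda>u v. base_pairing R T ?N (h p (q - 1)) u (tensor_map R T (cmod X (q - 1)) id (cdiff X q) v)"
  let ?B = "bilin R (tensor R T (cmod X p)) (tensor R T (cmod X q)) ?TN"
  have lhs: "?lhs \<in> ?B" by (rule bilin_comp_hom[OF Bh base_map_hom[OF mT mP mP dP]])
  have a: "?a \<in> ?B" by (rule bilin_comp_hom[OF Bm base_map_hom[OF mT mX mP \<tau>pq]])
  have b: "?b \<in> ?B" by (rule bilin_comp_left[OF Bmr base_map_hom[OF mT mX mP \<tau>]])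
  have c: "?c \<in> ?B" by (rule bilin_comp_right[OF Bml base_map_hom[OF mT mX mP \<tau>]])
  have hl': "?hl \<in> ?B" by (rule bilin_comp_left[OF Bhl base_map_hom[OF mT mX mX dX]])
  have hr': "?hr \<in> ?B" by (rule bilin_comp_right[OF Bhr base_map_hom[OF mT mX mX dX]])
  let ?rhs = "\<lambda>u v. (?a u v \<oplus>\<^bsub>?TN\<^esub> \<ominus>\<^bsub>?TN\<^esub> (?b u v \<oplus>\<^bsub>?TN\<^esub> sign_act ?TN p (?c u v))) \<oplus>\<^bsub>?TN\<^esub>
    (?hl u v \<oplus>\<^bsub>?TN\<^esub> sign_act ?TN p (?hr u v))"
  have rhs: "?rhs \<in> ?B"
    by (rule bilin_plus[OF mTN bilin_plus[OF mTN a bilin_uminus[OF mTN bilin_plus[OF mTN b bilin_sign_act[OF mTN c]]]]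
          bilin_plus[OF mTN hl' bilin_sign_act[OF mTN hr']]])
  note uc = cyclesD[OF u, unfolded base_change_simps] and vc = cyclesD[OF v, unfolded base_change_simps]
  \<comment> \<open>The reduction to pure tensors leaves the cycles, since a cycle need not be a sum
    of pure tensors that are cycles. The full relation is therefore proved first, and only
    afterwards are the terms with differentials dropped.\<close>
  have key: "?lhs u v = ?rhs u v"
  proof (rule tensor_bilin_eqI[OF mT mX mT mX mTN lhs rhs _ uc(1) vc(1)])
    fix t x t' y
    assume txy: "t \<in> carrier T" "x \<in> carrier (cmod X p)" "t' \<in> carrier T" "y \<in> carrier (cmod X q)"
    have tt: "t \<otimes>\<^bsub>T\<^esub> t' \<in> carrier T" using txy by simp
    note L = bilin_right[OF pure_tensor_bilin[OF mT mP[of n]] tt]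
    note lin = mod_hom_add[OF L] mod_hom_minus[OF N.module_axioms mTN L] mod_hom_sign[OF N.module_axioms mTN L]
    show "?lhs (pure_tensor R T (cmod X p) t x) (pure_tensor R T (cmod X q) t' y) =
        ?rhs (pure_tensor R T (cmod X p) t x) (pure_tensor R T (cmod X q) t' y)"
      using txy tt by (simp add: pure closed rel homotopy_rhs_def Leibniz_defect_def n[symmetric] lin)
  qed
  have "?hl u v = \<zero>\<^bsub>?TN\<^esub>" "?hr u v = \<zero>\<^bsub>?TN\<^esub>"
    using bilin_zero_left[OF module_tensor[OF mT mX] mTN Bhl vc(1)] bilin_zero_right[OF module_tensor[OF mT mX] mTN Bhr uc(1)]
    by (simp_all only: uc(2) vc(2))
  then have eq: "?lhs u v = ?a u v \<oplus>\<^bsub>?TN\<^esub> \<ominus>\<^bsub>?TN\<^esub> (?b u v \<oplus>\<^bsub>?TN\<^esub> sign_act ?TN p (?c u v))"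
    using key bilin_closed[OF a uc(1) vc(1)] bilin_closed[OF b uc(1) vc(1)]
      sign_act_closed[OF mTN bilin_closed[OF c uc(1) vc(1)]]
    by (simp add: sign_act_zero[OF mTN])
  have move: "z = y \<oplus>\<^bsub>?TN\<^esub> w"
    if "w = z \<oplus>\<^bsub>?TN\<^esub> \<ominus>\<^bsub>?TN\<^esub> y" "z \<in> carrier ?TN" "y \<in> carrier ?TN" for w y z
    using that by (simp add: TN.a_comm[of z] TN.r_neg2)
  show ?thesis
    unfolding base_change_simps(2) e
    by (rule move[OF eq bilin_closed[OF a uc(1) vc(1)] TN.a_closed[OF bilin_closed[OF b uc(1) vc(1)]
        sign_act_closed[OF mTN bilin_closed[OF c uc(1) vc(1)]]]])
qed

theorem proposition2:
  fixes R :: "('r, 'x) ring_scheme"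
    and T :: "('r, 't) module"
    and J :: "('r, 'j) module"
    and A :: "('r, 'a) module"
    and A' :: "('r, 'b) module"
    and i :: "'j \<Rightarrow> 'a"
    and \<pi> :: "'a \<Rightarrow> 'b"
    and P :: "('r, 'l, 'j) resolution"
    and Q :: "('r, 'm, 'a) resolution"
    and Q' :: "('r, 'n, 'b) resolution"
    and f :: "int \<Rightarrow> 'l \<Rightarrow> 'm"
    and g :: "int \<Rightarrow> 'm \<Rightarrow> 'n"
    and p q :: int
  assumes "cring R"
    and "singular_extension R J A A' i \<pi>"
    and "algebra R T"
    and "projective_resolution R J P"
    and "projective_resolution R A Q"
    and "projective_resolution R A' Q'"
    and "short_exact_complexes R P Q Q' f g"
    and "\<forall>x\<in>carrier (cmod P 0). aug Q (f 0 x) = i (aug P x)"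
    and "\<forall>x\<in>carrier (cmod Q 0). aug Q' (g 0 x) = \<pi> (aug Q x)"
    and "lifts_pairing R A' A' A' (\<lambda>a b. a \<otimes>\<^bsub>A'\<^esub> b) Q' Q' Q' \<mu>"
    and "lifts_pairing R A' J J (left_act J A i \<pi>) Q' P P \<mu>l"
    and "lifts_pairing R J A' J (right_act J A i \<pi>) P Q' P \<mu>r"
    and "\<alpha> \<in> carrier (Tor R T Q' p)"
    and "\<beta> \<in> carrier (Tor R T Q' q)"
  shows "connecting R T P Q Q' f g (p + q) (Tor_pairing R T Q' Q' Q' \<mu> p q \<alpha> \<beta>) =
    Tor_pairing R T P Q' P \<mu>r (p - 1) q (connecting R T P Q Q' f g p \<alpha>) \<beta>
    \<oplus>\<^bsub>Tor R T P (p + q - 1)\<^esub>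
    sign_act (Tor R T P (p + q - 1)) p
      (Tor_pairing R T Q' P P \<mu>l p (q - 1) \<alpha> (connecting R T P Q Q' f g q \<beta>))"
proof -
  note T = assms(3)
  note mT = algebra.module[OF T]
  note E = singular_extensionD[OF assms(2)]
  note rP = projective_resolutionD[OF assms(4)] and rQ = projective_resolutionD[OF assms(5)]
    and rQ' = projective_resolutionD[OF assms(6)]
  note cP = rP(2) and cQ = rQ(2) and cQ' = rQ'(2)
  note bP = is_complex_base_change[OF mT cP] and bQ' = is_complex_base_change[OF mT cQ']
  have \<mu>: "chain_map R (tensor_complex R Q' Q') Q' \<mu>" and \<mu>l: "chain_map R (tensor_complex R Q' P) P \<mu>l"
    and \<mu>r: "chain_map R (tensor_complex R P Q') P \<mu>r"
    using assms(10-12) by (simp_all add: lifts_pairing_def)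
  let ?m = "chain_bilin R Q' Q' \<mu>" and ?ml = "chain_bilin R Q' P \<mu>l" and ?mr = "chain_bilin R P Q' \<mu>r"
  have m: "dg_pairing R Q' Q' Q' ?m" and ml: "dg_pairing R Q' P P ?ml" and mr: "dg_pairing R P Q' P ?mr"
    using assms(1) cP cQ' \<mu> \<mu>l \<mu>r by (simp_all add: dg_pairing_chain_bilin)
  \<comment> \<open>The splitting and the homotopy are auxiliary choices: the operations on Tor in
    the claim are independent of them and can be computed from them.\<close>
  obtain s \<tau> \<rho> where split: "split_extension R P Q Q' f g s \<tau> \<rho>"
    using split_extension_exists[OF cP cQ cQ' rQ(3) rQ'(3) assms(7)] by metis
  have anti: "anti_chain_map R Q' P \<tau>"
    unfolding anti_chain_map_def
    using split_extensionD(4)[OF split] split_extension_anticommute[OF cP cQ cQ' split] by blast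
  obtain h where h: "\<And>p q. h p q \<in> bilin R (cmod Q' p) (cmod Q' q) (cmod P (p + q))"
    and rel: "\<And>p q x y. \<lbrakk>x \<in> carrier (cmod Q' p); y \<in> carrier (cmod Q' q)\<rbrakk> \<Longrightarrow>
      cdiff P (p + q) (h p q x y) = homotopy_rhs Q' Q' P (Leibniz_defect P \<tau> ?m ?mr ?ml) h p q x y"
    by (rule Leibniz_defect_null_homotopic[OF assms(2,4,5,6) assms(8)[rule_format] assms(9)[rule_format] split m mr ml
          chain_bilin_aug[OF cQ' cQ' E(5,5,5) assms(10) assoc_algebra_mult_bilin[OF E(3)] rQ'(6) rQ'(6)]
          chain_bilin_aug[OF cP cQ' E(1,5,1) assms(12) right_act_bilin[OF assms(2)] rP(6) rQ'(6)]
          chain_bilin_aug[OF cQ' cP E(5,1,1) assms(11) left_act_bilin[OF assms(2)] rQ'(6) rP(6)]]) (assumption | rule that)+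
  let ?BP = "base_change R T P" and ?BQ' = "base_change R T Q'"
  let ?\<tau> = "\<lambda>n. tensor_map R T (cmod P (n - 1)) id (\<tau> n)"
  let ?n = "p + q - 1"
  \<comment> \<open>The pairings with \<open>P\<close> are indexed by \<open>p - 1 + q\<close> and
    \<open>p + (q - 1)\<close>; both have to be rewritten to one index before classes can be
    added.\<close>
  have n: "p - 1 + q = ?n" "p + (q - 1) = ?n" "?n + 1 = p + q" by simp_all
  \<comment> \<open>One pair of representing cycles serves all three products and all three
    connecting maps, so the claim becomes an equation between classes of explicit chains.\<close>
  obtain u v where u: "u \<in> \<alpha>" "u \<in> cycles ?BQ' p" and v: "v \<in> \<beta>" "v \<in> cycles ?BQ' q"
    using homology_carrierE[OF assms(13)[unfolded Tor_def]] homology_carrierE[OF assms(14)[unfolded Tor_def]]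
      homology_class_self[OF bQ'] by metis
  note split' = split_extension_base_change[OF mT cP cQ cQ' split]
  note \<tau>_cycle = split_extension_cycle[OF bP is_complex_base_change[OF mT cQ] bQ' split']
  let ?mT = "base_pairing R T (cmod Q' (p + q)) (?m p q) u v"
  let ?mrT = "base_pairing R T (cmod P ?n) (?mr (p - 1) q) (?\<tau> p u) v"
  let ?mlT = "base_pairing R T (cmod P ?n) (?ml p (q - 1)) u (?\<tau> q v)"
  have m_cycle: "?mT \<in> cycles ?BQ' (p + q)"
    by (rule dg_pairing_cycle[OF bQ' bQ' bQ' dg_pairing_base_change[OF T cQ' cQ' cQ' m] u(2) v(2) refl])
  have mr_cycle: "?mrT \<in> cycles ?BP ?n"
    using dg_pairing_cycle[OF bP bQ' bP dg_pairing_base_change[OF T cP cQ' cP mr] \<tau>_cycle[OF u(2)] v(2) refl]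
    by (simp only: n)
  have ml_cycle: "?mlT \<in> cycles ?BP ?n"
    using dg_pairing_cycle[OF bQ' bP bP dg_pairing_base_change[OF T cQ' cP cP ml] u(2) \<tau>_cycle[OF v(2)] refl]
    by (simp only: n)
  have hT: "base_pairing R T (cmod P (p + q)) (h p q) u v \<in> carrier (cmod ?BP (?n + 1))"
    unfolding n base_change_simps
    using bilin_closed[OF base_pairing_bilin[OF T complex_module[OF cQ'] complex_module[OF cQ'] complex_module[OF cP] h]]
      cyclesD(1)[OF u(2)] cyclesD(1)[OF v(2)] by (simp add: base_change_simps)
  interpret N: module R "cmod ?BP ?n" by (rule complex_module[OF bP])
  have sign_ml: "sign_act (cmod ?BP ?n) p ?mlT \<in> cycles ?BP ?n"
    using N.submoduleE(3)[OF cycles_submodule[OF bP] ml_cycle] ml_cycle by (simp add: sign_act_def)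
  have \<tau>_class: "homology_class ?BP (k - 1) (?\<tau> k w) \<in> carrier (Tor R T P (k - 1))"
    "?\<tau> k w \<in> homology_class ?BP (k - 1) (?\<tau> k w)" if "w \<in> cycles ?BQ' k" for k w
    using homology_class_closed[OF \<tau>_cycle[OF that]] homology_class_self[OF bP \<tau>_cycle[OF that]] by (simp_all add: Tor_def)
  have "connecting R T P Q Q' f g (p + q) (Tor_pairing R T Q' Q' Q' \<mu> p q \<alpha> \<beta>) =
      homology_class ?BP ?n (?\<tau> (p + q) ?mT)"
    unfolding Tor_pairing_eq[OF T cQ' cQ' cQ' \<mu> assms(13) u(1) assms(14) v(1)]
    by (rule connecting_eq[OF mT cP cQ cQ' split _ homology_class_self[OF bQ' m_cycle]])
      (simp add: Tor_def homology_class_closed[OF m_cycle])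
  \<comment> \<open>The two chains differ by the boundary of the base-changed homotopy at
    \<open>u\<close> and \<open>v\<close>.\<close>
  also have "\<dots> = homology_class ?BP ?n (?mrT \<oplus>\<^bsub>cmod ?BP ?n\<^esub> sign_act (cmod ?BP ?n) p ?mlT)"
    by (rule homology_class_eqI[OF bP N.a_closed[OF cyclesD(1)[OF mr_cycle] cyclesD(1)[OF sign_ml]] hT])
      (use base_change_Leibniz_defect[OF T cQ' cP anti m mr ml h rel u(2) v(2) refl]
        in \<open>simp only: n base_change_simps(1)\<close>)
  also have "\<dots> = homology_class ?BP ?n ?mrT \<oplus>\<^bsub>Tor R T P ?n\<^esub> sign_act (Tor R T P ?n) p (homology_class ?BP ?n ?mlT)"
    unfolding Tor_def homology_class_add[OF bP mr_cycle sign_ml] homology_class_sign[OF bP ml_cycle] ..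
  \<comment> \<open>The chain \<open>\<tau> u\<close> represents the connecting image of \<alpha>,
    so this class is the product formed with that representative and \<open>v\<close>.\<close>
  also have "homology_class ?BP ?n ?mrT =
      Tor_pairing R T P Q' P \<mu>r (p - 1) q (connecting R T P Q Q' f g p \<alpha>) \<beta>"
    unfolding connecting_eq[OF mT cP cQ cQ' split assms(13) u(1)]
      Tor_pairing_eq[OF T cP cQ' cP \<mu>r \<tau>_class[OF u(2)] assms(14) v(1)] n ..
  also have "homology_class ?BP ?n ?mlT =
      Tor_pairing R T Q' P P \<mu>l p (q - 1) \<alpha> (connecting R T P Q Q' f g q \<beta>)"
    unfolding connecting_eq[OF mT cP cQ cQ' split assms(14) v(1)]
      Tor_pairing_eq[OF T cQ' cP cP \<mu>l assms(13) u(1) \<tau>_class[OF v(2)]] n ..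
  finally show ?thesis .
qed

end
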